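(* Let $\{S_i\}_{i\in I}$ be a family of intervals of $\mathbb R$ with $\operatorname{cl}(S_i)\cap\operatorname{cl}(S_j)=\emptyset$ for any $i\neq j\in I$, let $F$ be a subfield of $\mathbb R$, and set $A=(F,+)$, $P=(F^+,\cdot)$ (where $F^+$ is the set of positive elements of $F$) and $S=\bigcup_{i\in I}S_i$. Then the pseudocentre of $G(S;A,P)$ is its commutator subgroup.
   Context: For a group $G$, the pseudocentre is $\bigcap_{x\in G}C_G(x)^G$, where $C_G(x)$ is the centralizer of $x$ in $G$ and, for a subgroup $H\leq G$, $H^G$ is the normal closure of $H$ in $G$. $\operatorname{cl}$ denotes closure in $\mathbb R$. $\operatorname{PL_o}(\mathbb R)$ is the group of all orientation-preserving piecewise linear homeomorphisms of $\mathbb R$ with only finitely many points of non-differentiability (breaks). Given $S\subseteq\mathbb R$ a union of intervals, a subgroup $P$ of the multiplicative group of positive reals and a $\mathbb Z[P]$-submodule $A$ of $(\mathbb R,+)$, $G(S;A,P)$ is the subgroup of all $f\in\operatorname{PL_o}(\mathbb R)$ whose support $\{x: f(x)\neq x\}$ is contained in $S$, whose slopes all lie in $P$, and whose breaks all lie in $A$, with the further condition that, if $S=\mathbb R$, every $f\in G(S;A,P)$ maps $A$ onto itself. *)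

theory Defs
  imports "HOL-Algebra.Algebra" "HOL-Algebra.Algebraic_Closure_Type" "HOL-Analysis.Analysis"
begin

definition centralizer :: "('a, 'b) monoid_scheme \<Rightarrow> 'a \<Rightarrow> 'a set" where
  "centralizer G x = {g \<in> carrier G. g \<otimes>\<^bsub>G\<^esub> x = x \<otimes>\<^bsub>G\<^esub> g}"

definition normal_closure :: "('a, 'b) monoid_scheme \<Rightarrow> 'a set \<Rightarrow> 'a set" where
  "normal_closure G H = \<Inter>{N. N \<lhd> G \<and> H \<subseteq> N}"

definition pseudocentre :: "('a, 'b) monoid_scheme \<Rightarrow> 'a set" where
  "pseudocentre G = (\<Inter>x\<in>carrier G. normal_closure G (centralizer G x))"

definition piecewise_linear :: "(real \<Rightarrow> real) \<Rightarrow> bool" where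
  "piecewise_linear f \<longleftrightarrow>
     (\<exists>B. (\<forall>a b. finite (B \<inter> {a..b})) \<and>
          (\<forall>a b. {a<..<b} \<inter> B = {} \<longrightarrow> (\<exists>m c. \<forall>x\<in>{a<..<b}. f x = m * x + c)))"

definition breaks :: "(real \<Rightarrow> real) \<Rightarrow> real set" where
  "breaks f = {x. \<not> f differentiable (at x)}"

definition slopes :: "(real \<Rightarrow> real) \<Rightarrow> real set" where
  "slopes f = deriv f ` (- breaks f)"

definition supp :: "(real \<Rightarrow> real) \<Rightarrow> real set" where
  "supp f = {x. f x \<noteq> x}"

definition PLo :: "(real \<Rightarrow> real) monoid" where
  "PLo = \<lparr>carrier = {f. (\<exists>g. homeomorphism UNIV UNIV f g) \<and> strict_mono f \<and>
                        piecewise_linear f \<and> finite (breaks f)},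
          monoid.mult = (\<circ>), one = id\<rparr>"

(* The definition makes sense for arbitrary sets A and P; the structure "P a group of positive
   reals, A a Z[P]-module" is a hypothesis of the theorems about PL_grp, not part of it. *)
definition PL_grp :: "real set \<Rightarrow> real set \<Rightarrow> real set \<Rightarrow> (real \<Rightarrow> real) monoid" where
  "PL_grp S A P = PLo\<lparr>carrier := {f \<in> carrier PLo. supp f \<subseteq> S \<and> slopes f \<subseteq> P \<and> breaks f \<subseteq> A \<and>
                                     (S = UNIV \<longrightarrow> f ` A = A)}\<rparr>"

(* Intervals of positive length, bounded or not, with or without their endpoints. One-point
   intervals have to be excluded: uncountably many of them can make up any set of reals, for
   instance the complement of a point p outside the field F, and PL_grp (- {p}) F P is not
   closed under composition. *)
definition nondegenerate_interval :: "real set \<Rightarrow> bool" where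
  "nondegenerate_interval J \<longleftrightarrow> is_interval J \<and> interior J \<noteq> {}"

end

theory Submission
  imports Defs
begin

text \<open>
  Call an end of an interval \<open>S i\<close> a one-sided neighbourhood of one of its endpoints, possibly infinite,
  and let \<open>E\<close> be the set of all \<open>f\<close> in \<open>G = G(S;A,P)\<close> with slope 1 at every end. Both the
  pseudocentre and the commutator subgroup are equal to \<open>E\<close>. Slopes at an end are multiplicative, so \<open>G' \<subseteq> E\<close>.

  Let \<open>x \<in> G\<close> have a single bend \<open>q\<close> that it does not fix, with \<open>x\<^sup>k q\<close> tending to an end. A map
  commuting with \<open>x\<close> has finitely many bends, hence maps \<open>q\<close> into its own orbit, and so its slope at
  that end is a power of the slope of \<open>x\<close>. Taking 2 and 3 for the latter shows that the
  pseudocentre is contained in \<open>E\<close>.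

  Finally \<open>E \<subseteq> N\<close> if the normal subgroup \<open>N\<close> is \<open>G'\<close> or contains a centralizer. Commutators with
  a map that is not the identity near an infinite end supply all translations there, so it remains
  to treat maps with compact support in the interior of one interval. These commute modulo \<open>N\<close> (by
  Higman's argument, if \<open>N\<close> contains a centralizer) and are products of tents, maps that consist of
  two affine pieces between two fixed points. Modulo \<open>N\<close> a tent depends only on its shape, not on its
  place or size. Let \<open>h\<close> be its class. A tent of double size differs from two adjacent tents by a class
  \<open>\<delta>\<close>, and one of triple size differs from three of them (one single, one double) by \<open>2\<delta>\<close>, so
  additively \<open>h = 2h + \<delta>\<close> and \<open>h = 2h + 2\<delta>\<close>, whence \<open>h = 0\<close>.\<close>

text \<open>The definition of the group restricts slopes and breaks but says nothing about the
  translation parts of the affine pieces. These lie in \<open>F\<close> nevertheless: passing a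
  break in \<open>F\<close> does not change whether they do, so one good point decides, either a
  point outside the union or, if there is none, the requirement that \<open>F\<close> is mapped onto
  itself.

  The index set may be infinite and the intervals may accumulate. This stays harmless because every
  endpoint is a limit of points outside the union, hence fixed by the group, and because an element
  moves points of finitely many intervals only: each interval that it moves, unless it is the whole
  line, has a kink of it in its closure.

  An endpoint outside \<open>F\<close> cannot be a break, so all germs there are trivial; a map
  \<open>x\<close> with prescribed slope exists at the remaining ends only. The numbers 2 and 3
  serve as slopes because no power of 2 other than 1 is a power of 3.\<close>

abbreviation finv :: "(real \<Rightarrow> real) \<Rightarrow> real \<Rightarrow> real" where
  "finv \<equiv> inv_into UNIV"

section \<open>Affine germs and piecewise linear maps over a subfield\<close>

text \<open>The filter is a parameter so that two-sided and one-sided neighbourhoods of a point and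
  the two infinities are served by the same lemmas.\<close>

definition germ :: "real filter \<Rightarrow> (real \<Rightarrow> real) \<Rightarrow> real \<Rightarrow> real \<Rightarrow> bool" where
  "germ \<Phi> f m c \<longleftrightarrow> (\<forall>\<^sub>F y in \<Phi>. f y = m * y + c)"

lemma germ_comp:
  assumes "germ \<Phi> g m c" "germ \<Psi> f m' c'" "filterlim g \<Psi> \<Phi>"
  shows "germ \<Phi> (f \<circ> g) (m' * m) (m' * c + c')"
proof -
  have "\<forall>\<^sub>F y in \<Phi>. f (g y) = m' * g y + c'"
    using assms(2,3) unfolding germ_def filterlim_iff by blast
  with assms(1) show ?thesis
    unfolding germ_def by eventually_elim (simp add: algebra_simps)
qed

lemma germ_inv:
  assumes "germ \<Phi> f m c" "m \<noteq> 0" "surj f" "filterlim (finv f) \<Phi> \<Psi>"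
  shows "germ \<Psi> (finv f) (1 / m) (- c / m)"
proof -
  have "\<forall>\<^sub>F y in \<Psi>. f (finv f y) = m * finv f y + c"
    using assms(1,4) unfolding germ_def filterlim_iff by blast
  then show ?thesis
    unfolding germ_def
  proof eventually_elim
    case (elim y)
    then have "y = m * finv f y + c"
      using assms(3) by (simp add: surj_f_inv_f)
    then have "finv f y = (y - c) / m"
      using assms(2) by (simp add: field_simps)
    then show ?case
      by (simp add: diff_divide_distrib)
  qed
qed

lemma germ_filter_mono: "germ \<Psi> f m c \<Longrightarrow> \<Phi> \<le> \<Psi> \<Longrightarrow> germ \<Phi> f m c"
  unfolding germ_def by (rule filter_leD)

lemma germ_cong:
  assumes "\<forall>\<^sub>F y in \<Phi>. f y = g y"
  shows "germ \<Phi> f m c \<longleftrightarrow> germ \<Phi> g m c"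
  unfolding germ_def using assms by (intro eventually_cong) (auto elim: eventually_mono)

lemma germ_value:
  assumes "isCont f x" "germ \<Phi> f m c" "\<Phi> \<le> at x" "\<Phi> \<noteq> bot"
  shows "f x = m * x + c"
proof (rule tendsto_unique[OF assms(4)])
  show "(f \<longlongrightarrow> f x) \<Phi>"
    using assms(1,3) unfolding isCont_def by (rule tendsto_mono[rotated])
  have "((\<lambda>y. m * y + c) \<longlongrightarrow> m * x + c) \<Phi>"
    by (intro tendsto_intros tendsto_mono[OF assms(3) tendsto_ident_at])
  then show "(f \<longlongrightarrow> m * x + c) \<Phi>"
    by (rule Lim_transform_eventually) (use assms(2) in \<open>simp add: germ_def eq_commute\<close>)
qed

lemma germ_id: "germ \<Phi> id 1 0"
  by (simp add: germ_def)

text \<open>Two different affine functions agree in at most one point; the last assumption rules out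
  filters that concentrate on a single point.\<close>

lemma germ_unique:
  assumes "germ \<Phi> f m c" "germ \<Phi> f m' c'" "\<Phi> \<noteq> bot" "\<And>y. \<forall>\<^sub>F z in \<Phi>. z \<noteq> y"
  shows "m = m' \<and> c = c'"
proof (rule ccontr)
  assume neg: "\<not> (m = m' \<and> c = c')"
  have eq: "\<forall>\<^sub>F y in \<Phi>. m * y + c = m' * y + c'"
    using assms(1,2) unfolding germ_def by eventually_elim simp
  have mm: "m \<noteq> m'"
  proof
    assume "m = m'"
    with eq have "\<forall>\<^sub>F y in \<Phi>. c = c'" by simp
    with neg \<open>m = m'\<close> assms(3) show False
      by (simp add: eventually_const_iff)
  qed
  have "\<forall>\<^sub>F y in \<Phi>. False"
    using eq assms(4)[of "(c' - c) / (m - m')"]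
    by eventually_elim (use mm in \<open>simp add: field_simps\<close>)
  with assms(3) show False by simp
qed

lemma strict_mono_surj_inv:
  fixes f :: "real \<Rightarrow> real"
  assumes "strict_mono f" "surj f"
  shows "strict_mono (finv f)" "surj (finv f)" "bij f"
proof -
  show b: "bij f" using assms by (simp add: bij_def strict_mono_imp_inj_on)
  then show "surj (finv f)" by (simp add: bij_betw_inv_into bij_is_surj)
  show "strict_mono (finv f)"
  proof (rule strict_monoI)
    fix x y :: real assume "x < y"
    then have "f (finv f x) < f (finv f y)" using assms(2) by (simp add: surj_f_inv_f)
    then show "finv f x < finv f y" using assms(1) by (simp add: strict_mono_less)
  qed
qed

lemma strict_mono_surj_filterlim:
  fixes f :: "real \<Rightarrow> real"
  assumes "strict_mono f" "surj f"
  shows "filterlim f (nhds (f x)) (nhds x)"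
    and "filterlim f (at_right (f x)) (at_right x)"
    and "filterlim f (at_left (f x)) (at_left x)"
    and "filterlim f at_top at_top"
    and "filterlim f at_bot at_bot"
    and "continuous_on UNIV f"
proof -
  show c: "continuous_on UNIV f"
    using assms by (intro continuous_onI_mono) (auto simp: strict_mono_less_eq)
  then have t: "(f \<longlongrightarrow> f x) (at x)"
    by (simp add: continuous_on_def)
  then show "filterlim f (nhds (f x)) (nhds x)"
    by (simp add: tendsto_at_iff_tendsto_nhds)
  show "filterlim f (at_right (f x)) (at_right x)"
    using t assms(1)
    by (auto simp: filterlim_at eventually_at_filter filterlim_at_split strict_mono_less less_imp_neq[THEN not_sym])
  show "filterlim f (at_left (f x)) (at_left x)"
    using t assms(1)
    by (auto simp: filterlim_at eventually_at_filter filterlim_at_split strict_mono_less less_imp_neq)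
  show "filterlim f at_top at_top"
    unfolding filterlim_at_top
  proof
    fix Z
    have "\<forall>\<^sub>F y in at_top. finv f Z \<le> y" by (rule eventually_ge_at_top)
    then show "\<forall>\<^sub>F y in at_top. Z \<le> f y"
      by eventually_elim (metis assms strict_mono_less_eq surj_f_inv_f)
  qed
  show "filterlim f at_bot at_bot"
    unfolding filterlim_at_bot
  proof
    fix Z
    have "\<forall>\<^sub>F y in at_bot. y \<le> finv f Z" by (rule eventually_le_at_bot)
    then show "\<forall>\<^sub>F y in at_bot. f y \<le> Z"
      by eventually_elim (metis assms strict_mono_less_eq surj_f_inv_f)
  qed
qed

text \<open>The clause for inverses covers zero as well, by the convention
  \<open>inverse 0 = 0\<close>.\<close>

locale real_subfield =
  fixes F :: "real set"
  assumes one_mem: "1 \<in> F"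
    and diff_mem: "x \<in> F \<Longrightarrow> y \<in> F \<Longrightarrow> x - y \<in> F"
    and mult_mem: "x \<in> F \<Longrightarrow> y \<in> F \<Longrightarrow> x * y \<in> F"
    and inverse_mem: "x \<in> F \<Longrightarrow> inverse x \<in> F"
begin

lemma zero_mem: "0 \<in> F"
  using diff_mem[OF one_mem one_mem] by simp

lemma uminus_mem: "x \<in> F \<Longrightarrow> - x \<in> F"
  using diff_mem[OF zero_mem] by simp

lemma add_mem: "x \<in> F \<Longrightarrow> y \<in> F \<Longrightarrow> x + y \<in> F"
  using diff_mem[OF _ uminus_mem] by force

lemma divide_mem: "x \<in> F \<Longrightarrow> y \<in> F \<Longrightarrow> x / y \<in> F"
  by (simp add: divide_inverse mult_mem inverse_mem)

lemma nat_mem: "of_nat n \<in> F"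
  by (induction n) (auto intro: zero_mem one_mem add_mem)

lemma numeral_mem: "numeral n \<in> F"
  using nat_mem[of "numeral n"] by simp

lemmas mem_intros = zero_mem one_mem numeral_mem add_mem diff_mem mult_mem divide_mem uminus_mem

lemma Rats_subset: "\<rat> \<subseteq> F"
proof
  fix x :: real assume "x \<in> \<rat>"
  then obtain a b :: int where "x = of_int a / of_int b"
    by (auto elim!: Rats_cases')
  moreover have "of_int k \<in> F" for k :: int
    by (cases k) (auto intro!: nat_mem uminus_mem diff_mem one_mem)
  ultimately show "x \<in> F" by (simp add: divide_mem)
qed

lemma dense: "x < y \<Longrightarrow> \<exists>z\<in>F. x < z \<and> z < y"
  using Rats_dense_in_real Rats_subset by blast

definition affine_germ :: "real filter \<Rightarrow> (real \<Rightarrow> real) \<Rightarrow> bool" where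
  "affine_germ \<Phi> f \<longleftrightarrow> (\<exists>m\<in>F. \<exists>c\<in>F. m > 0 \<and> germ \<Phi> f m c)"

text \<open>Stated with germs instead of differentiability, so that absence of kinks passes through
  compositions and inverses by filter arguments. On \<open>pl\<close> maps the set coincides with
  \<open>breaks\<close>.\<close>

definition kinks :: "(real \<Rightarrow> real) \<Rightarrow> real set" where
  "kinks f = {x. \<not> affine_germ (nhds x) f}"

text \<open>The working description of the group elements apart from their support. That all
  translation parts lie in \<open>F\<close>, also on the two unbounded pieces, is explicit here but
  only implicit in \<open>PL_grp\<close>.\<close>

definition pl :: "(real \<Rightarrow> real) \<Rightarrow> bool" where
  "pl f \<longleftrightarrow> strict_mono f \<and> surj f \<and>
     (\<forall>x. affine_germ (at_left x) f \<and> affine_germ (at_right x) f) \<and>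
     affine_germ at_top f \<and> affine_germ at_bot f \<and> finite (kinks f) \<and> kinks f \<subseteq> F"

lemma affine_germ_comp:
  assumes "affine_germ \<Phi> g" "affine_germ \<Psi> f" "filterlim g \<Psi> \<Phi>"
  shows "affine_germ \<Phi> (f \<circ> g)"
proof -
  obtain m c m' c' where "m \<in> F" "c \<in> F" "m > 0" "germ \<Phi> g m c"
    and "m' \<in> F" "c' \<in> F" "m' > 0" "germ \<Psi> f m' c'"
    using assms unfolding affine_germ_def by blast
  then show ?thesis
    unfolding affine_germ_def
    by (intro bexI[of _ "m' * m"] bexI[of _ "m' * c + c'"] conjI germ_comp[OF _ _ assms(3)] mem_intros)
       auto
qed

lemma affine_germ_inv:
  assumes "affine_germ \<Phi> f" "surj f" "filterlim (finv f) \<Phi> \<Psi>"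
  shows "affine_germ \<Psi> (finv f)"
proof -
  obtain m c where "m \<in> F" "c \<in> F" "m > 0" "germ \<Phi> f m c"
    using assms unfolding affine_germ_def by blast
  then have "germ \<Psi> (finv f) (1 / m) (- c / m)" "1 / m \<in> F" "- c / m \<in> F" "1 / m > 0"
    using germ_inv[OF _ _ assms(2,3)] by (fastforce intro!: mem_intros)+
  then show ?thesis
    unfolding affine_germ_def by blast
qed

lemma affine_germ_cong:
  assumes "\<forall>\<^sub>F y in \<Phi>. f y = g y"
  shows "affine_germ \<Phi> f \<longleftrightarrow> affine_germ \<Phi> g"
  unfolding affine_germ_def using germ_cong[OF assms] by simp

lemma affine_germ_affine:
  "m \<in> F \<Longrightarrow> c \<in> F \<Longrightarrow> m > 0 \<Longrightarrow> affine_germ \<Phi> (\<lambda>x. m * x + c)"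
  unfolding affine_germ_def germ_def by force

lemma pl_affine:
  assumes "m \<in> F" "c \<in> F" "m > 0"
  shows "pl (\<lambda>x. m * x + c)"
proof -
  have "surj (\<lambda>x. m * x + c)"
    using assms(3) by (intro surjI[of _ "\<lambda>y. (y - c) / m"]) auto
  then show ?thesis
    using assms by (auto simp: pl_def strict_mono_def kinks_def affine_germ_affine)
qed

lemma pl_id: "pl id"
  using pl_affine[of 1 0] by (simp add: id_def zero_mem one_mem)

context
  fixes f assumes f: "pl f"
begin

lemma pl_strict_mono: "strict_mono f" and pl_surj: "surj f"
  using f by (auto simp: pl_def)

lemmas pl_bij = strict_mono_surj_inv(3)[OF pl_strict_mono pl_surj]
lemmas pl_inj = bij_is_inj[OF pl_bij]
lemmas pl_filterlim = strict_mono_surj_filterlim[OF pl_strict_mono pl_surj]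
lemmas pl_inv_filterlim =
  strict_mono_surj_filterlim[OF strict_mono_surj_inv(1,2)[OF pl_strict_mono pl_surj]]

lemma pl_less_iff: "f x < f y \<longleftrightarrow> x < y"
  by (rule strict_mono_less[OF pl_strict_mono])

lemma pl_le_iff: "f x \<le> f y \<longleftrightarrow> x \<le> y"
  by (rule strict_mono_less_eq[OF pl_strict_mono])

lemma pl_inv_f: "finv f (f x) = x"
  by (simp add: pl_inj)

lemma pl_f_inv: "f (finv f x) = x"
  by (simp add: pl_surj surj_f_inv_f)

lemma pl_isCont: "isCont f x"
  using pl_filterlim(6) by (simp add: continuous_on_eq_continuous_at)

lemma pl_affine_germ:
  "affine_germ (at_left x) f" "affine_germ (at_right x) f" "affine_germ at_top f" "affine_germ at_bot f"
  using f by (auto simp: pl_def)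

lemma pl_kinks: "finite (kinks f)" "kinks f \<subseteq> F"
  using f by (auto simp: pl_def)

lemma pl_germ_value:
  assumes "germ \<Phi> f m c" "\<Phi> = at_left x \<or> \<Phi> = at_right x"
  shows "f x = m * x + c"
proof (rule germ_value[OF pl_isCont assms(1)])
  show "\<Phi> \<noteq> bot"
    using assms(2) trivial_limit_at_left_real[of x] trivial_limit_at_right_real[of x] by metis
  show "\<Phi> \<le> at x"
    using assms(2) by (auto simp: at_le)
qed

text \<open>The value at \<open>x\<close> is given by the germ on one side, an affine map with
  coefficients in \<open>F\<close>; such a map and its inverse preserve \<open>F\<close>.\<close>

lemma pl_mem_iff: "f x \<in> F \<longleftrightarrow> x \<in> F"
proof -
  obtain m c where mc: "m \<in> F" "c \<in> F" "m > 0" "germ (at_right x) f m c"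
    using pl_affine_germ(2) unfolding affine_germ_def by blast
  then have e: "f x = m * x + c" by (intro pl_germ_value) auto
  then have "x = (f x - c) / m" using mc by simp
  then show ?thesis using e mc by (metis mem_intros(4-7))
qed

end

lemma pl_comp:
  assumes f: "pl f" and g: "pl g"
  shows "pl (f \<circ> g)"
proof -
  have sub: "kinks (f \<circ> g) \<subseteq> kinks g \<union> finv g ` kinks f"
  proof
    fix x assume x: "x \<in> kinks (f \<circ> g)"
    then have "x \<in> kinks g \<or> g x \<in> kinks f"
      using affine_germ_comp[OF _ _ pl_filterlim(1)[OF g]] by (auto simp: kinks_def)
    then show "x \<in> kinks g \<union> finv g ` kinks f"
      using pl_inv_f[OF g, of x] by (metis UnI1 UnI2 image_eqI)
  qed
  show ?thesis
    unfolding pl_def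
  proof (intro conjI allI)
    show "strict_mono (f \<circ> g)"
      using pl_strict_mono[OF f] pl_strict_mono[OF g] by (simp add: strict_mono_def)
    show "surj (f \<circ> g)"
      by (rule comp_surj[OF pl_surj[OF g] pl_surj[OF f]])
    show "affine_germ (at_left x) (f \<circ> g)" "affine_germ (at_right x) (f \<circ> g)" for x
      by (blast intro: affine_germ_comp pl_affine_germ pl_filterlim f g)+
    show "affine_germ at_top (f \<circ> g)" "affine_germ at_bot (f \<circ> g)"
      by (blast intro: affine_germ_comp pl_affine_germ pl_filterlim f g)+
    show "finite (kinks (f \<circ> g))"
      using sub pl_kinks(1)[OF f] pl_kinks(1)[OF g] by (meson finite_UnI finite_imageI finite_subset)
    have "finv g y \<in> F" if "y \<in> F" for y
      using that pl_mem_iff[OF g, of "finv g y"] pl_f_inv[OF g] by simp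
    then show "kinks (f \<circ> g) \<subseteq> F"
      using sub pl_kinks(2)[OF f] pl_kinks(2)[OF g] by blast
  qed
qed

lemma kinks_inv: assumes f: "pl f" shows "kinks (finv f) \<subseteq> f ` kinks f"
proof
  fix x assume "x \<in> kinks (finv f)"
  then have "finv f x \<in> kinks f"
    using affine_germ_inv[OF _ pl_surj[OF f] pl_inv_filterlim(1)[OF f]] by (auto simp: kinks_def)
  then show "x \<in> f ` kinks f"
    using pl_f_inv[OF f, of x] by (metis image_eqI)
qed

lemma pl_inv:
  assumes f: "pl f"
  shows "pl (finv f)"
  unfolding pl_def
proof (intro conjI allI)
  note a = affine_germ_inv[OF _ pl_surj[OF f]]
  show "strict_mono (finv f)" "surj (finv f)"
    using strict_mono_surj_inv[OF pl_strict_mono pl_surj] f by auto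
  show "affine_germ (at_left x) (finv f)" "affine_germ (at_right x) (finv f)" for x
    by (blast intro: a pl_affine_germ pl_inv_filterlim f)+
  show "affine_germ at_top (finv f)" "affine_germ at_bot (finv f)"
    by (blast intro: a pl_affine_germ pl_inv_filterlim f)+
  show "finite (kinks (finv f))" 
    using kinks_inv[OF f] pl_kinks(1)[OF f] finite_surj by blast
  show "kinks (finv f) \<subseteq> F"
    using kinks_inv[OF f] pl_kinks(2)[OF f] pl_mem_iff[OF f] by blast
qed

lemma kinks_glue: "kinks (\<lambda>t. if t \<le> p then f t else g t) \<subseteq> insert p (kinks f \<union> kinks g)"
proof
  let ?h = "\<lambda>t. if t \<le> p then f t else g t"
  fix x assume x: "x \<in> kinks ?h"
  show "x \<in> insert p (kinks f \<union> kinks g)"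
  proof (cases x p rule: linorder_cases)
    case less
    then have "\<forall>\<^sub>F y in nhds x. y \<in> {..<p}" by (intro eventually_nhds_in_open) auto
    then have "\<forall>\<^sub>F y in nhds x. ?h y = f y" by eventually_elim simp
    then show ?thesis using x affine_germ_cong[of ?h f] by (simp add: kinks_def)
  next
    case greater
    then have "\<forall>\<^sub>F y in nhds x. y \<in> {p<..}" by (intro eventually_nhds_in_open) auto
    then have "\<forall>\<^sub>F y in nhds x. ?h y = g y" by eventually_elim simp
    then show ?thesis using x affine_germ_cong[of ?h g] by (simp add: kinks_def)
  qed simp
qed

text \<open>Tents, ramps and transporting maps are assembled from lines with this lemma. The joint
  is taken in \<open>F\<close> because it may become a kink.\<close>

lemma pl_glue:
  assumes f: "pl f" and g: "pl g" and p: "p \<in> F" "f p = g p"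
  shows "pl (\<lambda>t. if t \<le> p then f t else g t)" (is "pl ?h")
proof -
  have left: "affine_germ \<Phi> ?h" if "affine_germ \<Phi> f" "\<forall>\<^sub>F y in \<Phi>. y \<le> p" for \<Phi>
  proof -
    have "\<forall>\<^sub>F y in \<Phi>. ?h y = f y" using that(2) by eventually_elim simp
    then show ?thesis by (rule affine_germ_cong[THEN iffD2, OF _ that(1)])
  qed
  have right: "affine_germ \<Phi> ?h" if "affine_germ \<Phi> g" "\<forall>\<^sub>F y in \<Phi>. y > p" for \<Phi>
  proof -
    have "\<forall>\<^sub>F y in \<Phi>. ?h y = g y" using that(2) by eventually_elim simp
    then show ?thesis by (rule affine_germ_cong[THEN iffD2, OF _ that(1)])
  qed
  show ?thesis
    unfolding pl_def
  proof (intro conjI allI)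
    show "strict_mono ?h"
    proof (rule strict_monoI)
      fix x y :: real assume "x < y"
      moreover have "f x \<le> g p" if "x \<le> p" using that pl_le_iff[OF f, of x p] p by simp
      moreover have "g p < g y" if "y > p" using that pl_less_iff[OF g] by simp
      ultimately show "?h x < ?h y"
        using pl_less_iff[OF f, of x y] pl_less_iff[OF g, of x y] by auto
    qed
    show "surj ?h"
    proof (rule surjI)
      fix y
      show "?h (if y \<le> f p then finv f y else finv g y) = y"
        using pl_le_iff[OF f, of "finv f y" p] pl_le_iff[OF g, of "finv g y" p] p
          pl_f_inv[OF f, of y] pl_f_inv[OF g, of y] by auto
    qed
    show "affine_germ (at_left x) ?h" for x
    proof (cases "x \<le> p")
      case True
      then have "\<forall>\<^sub>F y in at_left x. y \<le> p"
        unfolding eventually_at_filter by (auto intro!: always_eventually)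
      then show ?thesis using left pl_affine_germ(1)[OF f] by blast
    next
      case False
      then have "\<forall>\<^sub>F y in at_left x. y \<in> {p<..<x}" by (intro eventually_at_left_real) simp
      then have "\<forall>\<^sub>F y in at_left x. y > p" by eventually_elim simp
      then show ?thesis using right pl_affine_germ(1)[OF g] by blast
    qed
    show "affine_germ (at_right x) ?h" for x
    proof (cases "p \<le> x")
      case True
      then have "\<forall>\<^sub>F y in at_right x. y > p"
        unfolding eventually_at_filter by (auto intro!: always_eventually)
      then show ?thesis using right pl_affine_germ(2)[OF g] by blast
    next
      case False
      then have "\<forall>\<^sub>F y in at_right x. y \<in> {x<..<p}" by (intro eventually_at_right_real) simp
      then have "\<forall>\<^sub>F y in at_right x. y \<le> p" by eventually_elim simp
      then show ?thesis using left pl_affine_germ(2)[OF f] by blast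
    qed
    show "affine_germ at_top ?h"
      using right eventually_gt_at_top pl_affine_germ(3)[OF g] by blast
    show "affine_germ at_bot ?h"
      using left eventually_le_at_bot pl_affine_germ(4)[OF f] by blast
    show "finite (kinks ?h)"
      by (rule finite_subset[OF kinks_glue]) (simp add: pl_kinks(1)[OF f] pl_kinks(1)[OF g])
    show "kinks ?h \<subseteq> F"
      using kinks_glue[of p f g] pl_kinks(2)[OF f] pl_kinks(2)[OF g] p(1) by blast
  qed
qed

end

section \<open>Unions of intervals with disjoint closures\<close>

lemma open_germ: "open {x. germ (nhds x) f m c}"
  unfolding germ_def by (subst open_subopen) (force simp: eventually_nhds)

lemma germ_at_unique:
  fixes x :: real
  assumes "germ (nhds x) f m c" "germ (nhds x) f m' c'"
  shows "m = m' \<and> c = c'"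
proof (rule germ_unique)
  have "at x \<le> nhds x" by (simp add: at_within_def)
  then show "germ (at x) f m c" "germ (at x) f m' c'"
    using assms germ_filter_mono by blast+
  show "at x \<noteq> bot" by simp
  show "\<forall>\<^sub>F z in at x. z \<noteq> y" for y
    by (rule eventually_neq_at_within)
qed

text \<open>For each pair of coefficients the points with that germ form an open set, and different
  pairs give disjoint sets; a connected set covered by them lies in one.\<close>

lemma germ_connected:
  assumes "connected U" "x0 \<in> U" "germ (nhds x0) f m c"
    and ex: "\<And>x. x \<in> U \<Longrightarrow> \<exists>m c. germ (nhds x) f m c" and "x \<in> U"
  shows "germ (nhds x) f m c"
proof -
  define A where "A = {x. germ (nhds x) f m c}"
  define B where "B = (\<Union>(m', c')\<in>- {(m, c)}. {x. germ (nhds x) f m' c'})"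
  have "open A" "open B"
    unfolding A_def B_def by (auto intro: open_germ)
  moreover have "A \<inter> B = {}"
    using germ_at_unique unfolding A_def B_def by auto
  moreover have "U \<subseteq> A \<union> B"
    using ex unfolding A_def B_def by fastforce
  ultimately have "B \<inter> U = {}"
    using connectedD[OF assms(1), of A B] assms(2,3) by (auto simp: A_def)
  then show ?thesis
    using \<open>U \<subseteq> A \<union> B\<close> \<open>x \<in> U\<close> by (auto simp: A_def)
qed

section \<open>One-sided germs of piecewise linear functions\<close>

lemma eventually_sided_interval:
  fixes x :: real
  assumes "eventually P \<Phi>" "\<Phi> = at_left x \<or> \<Phi> = at_right x"
  obtains a b where "a < b" "\<And>y. a < y \<Longrightarrow> y < b \<Longrightarrow> P y"
  using assms by (metis eventually_at_right_field eventually_at_left_field)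

text \<open>Along each side the difference quotient is eventually constant, equal to the slope of
  the germ. Differentiability therefore forces equal slopes, and continuity then equal translation
  parts.\<close>

lemma germ_differentiable:
  assumes l: "germ (at_left x) f m1 c1" and r: "germ (at_right x) f m2 c2" and d: "f differentiable (at x)"
  shows "germ (nhds x) f m1 c1" "m2 = m1" "c2 = c1" "deriv f x = m1"
proof -
  have cont: "isCont f x" using d by (rule differentiable_imp_continuous_within)
  note val = germ_value[OF cont]
  have le: "at_left x \<le> at x" "at_right x \<le> at x" by (auto simp: at_le)
  note v = val[OF l le(1) trivial_limit_at_left_real] val[OF r le(2) trivial_limit_at_right_real]
  have D: "((\<lambda>y. (f y - f x) / (y - x)) \<longlongrightarrow> deriv f x) (at x)"
    using d by (metis DERIV_deriv_iff_real_differentiable has_field_derivative_iff)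
  have slope: "deriv f x = m" if g: "germ \<Phi> f m c" "\<Phi> \<le> at x" "\<Phi> \<noteq> bot" for \<Phi> m c
  proof (rule tendsto_unique[OF that(3)])
    show "((\<lambda>y. (f y - f x) / (y - x)) \<longlongrightarrow> deriv f x) \<Phi>"
      using D g(2) by (rule tendsto_mono[rotated])
    have "\<forall>\<^sub>F y in \<Phi>. y \<noteq> x" by (rule filter_leD[OF g(2)]) (rule eventually_neq_at_within)
    with g(1) have "\<forall>\<^sub>F y in \<Phi>. m = (f y - f x) / (y - x)"
      unfolding germ_def
    proof eventually_elim
      case (elim y)
      then show ?case using val[OF g] by (simp add: field_simps)
    qed
    then show "((\<lambda>y. (f y - f x) / (y - x)) \<longlongrightarrow> m) \<Phi>"
      by (rule Lim_transform_eventually[OF tendsto_const])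
  qed
  show m: "deriv f x = m1" using slope[OF l le(1) trivial_limit_at_left_real] .
  show m2: "m2 = m1" using slope[OF r le(2) trivial_limit_at_right_real] m by simp
  show c2: "c2 = c1" using v m2 by simp
  have "\<forall>\<^sub>F y in at x. f y = m1 * y + c1"
    using l r m2 c2 unfolding germ_def by (simp add: eventually_at_split)
  then show "germ (nhds x) f m1 c1"
    using v(1) unfolding germ_def eventually_at_filter
    by (auto elim!: eventually_mono)
qed

lemma piecewise_linear_germs:
  assumes "piecewise_linear f"
  shows "\<exists>m c. germ (at_left x) f m c" "\<exists>m c. germ (at_right x) f m c"
proof -
  obtain B where B: "\<And>a b. finite (B \<inter> {a..b})"
    "\<And>a b. {a<..<b} \<inter> B = {} \<Longrightarrow> \<exists>m c. \<forall>x\<in>{a<..<b}. f x = m * x + c"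
    using assms unfolding piecewise_linear_def by blast
  obtain d where d: "d > 0" "\<And>y. y \<in> B \<inter> {x - 1..x + 1} \<Longrightarrow> y \<noteq> x \<Longrightarrow> d \<le> dist x y"
    using finite_set_avoid[OF B(1)] by metis
  define e where "e = min d 1"
  have e: "e > 0" using d by (simp add: e_def)
  have "{x<..<x + e} \<inter> B = {}" "{x - e<..<x} \<inter> B = {}"
    using d(2) by (force simp: e_def dist_real_def)+
  then obtain m c m' c' where "\<forall>y\<in>{x<..<x + e}. f y = m * y + c" "\<forall>y\<in>{x - e<..<x}. f y = m' * y + c'"
    using B(2) by meson
  moreover have "\<forall>\<^sub>F y in at_right x. y \<in> {x<..<x + e}" "\<forall>\<^sub>F y in at_left x. y \<in> {x - e<..<x}"
    using e eventually_at_left_real[of "x - e" x] eventually_at_right_real[of x "x + e"] by simp_all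
  ultimately have "germ (at_right x) f m c" "germ (at_left x) f m' c'"
    unfolding germ_def by (auto elim: eventually_mono)
  then show "\<exists>m c. germ (at_left x) f m c" "\<exists>m c. germ (at_right x) f m c" by blast+
qed

lemma eventually_at_nhds:
  fixes x :: real
  assumes "eventually P (at x)"
  shows "\<forall>\<^sub>F z in at x. \<forall>\<^sub>F y in nhds z. P y"
proof -
  obtain T where T: "open T" "x \<in> T" "\<And>y. y \<in> T \<Longrightarrow> y \<noteq> x \<Longrightarrow> P y"
    using assms unfolding eventually_at_topological by auto
  have "\<forall>\<^sub>F y in nhds z. P y" if "z \<in> T" "z \<noteq> x" for z
    unfolding eventually_nhds using T that by (intro exI[of _ "T - {x}"]) auto
  then show ?thesis
    unfolding eventually_at_topological using T by auto
qed

locale pl_intervals = real_subfield +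
  fixes S :: "'i \<Rightarrow> real set" and I :: "'i set"
  assumes nondeg: "i \<in> I \<Longrightarrow> nondegenerate_interval (S i)"
    and disj: "i \<in> I \<Longrightarrow> j \<in> I \<Longrightarrow> closure (S i) \<inter> closure (S j) \<noteq> {} \<Longrightarrow> i = j"
begin

definition region :: "real set" where
  "region = (\<Union>i\<in>I. S i)"

lemma mem_region: "i \<in> I \<Longrightarrow> x \<in> S i \<Longrightarrow> x \<in> region"
  by (auto simp: region_def)

lemma interval: "i \<in> I \<Longrightarrow> is_interval (S i)" and int_nonempty: "i \<in> I \<Longrightarrow> interior (S i) \<noteq> {}"
  using nondeg by (auto simp: nondegenerate_interval_def)

lemma disj_closure: "i \<in> I \<Longrightarrow> j \<in> I \<Longrightarrow> x \<in> closure (S i) \<Longrightarrow> x \<in> closure (S j) \<Longrightarrow> i = j"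
  using disj by blast

text \<open>Nondegenerate intervals contain rationals, and disjoint ones contain different
  rationals. Countability is needed to apply Sierpinski's theorem below.\<close>

lemma countable_index: "countable I"
proof -
  have "\<forall>i\<in>I. \<exists>q\<in>\<rat>. q \<in> S i"
  proof
    fix i assume "i \<in> I"
    then obtain x where "x \<in> interior (S i)" using int_nonempty by blast
    then obtain e where "e > 0" "ball x e \<subseteq> S i"
      using mem_interior by blast
    then show "\<exists>q\<in>\<rat>. q \<in> S i"
      using Rats_dense_in_real[of x "x + e"] by (force simp: dist_real_def subset_iff)
  qed
  then obtain q where q: "\<And>i. i \<in> I \<Longrightarrow> q i \<in> \<rat> \<and> q i \<in> S i" by metis
  then have "inj_on q I"
    by (intro inj_onI) (metis closure_subset disj_closure subsetD)
  moreover have "countable (q ` I)"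
    using q countable_rat by (metis countable_subset image_subsetI)
  ultimately show ?thesis
    by (metis countable_image_inj_on)
qed

text \<open>Since infinitely many intervals may be involved, connectedness alone does not suffice.
  By Sierpinski's theorem a compact interval is not the disjoint union of countably many, and at
  least two, nonempty closed sets, so each compact subinterval lies in a single closure.\<close>

lemma open_interval_in_component:
  assumes "u < v" "{u<..<v} \<subseteq> region"
  obtains i where "i \<in> I" "{u<..<v} \<subseteq> S i"
proof -
  have closed_case: "\<exists>i\<in>I. {c..d} \<subseteq> closure (S i)" if "c \<le> d" "u < c" "d < v" for c d
  proof -
    define \<U> where "\<U> = (\<lambda>i. closure (S i) \<inter> {c..d}) ` I - {{}}"
    have "\<U> = {{c..d}}"
    proof (rule real_Sierpinski_lemma[OF \<open>c \<le> d\<close>])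
      show "countable \<U>" unfolding \<U>_def using countable_index by auto
      show "pairwise disjnt \<U>"
        unfolding pairwise_def disjnt_def \<U>_def using disj_closure by fastforce
      show "closed C \<and> C \<noteq> {}" if "C \<in> \<U>" for C
        using that unfolding \<U>_def by auto
      have "x \<in> \<Union>\<U>" if "x \<in> {c..d}" for x
      proof -
        have "x \<in> region" using that \<open>u < c\<close> \<open>d < v\<close> assms(2) by auto
        then obtain i where "i \<in> I" "x \<in> S i" by (auto simp: region_def)
        then have "x \<in> closure (S i) \<inter> {c..d}" using that closure_subset by auto
        then show ?thesis unfolding \<U>_def using \<open>i \<in> I\<close> by blast
      qed
      then show "\<Union>\<U> = {c..d}" unfolding \<U>_def by auto
    qed
    then have "{c..d} \<in> \<U>" by simp
    then show ?thesis unfolding \<U>_def by auto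
  qed
  define m where "m = (u + v) / 2"
  have m: "u < m" "m < v" using assms(1) by (auto simp: m_def)
  then obtain i where i: "i \<in> I" "m \<in> S i" using assms(2) by (fastforce simp: region_def)
  \<comment> \<open>The point \<open>x\<close> lies in some \<open>S k\<close> and the midpoint in
    \<open>S i\<close>. The compact interval between them lies in one closure, whence
    \<open>k = i\<close>; in this way membership in a closure is improved to membership in the
    interval.\<close>
  have "x \<in> S i" if x: "x \<in> {u<..<v}" for x
  proof -
    obtain k where k: "k \<in> I" "x \<in> S k" using assms(2) x by (fastforce simp: region_def)
    obtain j where j: "j \<in> I" "{min x m..max x m} \<subseteq> closure (S j)"
      using closed_case[of "min x m" "max x m"] m x by fastforce
    then have "x \<in> closure (S j)" "m \<in> closure (S j)" by auto
    then have "j = i" "j = k"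
      using i k j(1) disj_closure closure_subset by blast+
    with k show ?thesis by simp
  qed
  with i(1) that show ?thesis by blast
qed

text \<open>The complement of the union has no isolated points, although the intervals may accumulate.\<close>

lemma islimpt_complement:
  assumes "\<And>i. i \<in> I \<Longrightarrow> e \<notin> interior (S i)"
  shows "e islimpt (- region)"
proof (rule ccontr)
  assume "\<not> e islimpt (- region)"
  then obtain T where T: "open T" "e \<in> T" "\<And>y. y \<in> T \<Longrightarrow> y \<noteq> e \<Longrightarrow> y \<in> region"
    unfolding islimpt_def by blast
  then obtain d where d: "d > 0" "ball e d \<subseteq> T"
    using open_contains_ball by blast
  have sub: "{e - d<..<e} \<subseteq> region" "{e<..<e + d} \<subseteq> region"
    using T(3) d(2) by (force simp: ball_def dist_real_def subset_iff)+
  obtain i where i: "i \<in> I" "{e - d<..<e} \<subseteq> S i"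
    using open_interval_in_component[OF _ sub(1)] d(1) by auto
  obtain j where j: "j \<in> I" "{e<..<e + d} \<subseteq> S j"
    using open_interval_in_component[OF _ sub(2)] d(1) by auto
  have "e \<in> closure {e - d<..<e}" "e \<in> closure {e<..<e + d}"
    using d(1) by auto
  then have "e \<in> closure (S i)" "e \<in> closure (S j)"
    using i j closure_mono by blast+
  then have ij: "i = j" using i j disj_closure by blast
  have "ball e d \<subseteq> S i"
  proof
    fix y assume "y \<in> ball e d"
    then have "\<bar>y - e\<bar> < d" by (auto simp: dist_real_def)
    moreover have "e - d / 2 \<in> S i" "e + d / 2 \<in> S i"
      using i(2) j(2) ij d(1) by (auto simp: subset_iff)
    then have "e \<in> S i"
      using interval[OF i(1)] d(1) unfolding is_interval_1
      by (metis diff_le_eq le_add_same_cancel1 half_gt_zero less_eq_real_def)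
    ultimately show "y \<in> S i"
      using i(2) j(2) ij by (cases y e rule: linorder_cases) (auto simp: subset_iff)
  qed
  then have "e \<in> interior (S i)"
    using d(1) mem_interior by blast
  with assms i(1) show False by blast
qed

lemma frontier_not_interior:
  assumes "i \<in> I" "e \<in> frontier (S i)" "j \<in> I"
  shows "e \<notin> interior (S j)"
  using assms disj_closure interior_subset[of "S j"] closure_subset[of "S j"] unfolding frontier_def by blast

text \<open>The fixed points form a closed set that contains the complement of the union, and
  \<open>e\<close> is a limit of this complement.\<close>

lemma fixed_at_limit:
  assumes "\<And>i. i \<in> I \<Longrightarrow> e \<notin> interior (S i)" "continuous_on UNIV f" "supp f \<subseteq> region"
  shows "f e = e"
proof -
  have "closed {y. f y = y}"
    by (intro closed_Collect_eq assms(2) continuous_on_id)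
  moreover have "- region \<subseteq> {y. f y = y}"
    using assms(3) by (auto simp: supp_def)
  ultimately have "closure (- region) \<subseteq> {y. f y = y}"
    by (rule closure_minimal[rotated])
  then show ?thesis
    using islimpt_complement[OF assms(1)] closure_def by blast
qed

text \<open>Besides \<open>e\<close> there is another fixed point nearby, outside the union, and an
  affine map with two fixed points is the identity.\<close>

lemma germ_at_limit:
  assumes "\<And>i. i \<in> I \<Longrightarrow> e \<notin> interior (S i)" "continuous_on UNIV f" "supp f \<subseteq> region" "germ (nhds e) f m c"
  shows "m = 1 \<and> c = 0"
proof -
  have fe: "f e = e" by (rule fixed_at_limit[OF assms(1-3)])
  obtain T where T: "open T" "e \<in> T" "\<And>y. y \<in> T \<Longrightarrow> f y = m * y + c"
    using assms(4) unfolding germ_def eventually_nhds by blast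
  obtain y where y: "y \<in> T" "y \<notin> region" "y \<noteq> e"
    using islimpt_complement[OF assms(1)] T(1,2) unfolding islimpt_def by blast
  have "f y = y" using y(2) assms(3) by (auto simp: supp_def)
  then have "m * y + c = y" "m * e + c = e"
    using T(3)[OF y(1)] T(3)[OF T(2)] fe by simp_all
  then have "(m - 1) * (y - e) = 0" by (simp add: algebra_simps)
  with y(3) \<open>m * e + c = e\<close> show ?thesis by simp
qed

end

section \<open>The group\<close>

context real_subfield begin

lemma pl_germ_ex: "pl f \<Longrightarrow> x \<notin> kinks f \<Longrightarrow> \<exists>m c. germ (nhds x) f m c"
  unfolding kinks_def affine_germ_def by blast

lemma affine_germ_nhds_deriv:
  assumes "germ (nhds x) f m c"
  shows "(f has_real_derivative m) (at x)"
proof -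
  have "((\<lambda>y. m * y + c) has_real_derivative m) (at x)"
    by (auto intro!: derivative_eq_intros)
  moreover have "\<forall>\<^sub>F y in nhds x. f y = m * y + c"
    using assms by (simp add: germ_def)
  ultimately show ?thesis
    using DERIV_cong_ev[OF refl _ refl, of f "\<lambda>y. m * y + c" x m] by simp
qed

text \<open>Both one-sided germs are affine with coefficients in \<open>F\<close>, so at a point of
  differentiability they merge into one.\<close>

lemma breaks_eq_kinks:
  assumes "pl f"
  shows "breaks f = kinks f"
proof (intro equalityI subsetI)
  fix x assume "x \<in> breaks f"
  then show "x \<in> kinks f"
    using pl_germ_ex[OF assms] affine_germ_nhds_deriv unfolding breaks_def
    by (metis mem_Collect_eq real_differentiable_def)
next
  fix x assume x: "x \<in> kinks f"
  obtain m c m' c' where "m \<in> F" "c \<in> F" "m > 0" "germ (at_left x) f m c" "germ (at_right x) f m' c'"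
    using pl_affine_germ[OF assms] unfolding affine_germ_def by blast
  then show "x \<in> breaks f"
    using x germ_differentiable(1) unfolding breaks_def kinks_def affine_germ_def by blast
qed

end

context pl_intervals begin

abbreviation positive :: "real set" where
  "positive \<equiv> {x \<in> F. x > 0}"

definition grp :: "(real \<Rightarrow> real) monoid" where
  "grp = PL_grp region F positive"

lemma PL_grp_imp_pl:
  assumes f: "f \<in> carrier (PL_grp region F positive)"
  shows "pl f"
proof -
  have mono: "strict_mono f" and pw: "piecewise_linear f" and fin: "finite (breaks f)"
    and supp: "supp f \<subseteq> region" and slopes: "slopes f \<subseteq> positive" and brF: "breaks f \<subseteq> F"
    and onto: "region = UNIV \<Longrightarrow> f ` F = F"
    using f by (auto simp: PL_grp_def PLo_def)
  obtain g where hom: "homeomorphism UNIV UNIV f g"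
    using f by (auto simp: PL_grp_def PLo_def)
  then have cont: "continuous_on UNIV f" and surj: "surj f"
    by (auto simp: homeomorphism_def)
  have "\<exists>m c m' c'. germ (at_left x) f m c \<and> germ (at_right x) f m' c'" for x
    using piecewise_linear_germs[OF pw] by blast
  then obtain lm lc rm rc where
    L: "\<And>x. germ (at_left x) f (lm x) (lc x)" and R: "\<And>x. germ (at_right x) f (rm x) (rc x)"
    by metis
  have nonbreak: "germ (nhds x) f (lm x) (lc x)" "rm x = lm x" "rc x = lc x" "lm x \<in> positive"
    if "x \<notin> breaks f" for x
    using germ_differentiable[OF L R, of x] that slopes by (auto simp: breaks_def slopes_def)
  \<comment> \<open>A one-sided slope at \<open>x\<close> is the slope at nearby points that are not
    breaks, hence a positive element of \<open>F\<close>.\<close>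
  have nearby: "m \<in> positive" if g: "germ \<Phi> f m c" "\<Phi> = at_left x \<or> \<Phi> = at_right x" for \<Phi> x m c
  proof -
    obtain a b where ab: "a < b" "\<And>y. a < y \<Longrightarrow> y < b \<Longrightarrow> f y = m * y + c"
      using eventually_sided_interval[OF g[unfolded germ_def]] by blast
    have "infinite ({a<..<b} - breaks f)"
      using infinite_Ioo[OF ab(1)] fin by (rule Diff_infinite_finite[rotated])
    then obtain y where y: "a < y" "y < b" "y \<notin> breaks f"
      by (metis DiffE finite.emptyI equals0I greaterThanLessThan_iff)
    have "germ (nhds y) f m c"
      unfolding germ_def eventually_nhds using ab y
      by (intro exI[of _ "{a<..<b}"]) auto
    then have "lm y = m" using germ_at_unique nonbreak(1)[OF y(3)] by blast
    then show ?thesis using nonbreak(4)[OF y(3)] by simp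
  qed
  note lmP = nearby[OF L disjI1[OF refl]] and rmP = nearby[OF R disjI2[OF refl]]
  have le: "at_left x \<le> at x" "at_right x \<le> at x" for x :: real by (auto simp: at_le)
  have isc: "isCont f x" for x using cont by (simp add: continuous_on_eq_continuous_at)
  note val = germ_value[OF isc]
  have lv: "f x = lm x * x + lc x" and rv: "f x = rm x * x + rc x" for x
    using val[OF L le(1) trivial_limit_at_left_real] val[OF R le(2) trivial_limit_at_right_real] by auto
  \<comment> \<open>At a point of \<open>F\<close> each translation part lies in \<open>F\<close>
    exactly when the value of \<open>f\<close> does. A point outside \<open>F\<close> is not a
    break, so there the two translation parts are equal.\<close>
  have lr: "lc x \<in> F \<longleftrightarrow> rc x \<in> F" for x
  proof (cases "x \<in> F")
    case True
    have "lc x = f x - lm x * x" "f x = lm x * x + lc x" "rc x = f x - rm x * x" "f x = rm x * x + rc x"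
      using lv[of x] rv[of x] by auto
    then show ?thesis
      using True lmP[of x] rmP[of x] by (metis (no_types, lifting) mem_Collect_eq mem_intros(4-6))
  next
    case False
    then have "x \<notin> breaks f" using brF by blast
    then show ?thesis using nonbreak(3)[of x] by simp
  qed
  text \<open>Whether the germs at a point have translation part in \<open>F\<close> is a locally constant property.\<close>
  define Q where "Q x \<longleftrightarrow> (\<forall>\<^sub>F y in nhds x. y \<in> F \<longrightarrow> f y \<in> F)" for x
  have QI: "Q x" if "lc x \<in> F" for x
  proof -
    have "\<forall>\<^sub>F y in at_left x. y \<in> F \<longrightarrow> f y \<in> F"
      using L[of x] unfolding germ_def
      by eventually_elim (use that lmP[of x] in \<open>auto intro: mem_intros\<close>)
    moreover have "\<forall>\<^sub>F y in at_right x. y \<in> F \<longrightarrow> f y \<in> F"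
      using R[of x] unfolding germ_def
      by eventually_elim (use that lr[of x] rmP[of x] in \<open>auto intro: mem_intros\<close>)
    moreover have "x \<in> F \<longrightarrow> f x \<in> F"
      using lv[of x] that lmP[of x] by (auto intro: mem_intros)
    ultimately show ?thesis
      unfolding Q_def by (simp add: eventually_nhds_conv_at eventually_at_split)
  qed
  have dense': "\<exists>z\<in>F. P z" if "eventually P (nhds y)" for P and y :: real
  proof -
    have "eventually P (at_right y)"
      using that by (simp add: eventually_at_filter eventually_mono)
    then obtain a b where "a < b" "\<And>z. a < z \<Longrightarrow> z < b \<Longrightarrow> P z"
      using eventually_sided_interval by blast
    then show ?thesis using dense by blast
  qed
  \<comment> \<open>If the translation part is outside \<open>F\<close>, the points of
    \<open>F\<close> close to \<open>x\<close> are mapped out of \<open>F\<close>. As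
    \<open>F\<close> is dense, \<open>Q\<close> then fails at all points close to but different from
    \<open>x\<close>.\<close>
  have QD: "\<forall>\<^sub>F y in at x. \<not> Q y" if "lc x \<notin> F" for x
  proof -
    have out: "y \<in> F \<longrightarrow> f y \<notin> F" if "f y = m * y + c" "c \<notin> F" "m \<in> F" for y m c
    proof
      assume "y \<in> F"
      show "f y \<notin> F"
      proof
        assume "f y \<in> F"
        then have "f y - m * y \<in> F" using \<open>y \<in> F\<close> that(3) by (intro mem_intros)
        with that show False by simp
      qed
    qed
    have "\<forall>\<^sub>F y in at_left x. y \<in> F \<longrightarrow> f y \<notin> F"
      using L[of x] unfolding germ_def by eventually_elim (use that out lmP in blast)
    moreover have "\<forall>\<^sub>F y in at_right x. y \<in> F \<longrightarrow> f y \<notin> F"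
      using R[of x] unfolding germ_def by eventually_elim (use that lr out rmP in blast)
    ultimately have "\<forall>\<^sub>F y in at x. y \<in> F \<longrightarrow> f y \<notin> F"
      by (simp add: eventually_at_split)
    then have "\<forall>\<^sub>F z in at x. \<forall>\<^sub>F y in nhds z. y \<in> F \<longrightarrow> f y \<notin> F"
      by (rule eventually_at_nhds)
    then show ?thesis
    proof eventually_elim
      case (elim z)
      show ?case
      proof
        assume "Q z"
        then have "\<forall>\<^sub>F y in nhds z. y \<notin> F"
          using elim unfolding Q_def by eventually_elim blast
        then show False using dense' by blast
      qed
    qed
  qed
  \<comment> \<open>Here the extra condition for \<open>region = UNIV\<close> enters. In the other
    case a point \<open>p\<close> outside the union is fixed: for \<open>p\<close> in
    \<open>F\<close> its translation part is computed from \<open>f p = p\<close>, for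
    \<open>p\<close> outside \<open>F\<close> the germ is the identity.\<close>
  have "\<exists>x. Q x"
  proof (cases "region = UNIV")
    case True
    then have "Q 0" using onto unfolding Q_def by (auto intro!: always_eventually)
    then show ?thesis ..
  next
    case False
    then obtain p where p: "p \<notin> region" by blast
    then have "f p = p" using supp by (auto simp: supp_def)
    have notint: "p \<notin> interior (S i)" if "i \<in> I" for i
      using p that interior_subset mem_region by blast
    have "lc p \<in> F"
    proof (cases "p \<in> F")
      case True
      have "lc p = p - lm p * p" using lv[of p] \<open>f p = p\<close> by simp
      then show ?thesis using True lmP[of p] by (metis (no_types, lifting) mem_Collect_eq mem_intros(5,6))
    next
      case False
      then have "germ (nhds p) f (lm p) (lc p)" using nonbreak(1) brF by auto
      then have "lc p = 0" using germ_at_limit[OF notint cont supp] by blast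
      then show ?thesis by (simp add: zero_mem)
    qed
    then show ?thesis using QI by blast
  qed
  have "open {x. Q x}"
    unfolding Q_def by (subst open_subopen) (force simp: eventually_nhds)
  moreover have "open {x. \<not> Q x}"
  proof (subst open_subopen, rule ballI)
    fix x assume "x \<in> {x. \<not> Q x}"
    then have "\<not> Q x" "\<forall>\<^sub>F y in at x. \<not> Q y" using QI QD by blast+
    then have "\<forall>\<^sub>F y in nhds x. \<not> Q y" by (simp add: eventually_nhds_conv_at)
    then show "\<exists>T. open T \<and> x \<in> T \<and> T \<subseteq> {x. \<not> Q x}"
      unfolding eventually_nhds by blast
  qed
  moreover have "- {x. Q x} = {x. \<not> Q x}" by blast
  ultimately have "{x. Q x} = UNIV"
    using \<open>\<exists>x. Q x\<close> clopen[of "{x. Q x}"] by (auto simp: closed_def)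
  then have Q: "Q x" for x by blast
  have lF: "lc x \<in> F" for x
  proof (rule ccontr)
    assume "lc x \<notin> F"
    from QD[OF this] Q show False by simp
  qed
  have rF: "rc x \<in> F" for x using lF lr by blast
  have nh: "affine_germ (nhds x) f" if "x \<notin> breaks f" for x
    using nonbreak[OF that] lF unfolding affine_germ_def by blast
  then have sub: "kinks f \<subseteq> breaks f" by (auto simp: kinks_def)
  \<comment> \<open>Beyond all breaks a single affine germ persists up to infinity, by
    connectedness.\<close>
  have end_germ: "affine_germ \<Phi> f" if U: "eventually (\<lambda>x. x \<in> U) \<Phi>" "U \<inter> breaks f = {}" "connected U" "x0 \<in> U" for \<Phi> U x0
  proof -
    obtain m c where mc: "m \<in> F" "c \<in> F" "m > 0" "germ (nhds x0) f m c"
      using nh[of x0] U unfolding affine_germ_def by blast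
    have "germ (nhds x) f m c" if "x \<in> U" for x
      by (rule germ_connected[OF U(3,4) mc(4) _ that]) (use U(2) nonbreak(1) in blast)
    then have "f x = m * x + c" if "x \<in> U" for x
      using that by (auto simp: germ_def dest: eventually_nhds_x_imp_x)
    then have "germ \<Phi> f m c"
      using U(1) unfolding germ_def by (auto elim: eventually_mono)
    with mc show ?thesis unfolding affine_germ_def by blast
  qed
  obtain M where M: "\<And>x. x \<in> breaks f \<Longrightarrow> \<bar>x\<bar> \<le> M"
    using finite_imp_bounded[OF fin] by (auto simp: bounded_real)
  show ?thesis
    unfolding pl_def
  proof (intro conjI allI)
    show "affine_germ (at_left x) f" "affine_germ (at_right x) f" for x
      unfolding affine_germ_def using L R lF rF lmP rmP by blast+
    show "affine_germ at_top f"
      by (rule end_germ[of "{M<..}" _ "M + 1"]) (use M eventually_gt_at_top in \<open>force+\<close>)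
    show "affine_germ at_bot f"
      by (rule end_germ[of "{..- M - 1}" _ "- M - 1"]) (use M eventually_le_at_bot in \<open>force+\<close>)
  qed (use mono surj fin brF sub in \<open>auto intro: finite_subset\<close>)
qed

lemma pl_imp_PL_grp:
  assumes f: "pl f" "supp f \<subseteq> region"
  shows "f \<in> carrier (PL_grp region F positive)"
proof -
  have "homeomorphism UNIV UNIV f (finv f)"
    using pl_filterlim(6)[OF f(1)] pl_filterlim(6)[OF pl_inv[OF f(1)]] pl_surj[OF f(1)] pl_surj[OF pl_inv[OF f(1)]]
      pl_inv_f[OF f(1)] pl_f_inv[OF f(1)]
    by (auto simp: homeomorphism_def)
  moreover have "piecewise_linear f"
    unfolding piecewise_linear_def
  proof (intro exI[of _ "kinks f"] conjI allI impI)
    show "finite (kinks f \<inter> {a..b})" for a b using pl_kinks(1)[OF f(1)] by simp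
    fix a b :: real assume ab: "{a<..<b} \<inter> kinks f = {}"
    show "\<exists>m c. \<forall>x\<in>{a<..<b}. f x = m * x + c"
    proof (cases "a < b")
      case True
      then have mid: "(a + b) / 2 \<in> {a<..<b}" by simp
      then obtain m c where mc: "germ (nhds ((a + b) / 2)) f m c"
        using pl_germ_ex[OF f(1)] ab by blast
      have "\<exists>m c. germ (nhds x) f m c" if "x \<in> {a<..<b}" for x
        using ab that pl_germ_ex[OF f(1), of x] by blast
      then have "germ (nhds x) f m c" if "x \<in> {a<..<b}" for x
        using germ_connected[OF connected_Ioo mid mc _ that] by blast
      then have "\<forall>x\<in>{a<..<b}. f x = m * x + c"
        unfolding germ_def using eventually_nhds_x_imp_x by blast
      then show ?thesis by blast
    qed auto
  qed
  moreover have "slopes f \<subseteq> positive"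
  proof
    fix s assume "s \<in> slopes f"
    then obtain x where x: "s = deriv f x" "x \<notin> kinks f"
      unfolding slopes_def breaks_eq_kinks[OF f(1)] by blast
    then obtain m c where "m \<in> F" "m > 0" "germ (nhds x) f m c"
      unfolding kinks_def affine_germ_def by blast
    then show "s \<in> positive"
      using x DERIV_imp_deriv[OF affine_germ_nhds_deriv] by auto
  qed
  moreover have "f ` F = F"
    using pl_mem_iff[OF f(1)] pl_f_inv[OF f(1)] by (auto simp: image_iff) metis
  ultimately show ?thesis
    using f(2) pl_strict_mono[OF f(1)] pl_kinks[OF f(1)]
    unfolding PL_grp_def PLo_def by (auto simp: breaks_eq_kinks[OF f(1)])
qed

lemma carrier_grp: "carrier grp = {f. pl f \<and> supp f \<subseteq> region}"
proof -
  have "supp f \<subseteq> region" if "f \<in> carrier (PL_grp region F positive)" for f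
    using that by (auto simp: PL_grp_def)
  then show ?thesis
    unfolding grp_def using PL_grp_imp_pl pl_imp_PL_grp by blast
qed

lemma mult_grp: "f \<otimes>\<^bsub>grp\<^esub> g = f \<circ> g" and one_grp: "\<one>\<^bsub>grp\<^esub> = id"
  by (simp_all add: grp_def PL_grp_def PLo_def)

end

lemma supp_comp: "supp (f \<circ> g) \<subseteq> supp f \<union> supp g"
  by (auto simp: supp_def)

context real_subfield begin

lemma supp_finv: "pl f \<Longrightarrow> supp (finv f) = supp f"
  by (auto simp: supp_def) (metis pl_inv_f pl_f_inv)+

lemma finv_comp_self: "pl f \<Longrightarrow> finv f \<circ> f = id" "pl f \<Longrightarrow> f \<circ> finv f = id"
  by (auto simp: fun_eq_iff pl_inv_f pl_f_inv)

end

context pl_intervals begin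

sublocale G: group grp
proof (rule groupI)
  show "\<exists>y\<in>carrier grp. y \<otimes>\<^bsub>grp\<^esub> x = \<one>\<^bsub>grp\<^esub>" if "x \<in> carrier grp" for x
    using that by (intro bexI[of _ "finv x"])
      (auto simp: carrier_grp mult_grp one_grp finv_comp_self pl_inv supp_finv)
next
  fix f g assume "f \<in> carrier grp" "g \<in> carrier grp"
  then show "f \<otimes>\<^bsub>grp\<^esub> g \<in> carrier grp"
    using supp_comp[of f g] by (simp add: carrier_grp mult_grp pl_comp) blast
next
  show "\<one>\<^bsub>grp\<^esub> \<in> carrier grp"
    by (simp add: carrier_grp one_grp pl_id supp_def)
qed (simp_all add: mult_grp one_grp comp_assoc)

lemma inv_grp: "f \<in> carrier grp \<Longrightarrow> inv\<^bsub>grp\<^esub> f = finv f"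
  by (rule G.inv_equality) (auto simp: carrier_grp mult_grp one_grp finv_comp_self pl_inv supp_finv)

end

section \<open>Tents, ramps and commuting maps\<close>

text \<open>Conjugation by the reflection of the line; it transports results from the right to the
  left and from \<open>at_top\<close> to \<open>at_bot\<close>.\<close>

definition reflect :: "(real \<Rightarrow> real) \<Rightarrow> real \<Rightarrow> real" where
  "reflect f t = - f (- t)"

lemma germ_reflect: "germ \<Phi> f m c \<Longrightarrow> germ (filtermap uminus \<Phi>) (reflect f) m (- c)"
  unfolding germ_def reflect_def eventually_filtermap by (auto elim: eventually_mono)

lemma mirror_filters:
  "at_left x = filtermap uminus (at_right (- x))" "at_right x = filtermap uminus (at_left (- x))"
  "nhds x = filtermap uminus (nhds (- x))" for x :: real
  using at_left_minus[of x] at_right_minus[of x] filtermap_nhds_minus[of "- x"] by auto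

lemma supp_reflect: "supp (reflect f) = uminus ` supp f"
  by (auto simp: supp_def reflect_def image_iff) (metis add.inverse_inverse)+

lemma reflect_reflect: "reflect (reflect f) = f"
  by (auto simp: reflect_def)

text \<open>Monotonicity preserves the direction of the first step, so the orbit is strictly
  monotone.\<close>

lemma orbit_inj:
  fixes x :: "real \<Rightarrow> real"
  assumes "strict_mono x" "x q \<noteq> q"
  shows "inj (\<lambda>k. (x ^^ k) q)"
proof (cases "x q > q")
  case True
  have "(x ^^ k) q < (x ^^ Suc k) q" for k
    by (induction k) (use True strict_monoD[OF assms(1)] in auto)
  then have "strict_mono (\<lambda>k. (x ^^ k) q)" by (simp add: strict_mono_Suc_iff)
  then show ?thesis by (rule strict_mono_imp_inj_on)
next
  case False
  have "- (x ^^ k) q < - (x ^^ Suc k) q" for k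
    by (induction k) (use False assms(2) strict_monoD[OF assms(1)] in auto)
  then have "strict_mono (\<lambda>k. - (x ^^ k) q)" by (simp add: strict_mono_Suc_iff)
  then have "inj (\<lambda>k. - (x ^^ k) q)" by (rule strict_mono_imp_inj_on)
  then show ?thesis by (auto simp: inj_on_def)
qed

context real_subfield begin

lemma affine_germ_reflect: "affine_germ \<Phi> f \<Longrightarrow> affine_germ (filtermap uminus \<Phi>) (reflect f)"
  unfolding affine_germ_def using germ_reflect uminus_mem by blast

lemma kinks_reflect: "kinks (reflect f) = uminus ` kinks f"
proof -
  have "affine_germ (nhds x) f \<Longrightarrow> affine_germ (nhds (- x)) (reflect f)" for x f
    using affine_germ_reflect[of "nhds x" f] mirror_filters(3)[of "- x"] by simp
  then have "affine_germ (nhds (- x)) (reflect f) \<longleftrightarrow> affine_germ (nhds x) f" for x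
    using reflect_reflect[of f] by (metis add.inverse_inverse)
  then show ?thesis
    by (auto simp: kinks_def image_iff) (metis add.inverse_inverse)+
qed

lemma pl_reflect:
  assumes f: "pl f"
  shows "pl (reflect f)"
  unfolding pl_def
proof (intro conjI allI)
  show "strict_mono (reflect f)"
    using pl_less_iff[OF f] by (auto simp: strict_mono_def reflect_def)
  show "surj (reflect f)"
    by (rule surjI[of _ "\<lambda>y. - finv f (- y)"]) (simp add: reflect_def pl_f_inv[OF f])
  show "affine_germ (at_left x) (reflect f)" "affine_germ (at_right x) (reflect f)" for x
    using affine_germ_reflect pl_affine_germ[OF f] mirror_filters by metis+
  show "affine_germ at_top (reflect f)" "affine_germ at_bot (reflect f)"
    using affine_germ_reflect pl_affine_germ[OF f] at_top_mirror at_bot_mirror by metis+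
  show "finite (kinks (reflect f))" "kinks (reflect f) \<subseteq> F"
    using pl_kinks[OF f] by (auto simp: kinks_reflect uminus_mem)
qed

lemma pl_line:
  assumes "m \<in> F" "p \<in> F" "q \<in> F" "m > 0"
  shows "pl (\<lambda>t. q + m * (t - p))"
proof -
  have "pl (\<lambda>t. m * t + (q - m * p))"
    using assms by (intro pl_affine mem_intros)
  then show ?thesis by (simp add: algebra_simps)
qed

section \<open>Tents and ramps, the explicit building blocks\<close>

definition tent :: "real \<Rightarrow> real \<Rightarrow> real \<Rightarrow> real \<Rightarrow> real \<Rightarrow> real" where
  "tent a p q b t = (if t \<le> a then t else if t \<le> p then a + (q - a) / (p - a) * (t - a)
     else if t \<le> b then b + (b - q) / (b - p) * (t - b) else t)"

lemma pl_tent: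
  assumes "a < p" "p < b" "a < q" "q < b" "a \<in> F" "p \<in> F" "q \<in> F" "b \<in> F"
  shows "pl (tent a p q b)"
proof -
  have "pl (\<lambda>t. if t \<le> b then b + (b - q) / (b - p) * (t - b) else id t)"
    using assms by (intro pl_glue pl_line pl_id mem_intros) auto
  then have "pl (\<lambda>t. if t \<le> p then a + (q - a) / (p - a) * (t - a) else
      if t \<le> b then b + (b - q) / (b - p) * (t - b) else id t)"
    using assms by (intro pl_glue[where f = "\<lambda>t. a + (q - a) / (p - a) * (t - a)"] pl_line mem_intros)
      (auto simp: field_simps)
  then have "pl (\<lambda>t. if t \<le> a then id t else if t \<le> p then a + (q - a) / (p - a) * (t - a) else
      if t \<le> b then b + (b - q) / (b - p) * (t - b) else id t)"
    using assms by (intro pl_glue[where f = id] pl_id mem_intros) auto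
  moreover have "tent a p q b = (\<lambda>t. if t \<le> a then id t else if t \<le> p then a + (q - a) / (p - a) * (t - a) else
      if t \<le> b then b + (b - q) / (b - p) * (t - b) else id t)"
    by (rule ext) (simp add: tent_def)
  ultimately show ?thesis by (simp only:)
qed

lemma supp_tent: "a < p \<Longrightarrow> p < b \<Longrightarrow> supp (tent a p q b) \<subseteq> {a..b}"
  by (auto simp: supp_def tent_def split: if_splits)

text \<open>Designed to realise germs at \<open>at_top\<close>: \<open>\<mu>\<close> is the final
  slope, and the intermediate slope \<open>s\<close> shifts the final line vertically, so that its
  translation part can be prescribed.\<close>

definition ramp :: "real \<Rightarrow> real \<Rightarrow> real \<Rightarrow> real \<Rightarrow> real \<Rightarrow> real" where
  "ramp M N s \<mu> t = (if t \<le> M then t else if t \<le> N then M + s * (t - M)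
     else M + s * (N - M) + \<mu> * (t - N))"

lemma pl_ramp:
  assumes "M < N" "0 < s" "0 < \<mu>" "M \<in> F" "N \<in> F" "s \<in> F" "\<mu> \<in> F"
  shows "pl (ramp M N s \<mu>)"
proof -
  have "pl (\<lambda>t. if t \<le> N then M + s * (t - M) else M + s * (N - M) + \<mu> * (t - N))"
    using assms by (intro pl_glue pl_line mem_intros) auto
  then have "pl (\<lambda>t. if t \<le> M then id t else if t \<le> N then M + s * (t - M)
     else M + s * (N - M) + \<mu> * (t - N))"
    using assms by (intro pl_glue[where f = id] pl_id) auto
  moreover have "ramp M N s \<mu> = (\<lambda>t. if t \<le> M then id t else if t \<le> N then M + s * (t - M)
     else M + s * (N - M) + \<mu> * (t - N))"
    by (rule ext) (simp add: ramp_def)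
  ultimately show ?thesis by (simp only:)
qed

lemma kinks_line: "m \<in> F \<Longrightarrow> p \<in> F \<Longrightarrow> q \<in> F \<Longrightarrow> m > 0 \<Longrightarrow> kinks (\<lambda>t. q + m * (t - p)) = {}"
proof -
  assume a: "m \<in> F" "p \<in> F" "q \<in> F" "m > 0"
  have "affine_germ \<Phi> (\<lambda>t. m * t + (q - m * p))" for \<Phi>
    using a by (intro affine_germ_affine mem_intros)
  then show ?thesis by (simp add: kinks_def algebra_simps)
qed

lemma kinks_id: "kinks id = {}"
  using kinks_line[of 1 0 0] by (simp add: one_mem zero_mem id_def)

lemma kinks_tent:
  assumes "a < p" "p < b" "a < q" "q < b" "a \<in> F" "p \<in> F" "q \<in> F" "b \<in> F"
  shows "kinks (tent a p q b) \<subseteq> {a, p, b}"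
proof -
  define l r where "l = (\<lambda>t. a + (q - a) / (p - a) * (t - a))" and "r = (\<lambda>t. b + (b - q) / (b - p) * (t - b))"
  have "kinks l = {}"
    unfolding l_def by (rule kinks_line) (use assms in \<open>auto intro!: mem_intros\<close>)
  moreover have "kinks r = {}"
    unfolding r_def by (rule kinks_line) (use assms in \<open>auto intro!: mem_intros\<close>)
  moreover have "tent a p q b = (\<lambda>t. if t \<le> a then id t else if t \<le> p then l t else if t \<le> b then r t else id t)"
    by (rule ext) (simp add: tent_def l_def r_def)
  ultimately show ?thesis
    using kinks_glue[of a id "\<lambda>t. if t \<le> p then l t else if t \<le> b then r t else id t"]
      kinks_glue[of p l "\<lambda>t. if t \<le> b then r t else id t"] kinks_glue[of b r id]
    by (simp only: kinks_id) blast
qed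

lemma kinks_ramp:
  assumes "M < N" "0 < s" "0 < \<mu>" "M \<in> F" "N \<in> F" "s \<in> F" "\<mu> \<in> F"
  shows "kinks (ramp M N s \<mu>) \<subseteq> {M, N}"
proof -
  define l r where "l = (\<lambda>t. M + s * (t - M))" and "r = (\<lambda>t. M + s * (N - M) + \<mu> * (t - N))"
  have "kinks l = {}"
    unfolding l_def by (rule kinks_line) (use assms in \<open>auto intro!: mem_intros\<close>)
  moreover have "kinks r = {}"
    unfolding r_def by (rule kinks_line) (use assms in \<open>auto intro!: mem_intros\<close>)
  moreover have "ramp M N s \<mu> = (\<lambda>t. if t \<le> M then id t else if t \<le> N then l t else r t)"
    by (rule ext) (simp add: ramp_def l_def r_def)
  ultimately show ?thesis
    using kinks_glue[of M id "\<lambda>t. if t \<le> N then l t else r t"] kinks_glue[of N l r]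
    by (simp only: kinks_id) blast
qed

lemma kinkI:
  assumes "germ (at_left x) f m c" "germ (at_right x) f m' c'" "m \<noteq> m'"
  shows "x \<in> kinks f"
proof (rule ccontr)
  assume "x \<notin> kinks f"
  then obtain k d where "germ (nhds x) f k d" unfolding kinks_def affine_germ_def by blast
  then have kd: "germ \<Phi> f k d" if "\<Phi> \<le> nhds x" for \<Phi> using germ_filter_mono that by blast
  have n: "\<forall>\<^sub>F z in at_left x. z \<noteq> y" "\<forall>\<^sub>F z in at_right x. z \<noteq> y" for y
    by (rule eventually_neq_at_within)+
  have "at_left x \<le> nhds x" "at_right x \<le> nhds x" by (simp_all add: at_within_def)
  then have "m = k" "m' = k"
    using germ_unique[OF assms(1) kd trivial_limit_at_left_real n(1)]
      germ_unique[OF assms(2) kd trivial_limit_at_right_real n(2)] by auto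
  with assms(3) show False by simp
qed

lemma supp_ramp: "supp (ramp M N s \<mu>) \<subseteq> {M<..}"
  by (auto simp: supp_def ramp_def)

lemma germ_ramp: "germ at_top (ramp M N s \<mu>) \<mu> (M + s * (N - M) - \<mu> * N)"
proof -
  have "\<forall>\<^sub>F y in at_top. y > max M N" by (rule eventually_gt_at_top)
  then show ?thesis
    unfolding germ_def by eventually_elim (simp add: ramp_def algebra_simps)
qed

lemma abs_mem: "x \<in> F \<Longrightarrow> \<bar>x\<bar> \<in> F"
  by (cases "x \<ge> 0") (auto simp: uminus_mem)

lemma exists_germ_at_top:
  assumes "\<mu> \<in> F" "\<mu> > 0" "d \<in> F" "M \<in> F"
  obtains g where "pl g" "supp g \<subseteq> {M<..}" "germ at_top g \<mu> d"
proof -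
  \<comment> \<open>Large enough that the target line \<open>\<mu> * t + d\<close> has risen above
    \<open>M\<close> at \<open>t = N\<close>; a positive slope \<open>s\<close> then joins the point
    \<open>(M, M)\<close> to that line.\<close>
  define N where "N = \<bar>M\<bar> + (\<bar>M\<bar> + \<bar>d\<bar>) / \<mu> + 1"
  have "(\<bar>M\<bar> + \<bar>d\<bar>) / \<mu> \<ge> 0" using assms(2) by simp
  then have "N > M" unfolding N_def by linarith
  moreover have "N \<in> F"
    unfolding N_def by (intro mem_intros abs_mem assms)
  ultimately have N: "N \<in> F" "N > M" by auto
  have "\<mu> * N = \<mu> * \<bar>M\<bar> + \<bar>M\<bar> + \<bar>d\<bar> + \<mu>"
    using assms by (simp add: N_def field_simps)
  moreover have "\<mu> * \<bar>M\<bar> \<ge> 0" using assms(2) by simp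
  ultimately have P: "\<mu> * N + d > M" using assms(2) by linarith
  define s where "s = (\<mu> * N + d - M) / (N - M)"
  have s: "s > 0" "s \<in> F" using N P assms by (auto simp: s_def intro!: mem_intros)
  have "M + s * (N - M) - \<mu> * N = d" using N by (simp add: s_def)
  then have "germ at_top (ramp M N s \<mu>) \<mu> d" using germ_ramp[of M N s \<mu>] by simp
  then show thesis using that pl_ramp supp_ramp N s assms by blast
qed

lemma exists_germ_at_bot:
  assumes "\<mu> \<in> F" "\<mu> > 0" "d \<in> F" "M \<in> F"
  obtains g where "pl g" "supp g \<subseteq> {..<M}" "germ at_bot g \<mu> d"
proof -
  obtain g where g: "pl g" "supp g \<subseteq> {- M<..}" "germ at_top g \<mu> (- d)"
    using exists_germ_at_top[of \<mu> "- d" "- M"] assms uminus_mem by metis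
  have "supp (reflect g) \<subseteq> {..<M}" using g(2) by (auto simp: supp_reflect)
  moreover have "germ at_bot (reflect g) \<mu> d"
    using germ_reflect[OF g(3)] by (simp add: at_bot_mirror)
  ultimately show thesis using that pl_reflect[OF g(1)] by blast
qed

section \<open>Maps that commute with a map having a single moved kink\<close>

lemma kinks_comp_mono: "pl g \<Longrightarrow> y \<notin> kinks g \<Longrightarrow> g y \<notin> kinks f \<Longrightarrow> y \<notin> kinks (f \<circ> g)"
  using affine_germ_comp[OF _ _ pl_filterlim(1)] by (auto simp: kinks_def)

lemma kinks_finv: assumes "pl f" "y \<notin> kinks f" shows "f y \<notin> kinks (finv f)"
  using kinks_inv[OF assms(1)] assms(2) pl_inj[OF assms(1)] by (auto dest: injD)

text \<open>If \<open>x\<close> bends at \<open>q\<close> but nowhere else along the orbit of \<open>q\<close>, then a map commuting with \<open>x\<close> must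
  send \<open>q\<close> into its own orbit: otherwise it would bend at \<open>x\<^sup>k q\<close> for all large \<open>k\<close>
  (or for all large negative \<open>k\<close>), contradicting the finiteness of its kinks.\<close>

lemma commuting_orbit:
  assumes f: "pl f" and x: "pl x" and comm: "f \<circ> x = x \<circ> f"
    and q: "q \<in> kinks x" "x q \<noteq> q" and fixd: "\<And>y. y \<in> kinks x \<Longrightarrow> y \<noteq> q \<Longrightarrow> x y = y"
  obtains n m where "f ((x ^^ n) q) = (x ^^ m) q"
proof (rule ccontr)
  assume "\<not> thesis"
  with that have no: "f ((x ^^ n) q) \<noteq> (x ^^ m) q" for n m by blast
  have cp: "f (x y) = x (f y)" for y using comm by (metis comp_apply)
  \<comment> \<open>The backward orbit \<open>b\<close> and the forward orbit \<open>a\<close> of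
    \<open>q\<close>; each is without repetitions.\<close>
  define b where "b k = (finv x ^^ k) q" for k
  define a where "a k = (x ^^ k) q" for k
  have x_mono: "strict_mono x" and xi_mono: "strict_mono (finv x)"
    using pl_strict_mono pl_inv x by blast+
  have qi: "finv x q \<noteq> q" using q(2) pl_f_inv[OF x] by metis
  have inj: "inj a" "inj b"
    unfolding a_def b_def using orbit_inj[OF x_mono q(2)] orbit_inj[OF xi_mono qi] by auto
  have bS: "x (b (Suc k)) = b k" for k by (simp add: b_def pl_f_inv[OF x])
  have aS: "x (a k) = a (Suc k)" for k by (simp add: a_def)
  have xb: "(x ^^ k) (b k) = q" for k
    by (induction k) (simp add: b_def, simp add: funpow_Suc_right bS del: funpow.simps)
  have moved: "x (a k) \<noteq> a k" "x (b k) \<noteq> b k" for k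
  proof -
    show "x (a k) \<noteq> a k" using injD[OF inj(1), of k "Suc k"] aS by auto
    have "(x ^^ j) y = y" if "x y = y" for j y
      using that by (induction j) auto
    then show "x (b k) \<noteq> b k" using xb[of k] q(2) by metis
  qed
  \<comment> \<open>As \<open>f\<close> commutes with \<open>x\<close>, it maps moved points to
    moved points. The only kink that \<open>x\<close> moves is \<open>q\<close>, and hitting
    \<open>q\<close> would be an orbit relation of the excluded kind.\<close>
  have nk_f: "f y \<notin> kinks x" if "y = a k \<or> y = b k" for y k
  proof
    assume "f y \<in> kinks x"
    moreover have "x (f y) \<noteq> f y"
      using that moved cp pl_inj[OF f] by (metis injD)
    ultimately have "f y = q" using fixd by blast
    then show False
    proof (cases "y = a k")
      case True
      then show False using no[of k 0] \<open>f y = q\<close> by (simp add: a_def)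
    next
      case False
      then have "y = b k" using that by blast
      have "f ((x ^^ k) y) = (x ^^ k) (f y)" by (induction k) (auto simp: cp)
      then show False using no[of 0 k] \<open>f y = q\<close> \<open>y = b k\<close> xb by simp
    qed
  qed
  have nk_b: "b (Suc k) \<notin> kinks x" for k
  proof -
    have "b (Suc k) \<noteq> q" using injD[OF inj(2), of "Suc k" 0] by (auto simp: b_def)
    then show ?thesis using fixd moved(2) by blast
  qed
  have nk_a: "a (Suc k) \<notin> kinks x" for k
  proof -
    have "a (Suc k) \<noteq> q" using injD[OF inj(1), of "Suc k" 0] by (auto simp: a_def)
    then show ?thesis using fixd moved(1) by blast
  qed
  \<comment> \<open>Written as \<open>f \<circ> x \<circ> finv x\<close>, the map \<open>f\<close>
    inherits regularity at \<open>b k\<close> from regularity at \<open>b (Suc k)\<close>. The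
    backward orbit is infinite, so it contains a point that is no kink of \<open>f\<close>; hence
    \<open>q\<close> is none either.\<close>
  have down: "b k \<notin> kinks f" if "b (Suc k) \<notin> kinks f" for k
  proof -
    have "b (Suc k) \<notin> kinks (x \<circ> f)"
      using kinks_comp_mono[OF f that] nk_f by blast
    then have "b (Suc k) \<notin> kinks (f \<circ> x)" by (simp add: comm)
    moreover have "b k \<notin> kinks (finv x)"
      using kinks_finv[OF x nk_b] bS by metis
    moreover have "finv x (b k) = b (Suc k)" by (simp add: b_def)
    ultimately have "b k \<notin> kinks (f \<circ> x \<circ> finv x)"
      using kinks_comp_mono[OF pl_inv[OF x]] by metis
    then show ?thesis by (simp add: comp_assoc finv_comp_self[OF x])
  qed
  have "\<not> range b \<subseteq> kinks f"
    using pl_kinks(1)[OF f] range_inj_infinite[OF inj(2)] finite_subset by blast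
  then obtain K where "b K \<notin> kinks f" by blast
  then have "b 0 \<notin> kinks f" by (induction K) (use down in blast)+
  then have q0: "a 0 \<notin> kinks f" by (simp add: a_def b_def)
  then have "a 0 \<notin> kinks (x \<circ> f)" using kinks_comp_mono[OF f] nk_f by blast
  then have q0': "a 0 \<notin> kinks (f \<circ> x)" by (simp add: comm)
  \<comment> \<open>The bend of \<open>x\<close> at \<open>q\<close> must reappear in
    \<open>f\<close> at \<open>x q\<close>, because \<open>x = finv f \<circ> (f \<circ> x)\<close>
    and \<open>f \<circ> x\<close> is regular at \<open>q\<close>. From there the kink is carried
    forward along the whole orbit, which is impossible.\<close>
  have "a (Suc k) \<in> kinks f" for k
  proof (induction k)
    case 0
    show ?case
    proof (rule ccontr)
      assume "a (Suc 0) \<notin> kinks f"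
      then have "f (a (Suc 0)) \<notin> kinks (finv f)" by (rule kinks_finv[OF f])
      then have "a 0 \<notin> kinks (finv f \<circ> (f \<circ> x))"
        using kinks_comp_mono[OF pl_comp[OF f x] q0'] aS[of 0] by simp
      then show False using q(1) by (simp add: comp_assoc[symmetric] finv_comp_self[OF f] a_def)
    qed
  next
    case (Suc k)
    show ?case
    proof (rule ccontr)
      assume "a (Suc (Suc k)) \<notin> kinks f"
      then have "a (Suc k) \<notin> kinks (f \<circ> x)"
        using kinks_comp_mono[OF x nk_a] aS by metis
      then have "a (Suc k) \<notin> kinks (x \<circ> f)" by (simp add: comm)
      moreover have "x (f (a (Suc k))) \<notin> kinks (finv x)"
        using kinks_finv[OF x] nk_f by blast
      ultimately have "a (Suc k) \<notin> kinks (finv x \<circ> (x \<circ> f))"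
        using kinks_comp_mono[OF pl_comp[OF x f]] by simp
      then show False using Suc by (simp add: comp_assoc[symmetric] finv_comp_self[OF x])
    qed
  qed
  then have "range (\<lambda>k. a (Suc k)) \<subseteq> kinks f" by blast
  moreover have "inj (\<lambda>k. a (Suc k))" using inj(1) by (auto simp: inj_on_def)
  ultimately show False
    using pl_kinks(1)[OF f] range_inj_infinite finite_subset by blast
qed

text \<open>The orbit of \<open>q\<close> is geometric about \<open>w\<close> with ratio
  \<open>\<beta>\<close>, and \<open>f\<close> shifts its far part by \<open>m - n\<close> steps.
  Subtracting the equations for two consecutive orbit points removes the translation part and leaves
  \<open>\<nu>\<close> as the power of \<open>\<beta>\<close> with exponent
  \<open>m - n\<close>.\<close>

lemma commuting_slope:
  assumes f: "pl f" and x: "pl x" and comm: "f \<circ> x = x \<circ> f"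
    and q: "q \<in> kinks x" and fixd: "\<And>y. y \<in> kinks x \<Longrightarrow> y \<noteq> q \<Longrightarrow> x y = y"
    and orbit: "\<And>k. (x ^^ k) q = w + \<beta> ^ k * (q - w)" and \<beta>: "\<beta> > 0" "\<beta> \<noteq> 1" "w \<noteq> q"
    and lim: "filterlim (\<lambda>k. (x ^^ k) q) \<Phi> sequentially" and g: "germ \<Phi> f \<nu> d"
  shows "\<exists>k::int. \<nu> = \<beta> powi k"
proof -
  have "x q - q = (\<beta> - 1) * (q - w)" using orbit[of 1] by (simp add: algebra_simps)
  then have "x q \<noteq> q" using \<beta> by auto
  then obtain n m where nm: "f ((x ^^ n) q) = (x ^^ m) q"
    using commuting_orbit[OF f x comm q _ fixd] by blast
  have cp: "f ((x ^^ k) y) = (x ^^ k) (f y)" for k y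
    by (induction k) (use comm in \<open>auto simp: fun_eq_iff\<close>)
  have orb: "f ((x ^^ (k + n)) q) = (x ^^ (k + m)) q" for k
    by (metis funpow_add comp_apply cp nm)
  have "\<forall>\<^sub>F k in sequentially. f ((x ^^ k) q) = \<nu> * (x ^^ k) q + d"
    using g lim unfolding germ_def filterlim_iff by blast
  then obtain K where K: "\<And>k. k \<ge> K \<Longrightarrow> f ((x ^^ k) q) = \<nu> * (x ^^ k) q + d"
    unfolding eventually_sequentially by blast
  have e: "w + \<beta> ^ (k + m) * (q - w) = \<nu> * (w + \<beta> ^ (k + n) * (q - w)) + d" if "k \<ge> K" for k
    using K[of "k + n"] orb[of k] that by (simp add: orbit)
  have "(\<beta> ^ K * (\<beta> - 1) * (q - w)) * (\<beta> ^ m - \<nu> * \<beta> ^ n) = 0"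
  proof -
    define u v A B where uv: "u = \<beta> ^ (K + m)" "v = \<beta> ^ (K + n)" "A = q - w" "B = \<nu>"
    have "w + u * A = B * (w + v * A) + d" "w + (\<beta> * u) * A = B * (w + (\<beta> * v) * A) + d"
      using e[of K] e[of "Suc K"] by (simp_all add: uv)
    moreover have "(\<beta> - 1) * A * (u - B * v) = (w + (\<beta> * u) * A) - (w + u * A)
        - ((B * (w + (\<beta> * v) * A) + d) - (B * (w + v * A) + d))"
      by (simp add: algebra_simps)
    ultimately have "(\<beta> - 1) * A * (u - B * v) = 0" by simp
    then show ?thesis by (simp add: uv power_add algebra_simps)
  qed
  then have "\<nu> * \<beta> ^ n = \<beta> ^ m" using \<beta> by simp
  then have "\<nu> = \<beta> powi (int m - int n)"
    using \<beta> by (simp add: power_int_diff field_simps)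
  then show ?thesis ..
qed

end

section \<open>Restriction of a group element to a single interval\<close>

definition restrict_to :: "real set \<Rightarrow> (real \<Rightarrow> real) \<Rightarrow> real \<Rightarrow> real" where
  "restrict_to J f t = (if t \<in> J then f t else t)"

lemma supp_restrict_to: "supp (restrict_to J f) \<subseteq> J \<inter> supp f"
  by (auto simp: supp_def restrict_to_def split: if_splits)

text \<open>If an interval has points arbitrarily far along one of these filters, convexity fills
  the gaps between them.\<close>

lemma interval_eventually_sided:
  fixes x :: real
  assumes "is_interval J" "\<Phi> = at_left x \<or> \<Phi> = at_right x \<or> \<Phi> = at_top \<or> \<Phi> = at_bot"
  shows "(\<forall>\<^sub>F y in \<Phi>. y \<in> J) \<or> (\<forall>\<^sub>F y in \<Phi>. y \<notin> J)"
proof (cases "\<exists>\<^sub>F y in \<Phi>. y \<in> J")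
  case True
  then have beyond: "\<exists>y\<in>J. P y" if "eventually P \<Phi>" for P
    using frequently_ex[OF frequently_eventually_conj[OF True that]] by blast
  have mid: "y \<in> J" if "u \<in> J" "v \<in> J" "u \<le> y" "y \<le> v" for u v y
    using assms(1) that unfolding is_interval_1 by blast
  have lt: "\<forall>\<^sub>F y in at_left x. y < x" and gt: "\<forall>\<^sub>F y in at_right x. x < y"
    by (simp_all add: eventually_at_filter)
  consider "\<Phi> = at_left x" | "\<Phi> = at_right x" | "\<Phi> = at_top" | "\<Phi> = at_bot"
    using assms(2) by blast
  then show ?thesis
  proof cases
    case 1
    obtain z where z: "z \<in> J" "z < x"
      using beyond[unfolded 1, OF lt] by blast
    have "y \<in> J" if yz: "z < y" "y < x" for y
    proof -
      obtain v where v: "v \<in> J" "v \<in> {y<..<x}"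
        using beyond[unfolded 1, OF eventually_at_left_real[OF yz(2)]] by blast
      then show ?thesis using mid[OF z(1) v(1), of y] yz by simp
    qed
    then show ?thesis unfolding 1 eventually_at_left_field using z(2) by blast
  next
    case 2
    obtain z where z: "z \<in> J" "x < z"
      using beyond[unfolded 2, OF gt] by blast
    have "y \<in> J" if yz: "x < y" "y < z" for y
    proof -
      obtain v where v: "v \<in> J" "v \<in> {x<..<y}"
        using beyond[unfolded 2, OF eventually_at_right_real[OF yz(1)]] by blast
      then show ?thesis using mid[OF v(1) z(1), of y] yz by simp
    qed
    then show ?thesis unfolding 2 eventually_at_right_field using z(2) by blast
  next
    case 3
    obtain z where z: "z \<in> J" using beyond[OF eventually_True] by blast
    have "y \<in> J" if "z \<le> y" for y
      using beyond[unfolded 3, OF eventually_ge_at_top[of y]] mid z that by blast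
    then show ?thesis unfolding 3 eventually_at_top_linorder by blast
  next
    case 4
    obtain z where z: "z \<in> J" using beyond[OF eventually_True] by blast
    have "y \<in> J" if "y \<le> z" for y
      using beyond[unfolded 4, OF eventually_le_at_bot[of y]] mid z that by blast
    then show ?thesis unfolding 4 eventually_at_bot_linorder by blast
  qed
qed (simp add: frequently_def)

context pl_intervals begin

lemma grp_fixes_frontier:
  assumes "f \<in> carrier grp" "i \<in> I" "e \<in> frontier (S i)"
  shows "f e = e"
  using assms fixed_at_limit[OF frontier_not_interior[OF assms(2,3)]] pl_filterlim(6) by (auto simp: carrier_grp)

lemma grp_germ_frontier:
  assumes "f \<in> carrier grp" "i \<in> I" "e \<in> frontier (S i)" "germ (nhds e) f m c"
  shows "m = 1 \<and> c = 0"
  using assms germ_at_limit[OF frontier_not_interior[OF assms(2,3)]] pl_filterlim(6) by (auto simp: carrier_grp)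

text \<open>Otherwise the segment between \<open>t\<close> and \<open>f t\<close> would meet the
  frontier of \<open>S i\<close>, which is fixed pointwise, and an increasing map carries no other
  point onto or across a fixed point.\<close>

lemma grp_preserves_component:
  assumes f: "f \<in> carrier grp" and i: "i \<in> I" and t: "t \<in> S i"
  shows "f t \<in> S i"
proof (rule ccontr)
  assume no: "f t \<notin> S i"
  have pf: "pl f" using f by (simp add: carrier_grp)
  define K where "K = {min t (f t)..max t (f t)}"
  have "t \<in> K" "f t \<in> K" by (auto simp: K_def)
  then have "K \<inter> S i \<noteq> {}" "K - S i \<noteq> {}" using t no by blast+
  then have "K \<inter> frontier (S i) \<noteq> {}"
    by (intro connected_Int_frontier) (auto simp: K_def)
  then obtain e where e: "e \<in> K" "f e = e"
    using grp_fixes_frontier[OF f i] by blast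
  consider "t < e" | "t = e" | "t > e" by linarith
  then show False
  proof cases
    case 1
    then show False using pl_less_iff[OF pf, of t e] e by (auto simp: K_def)
  next
    case 2
    then show False using e t no by simp
  next
    case 3
    then show False using pl_less_iff[OF pf, of e t] e by (auto simp: K_def)
  qed
qed

lemma finv_in_grp: "f \<in> carrier grp \<Longrightarrow> finv f \<in> carrier grp"
  using inv_grp G.inv_closed by metis

lemma component_iff:
  assumes "f \<in> carrier grp" "i \<in> I"
  shows "f t \<in> S i \<longleftrightarrow> t \<in> S i"
  using grp_preserves_component[OF assms] grp_preserves_component[OF finv_in_grp assms(2), OF assms(1)]
    pl_inv_f assms by (metis (no_types, lifting) carrier_grp mem_Collect_eq)

text \<open>Cutting at an endpoint creates no new kink: if \<open>f\<close> has a two-sided germ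
  there, this germ is the identity, and if it has none, the endpoint is already a kink of
  \<open>f\<close> and lies in \<open>F\<close>.\<close>

lemma restrict_to_in_grp:
  assumes f: "f \<in> carrier grp" and i: "i \<in> I"
  shows "restrict_to (S i) f \<in> carrier grp"
proof -
  let ?J = "S i" and ?h = "restrict_to (S i) f"
  have pf: "pl f" and sf: "supp f \<subseteq> region" using f by (simp_all add: carrier_grp)
  note c = component_iff[OF f i]
  have mid: "y \<in> ?J" if "u \<in> ?J" "v \<in> ?J" "u \<le> y" "y \<le> v" for u v y
    using interval[OF i] that unfolding is_interval_1 by blast
  have out: "affine_germ \<Phi> id" for \<Phi>
    unfolding affine_germ_def
    by (intro bexI[of _ 1] bexI[of _ 0] conjI germ_id one_mem zero_mem zero_less_one)
  have cases: "affine_germ \<Phi> ?h" if "affine_germ \<Phi> f" "(\<forall>\<^sub>F y in \<Phi>. y \<in> ?J) \<or> (\<forall>\<^sub>F y in \<Phi>. y \<notin> ?J)" for \<Phi>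
    using that(2)
  proof
    assume "\<forall>\<^sub>F y in \<Phi>. y \<in> ?J"
    then have "\<forall>\<^sub>F y in \<Phi>. ?h y = f y" by eventually_elim (simp add: restrict_to_def)
    then show ?thesis using affine_germ_cong that(1) by blast
  next
    assume "\<forall>\<^sub>F y in \<Phi>. y \<notin> ?J"
    then have "\<forall>\<^sub>F y in \<Phi>. ?h y = id y" by eventually_elim (simp add: restrict_to_def)
    then show ?thesis using affine_germ_cong out by blast
  qed
  have kinks: "x \<notin> kinks ?h" if x: "x \<notin> kinks f \<or> x \<notin> F" for x
  proof (cases "x \<in> frontier ?J")
    case True
    have "x \<notin> kinks f" using x pl_kinks(2)[OF pf] by blast
    then obtain m c where "germ (nhds x) f m c"
      using pl_germ_ex[OF pf] by blast
    then have "germ (nhds x) f 1 0"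
      using grp_germ_frontier[OF f i True] by blast
    then have "\<forall>\<^sub>F y in nhds x. ?h y = id y"
      unfolding germ_def by eventually_elim (simp add: restrict_to_def)
    then show ?thesis using affine_germ_cong out unfolding kinks_def by blast
  next
    case False
    have "x \<notin> kinks f" using x pl_kinks(2)[OF pf] by blast
    moreover have "(\<forall>\<^sub>F y in nhds x. y \<in> ?J) \<or> (\<forall>\<^sub>F y in nhds x. y \<notin> ?J)"
    proof (cases "x \<in> interior ?J")
      case True
      then show ?thesis
        using eventually_nhds_in_open[OF open_interior True] interior_subset
        by (auto elim!: eventually_mono)
    next
      case False
      with \<open>x \<notin> frontier ?J\<close> have x: "x \<in> - closure ?J" by (simp add: frontier_def)
      have "open (- closure ?J)" by (simp add: open_Compl)
      then have "\<forall>\<^sub>F y in nhds x. y \<in> - closure ?J"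
        using x by (rule eventually_nhds_in_open)
      then have "\<forall>\<^sub>F y in nhds x. y \<notin> ?J"
        by eventually_elim (use closure_subset in blast)
      then show ?thesis ..
    qed
    ultimately show ?thesis using cases by (simp add: kinks_def)
  qed
  have "pl ?h"
    unfolding pl_def
  proof (intro conjI allI)
    show "strict_mono ?h"
    proof (rule strict_monoI)
      fix x y :: real assume xy: "x < y"
      consider "x \<in> ?J" "y \<in> ?J" | "x \<notin> ?J" "y \<notin> ?J" | "x \<in> ?J" "y \<notin> ?J" | "x \<notin> ?J" "y \<in> ?J" by blast
      then show "?h x < ?h y"
      proof cases
        case 3
        have "f x < y"
        proof (rule ccontr)
          assume "\<not> f x < y"
          then have "y \<in> ?J" using mid[OF 3(1), of "f x" y] c[of x] 3(1) xy by auto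
          with 3(2) show False by blast
        qed
        then show ?thesis using 3 by (simp add: restrict_to_def)
      next
        case 4
        have "x < f y"
        proof (rule ccontr)
          assume "\<not> x < f y"
          then have "x \<in> ?J" using mid[of "f y" y x] c[of y] 4(2) xy by auto
          with 4(1) show False by blast
        qed
        then show ?thesis using 4 by (simp add: restrict_to_def)
      qed (use xy pl_less_iff[OF pf] in \<open>auto simp: restrict_to_def\<close>)
    qed
    show "surj ?h"
    proof (rule surjI)
      fix y
      show "?h (restrict_to ?J (finv f) y) = y"
        using c[of "finv f y"] pl_f_inv[OF pf, of y] by (auto simp: restrict_to_def)
    qed
    show "affine_germ (at_left x) ?h" "affine_germ (at_right x) ?h" for x
      by (rule cases; use interval_eventually_sided[OF interval[OF i]] pl_affine_germ[OF pf] in blast)+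
    show "affine_germ at_top ?h" "affine_germ at_bot ?h"
      by (rule cases; use interval_eventually_sided[OF interval[OF i]] pl_affine_germ[OF pf] in blast)+
    have "kinks ?h \<subseteq> kinks f \<inter> F" using kinks by blast
    then show "finite (kinks ?h)" "kinks ?h \<subseteq> F" using pl_kinks[OF pf] by (auto intro: finite_subset)
  qed
  then show ?thesis
    using sf supp_restrict_to[of ?J f] by (auto simp: carrier_grp)
qed

end

section \<open>Compactly supported maps modulo a normal subgroup\<close>

text \<open>Affinity from one segment to another in barycentric form. Such statements compose
  without any computation of slopes, which reduces an identity between products of tents to a
  comparison of the division points.\<close>

definition seg :: "(real \<Rightarrow> real) \<Rightarrow> real \<Rightarrow> real \<Rightarrow> real \<Rightarrow> real \<Rightarrow> bool" where
  "seg f x y u v \<longleftrightarrow> (\<forall>\<theta>\<in>{0..1}. f (x + \<theta> * (y - x)) = u + \<theta> * (v - u))"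

lemma seg_comp: "seg f x y u v \<Longrightarrow> seg g u v z w \<Longrightarrow> seg (g \<circ> f) x y z w"
  by (auto simp: seg_def)

lemma seg_eq:
  assumes "seg f x y u v" "seg g x y u v" "x < y" "x \<le> t" "t \<le> y"
  shows "f t = g t"
proof -
  have "(t - x) / (y - x) \<in> {0..1}" "t = x + (t - x) / (y - x) * (y - x)"
    using assms(3-5) by auto
  then show ?thesis using assms(1,2) unfolding seg_def by metis
qed

context real_subfield begin

lemma seg_tent_left:
  assumes "a \<le> x" "x \<le> y" "y \<le> p" "u = a + (q - a) / (p - a) * (x - a)" "v = a + (q - a) / (p - a) * (y - a)"
  shows "seg (tent a p q b) x y u v"
  unfolding seg_def
proof
  fix \<theta> :: real assume \<theta>: "\<theta> \<in> {0..1}"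
  define t where "t = x + \<theta> * (y - x)"
  have "0 \<le> \<theta> * (y - x)" "\<theta> * (y - x) \<le> y - x"
    using \<theta> assms(2) mult_left_le_one_le[of "y - x" \<theta>] by auto
  then have "a \<le> t" "t \<le> p" using assms(1,3) by (auto simp: t_def)
  then have "tent a p q b t = a + (q - a) / (p - a) * (t - a)" by (auto simp: tent_def)
  also have "\<dots> = u + \<theta> * (v - u)"
  proof -
    define k where "k = (q - a) / (p - a)"
    show ?thesis unfolding assms(4,5) t_def k_def[symmetric] by (simp add: algebra_simps)
  qed
  finally show "tent a p q b (x + \<theta> * (y - x)) = u + \<theta> * (v - u)" by (simp add: t_def)
qed

lemma seg_tent_right:
  assumes "a < p" "p < b" "p \<le> x" "x \<le> y" "y \<le> b"
    "u = b + (b - q) / (b - p) * (x - b)" "v = b + (b - q) / (b - p) * (y - b)"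
  shows "seg (tent a p q b) x y u v"
  unfolding seg_def
proof
  fix \<theta> :: real assume \<theta>: "\<theta> \<in> {0..1}"
  define t where "t = x + \<theta> * (y - x)"
  have "0 \<le> \<theta> * (y - x)" "\<theta> * (y - x) \<le> y - x"
    using \<theta> assms(4) mult_left_le_one_le[of "y - x" \<theta>] by auto
  then have t: "p \<le> t" "t \<le> b" using assms(3,5) by (auto simp: t_def)
  have "tent a p q b t = b + (b - q) / (b - p) * (t - b)"
  proof (cases "t = p")
    case True
    then show ?thesis using assms(1,2) by (simp add: tent_def field_simps)
  next
    case False
    then show ?thesis using t assms(1) by (simp add: tent_def)
  qed
  also have "\<dots> = u + \<theta> * (v - u)"
  proof -
    define k where "k = (b - q) / (b - p)"
    show ?thesis unfolding assms(6,7) t_def k_def[symmetric] by (simp add: algebra_simps)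
  qed
  finally show "tent a p q b (x + \<theta> * (y - x)) = u + \<theta> * (v - u)" by (simp add: t_def)
qed

lemma tent_outside: "a < p \<Longrightarrow> p < b \<Longrightarrow> t \<le> a \<or> b \<le> t \<Longrightarrow> tent a p q b t = t"
  by (auto simp: tent_def)

lemma seg_tent_id:
  assumes "a < p" "p < b" "x \<le> y" "y \<le> a \<or> b \<le> x" "u = x" "v = y"
  shows "seg (tent a p q b) x y u v"
  unfolding seg_def assms(5,6)
proof
  fix \<theta> :: real assume \<theta>: "\<theta> \<in> {0..1}"
  have "0 \<le> \<theta> * (y - x)" "\<theta> * (y - x) \<le> y - x"
    using \<theta> assms(3) mult_left_le_one_le[of "y - x" \<theta>] by auto
  then show "tent a p q b (x + \<theta> * (y - x)) = x + \<theta> * (y - x)"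
    using assms(4) by (intro tent_outside[OF assms(1,2)]) auto
qed

lemma tent_scale:
  assumes "r > 0"
  shows "tent (s + r * a) (s + r * p) (s + r * q) (s + r * b) (s + r * t) = s + r * tent a p q b t"
  using assms by (auto simp: tent_def field_simps)

text \<open>Mark off consecutive pieces of lengths \<open>\<sigma>\<close>, \<open>L - \<sigma>\<close>, \<open>\<sigma>\<close>, \<open>\<sigma>\<close>, \<dots> from \<open>c\<close> on. Both sides of the
  following identities carry the pieces affinely to the same image intervals; the maps
  \<open>tent (c + j\<sigma>) \<dots>\<close> interchange the lengths of two neighbouring pieces.\<close>

lemma double_tent:
  assumes "0 < \<sigma>" "\<sigma> < L" "0 < \<sigma>'" "\<sigma>' < L"
  shows "tent c (c + 2 * \<sigma>) (c + 2 * \<sigma>') (c + 2 * L)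
      \<circ> tent (c + \<sigma>) (c + L) (c + 2 * \<sigma>) (c + L + \<sigma>)
    = tent (c + \<sigma>') (c + L) (c + 2 * \<sigma>') (c + L + \<sigma>')
      \<circ> (tent c (c + \<sigma>) (c + \<sigma>') (c + L)
      \<circ> tent (c + L) (c + L + \<sigma>) (c + L + \<sigma>') (c + 2 * L))"
    (is "?h2 \<circ> ?z = ?z' \<circ> (?h \<circ> ?k)")
proof
  fix t
  consider "t \<le> c"
    | "c \<le> t" "t \<le> c + \<sigma>"
    | "c + \<sigma> \<le> t" "t \<le> c + L"
    | "c + L \<le> t" "t \<le> c + L + \<sigma>"
    | "c + L + \<sigma> \<le> t" "t \<le> c + 2 * L"
    | "c + 2 * L \<le> t" using assms by linarith
  then show "(?h2 \<circ> ?z) t = (?z' \<circ> (?h \<circ> ?k)) t"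
  proof cases
    case 1
    then show ?thesis using assms by (simp add: tent_outside)
  next
    case 2
    have L2: "seg ?h2 c (c + \<sigma>) c (c + \<sigma>')"
      and R2: "seg ?h c (c + \<sigma>) c (c + \<sigma>')"
      using assms by (auto intro!: seg_tent_left simp: field_simps)
    have L1: "seg ?z c (c + \<sigma>) c (c + \<sigma>)"
      and R1: "seg ?k c (c + \<sigma>) c (c + \<sigma>)"
      and R3: "seg ?z' c (c + \<sigma>') c (c + \<sigma>')"
      using assms by (auto intro!: seg_tent_id simp: field_simps)
    show ?thesis
      using assms by (intro seg_eq[OF seg_comp[OF L1 L2]
        seg_comp[OF seg_comp[OF R1 R2] R3] _ 2]) auto
  next
    case 3
    have L1: "seg ?z (c + \<sigma>) (c + L) (c + \<sigma>) (c + 2 * \<sigma>)"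
      and L2: "seg ?h2 (c + \<sigma>) (c + 2 * \<sigma>) (c + \<sigma>') (c + 2 * \<sigma>')"
      and R3: "seg ?z' (c + \<sigma>') (c + L) (c + \<sigma>') (c + 2 * \<sigma>')"
      using assms by (auto intro!: seg_tent_left simp: field_simps)
    have R2: "seg ?h (c + \<sigma>) (c + L) (c + \<sigma>') (c + L)"
      using assms by (auto intro!: seg_tent_right simp: field_simps)
    have R1: "seg ?k (c + \<sigma>) (c + L) (c + \<sigma>) (c + L)"
      using assms by (auto intro!: seg_tent_id simp: field_simps)
    show ?thesis
      using assms by (intro seg_eq[OF seg_comp[OF L1 L2]
        seg_comp[OF seg_comp[OF R1 R2] R3] _ 3]) auto
  next
    case 4
    have R1: "seg ?k (c + L) (c + L + \<sigma>) (c + L) (c + L + \<sigma>')"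
      using assms by (auto intro!: seg_tent_left simp: field_simps)
    have L1: "seg ?z (c + L) (c + L + \<sigma>) (c + 2 * \<sigma>) (c + L + \<sigma>)"
      and L2: "seg ?h2 (c + 2 * \<sigma>) (c + L + \<sigma>) (c + 2 * \<sigma>') (c + L + \<sigma>')"
      and R3: "seg ?z' (c + L) (c + L + \<sigma>') (c + 2 * \<sigma>') (c + L + \<sigma>')"
      using assms by (auto intro!: seg_tent_right simp: field_simps)
    have R2: "seg ?h (c + L) (c + L + \<sigma>') (c + L) (c + L + \<sigma>')"
      using assms by (auto intro!: seg_tent_id simp: field_simps)
    show ?thesis
      using assms by (intro seg_eq[OF seg_comp[OF L1 L2]
        seg_comp[OF seg_comp[OF R1 R2] R3] _ 4]) auto
  next
    case 5
    have L2: "seg ?h2 (c + L + \<sigma>) (c + 2 * L) (c + L + \<sigma>') (c + 2 * L)"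
      and R1: "seg ?k (c + L + \<sigma>) (c + 2 * L) (c + L + \<sigma>') (c + 2 * L)"
      using assms by (auto intro!: seg_tent_right simp: field_simps)
    have L1: "seg ?z (c + L + \<sigma>) (c + 2 * L) (c + L + \<sigma>) (c + 2 * L)"
      and R2: "seg ?h (c + L + \<sigma>') (c + 2 * L) (c + L + \<sigma>') (c + 2 * L)"
      and R3: "seg ?z' (c + L + \<sigma>') (c + 2 * L) (c + L + \<sigma>') (c + 2 * L)"
      using assms by (auto intro!: seg_tent_id simp: field_simps)
    show ?thesis
      using assms by (intro seg_eq[OF seg_comp[OF L1 L2]
        seg_comp[OF seg_comp[OF R1 R2] R3] _ 5]) auto
  next
    case 6
    then show ?thesis using assms by (simp add: tent_outside)
  qed
qed

text \<open>The second block is twice as long as the first, so the right side again has just two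
  tents of the shape on the left, while two interchanges on either side are needed to bring the
  three pieces together. The resulting relation is thus independent of the one from
  \<open>double_tent\<close>.\<close>

lemma triple_tent:
  assumes "0 < \<sigma>" "\<sigma> < L" "0 < \<sigma>'" "\<sigma>' < L"
  shows "tent c (c + 3 * \<sigma>) (c + 3 * \<sigma>') (c + 3 * L)
      \<circ> (tent (c + 2 * \<sigma>) (c + L + \<sigma>) (c + 3 * \<sigma>) (c + L + 2 * \<sigma>)
      \<circ> tent (c + \<sigma>) (c + L) (c + 2 * \<sigma>) (c + L + \<sigma>))
    = tent (c + 2 * \<sigma>') (c + L + \<sigma>') (c + 3 * \<sigma>') (c + L + 2 * \<sigma>')
      \<circ> (tent (c + \<sigma>') (c + L) (c + 2 * \<sigma>') (c + L + \<sigma>')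
      \<circ> (tent c (c + \<sigma>) (c + \<sigma>') (c + L)
      \<circ> tent (c + L) (c + L + 2 * \<sigma>) (c + L + 2 * \<sigma>') (c + 3 * L)))"
    (is "?h3 \<circ> (?y \<circ> ?z) = ?y' \<circ> (?z' \<circ> (?h \<circ> ?k2))")
proof
  fix t
  consider "t \<le> c"
    | "c \<le> t" "t \<le> c + \<sigma>"
    | "c + \<sigma> \<le> t" "t \<le> c + L"
    | "c + L \<le> t" "t \<le> c + L + \<sigma>"
    | "c + L + \<sigma> \<le> t" "t \<le> c + L + 2 * \<sigma>"
    | "c + L + 2 * \<sigma> \<le> t" "t \<le> c + 3 * L"
    | "c + 3 * L \<le> t" using assms by linarith
  then show "(?h3 \<circ> (?y \<circ> ?z)) t = (?y' \<circ> (?z' \<circ> (?h \<circ> ?k2))) t"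
  proof cases
    case 1
    then show ?thesis using assms by (simp add: tent_outside)
  next
    case 2
    have L3: "seg ?h3 c (c + \<sigma>) c (c + \<sigma>')"
      and R2: "seg ?h c (c + \<sigma>) c (c + \<sigma>')"
      using assms by (auto intro!: seg_tent_left simp: field_simps)
    have L1: "seg ?z c (c + \<sigma>) c (c + \<sigma>)"
      and L2: "seg ?y c (c + \<sigma>) c (c + \<sigma>)"
      and R1: "seg ?k2 c (c + \<sigma>) c (c + \<sigma>)"
      and R3: "seg ?z' c (c + \<sigma>') c (c + \<sigma>')"
      and R4: "seg ?y' c (c + \<sigma>') c (c + \<sigma>')"
      using assms by (auto intro!: seg_tent_id simp: field_simps)
    show ?thesis
      using assms by (intro seg_eq[OF seg_comp[OF seg_comp[OF L1 L2] L3]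
        seg_comp[OF seg_comp[OF seg_comp[OF R1 R2] R3] R4] _ 2]) auto
  next
    case 3
    have L1: "seg ?z (c + \<sigma>) (c + L) (c + \<sigma>) (c + 2 * \<sigma>)"
      and L3: "seg ?h3 (c + \<sigma>) (c + 2 * \<sigma>) (c + \<sigma>') (c + 2 * \<sigma>')"
      and R3: "seg ?z' (c + \<sigma>') (c + L) (c + \<sigma>') (c + 2 * \<sigma>')"
      using assms by (auto intro!: seg_tent_left simp: field_simps)
    have R2: "seg ?h (c + \<sigma>) (c + L) (c + \<sigma>') (c + L)"
      using assms by (auto intro!: seg_tent_right simp: field_simps)
    have L2: "seg ?y (c + \<sigma>) (c + 2 * \<sigma>) (c + \<sigma>) (c + 2 * \<sigma>)"
      and R1: "seg ?k2 (c + \<sigma>) (c + L) (c + \<sigma>) (c + L)"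
      and R4: "seg ?y' (c + \<sigma>') (c + 2 * \<sigma>') (c + \<sigma>') (c + 2 * \<sigma>')"
      using assms by (auto intro!: seg_tent_id simp: field_simps)
    show ?thesis
      using assms by (intro seg_eq[OF seg_comp[OF seg_comp[OF L1 L2] L3]
        seg_comp[OF seg_comp[OF seg_comp[OF R1 R2] R3] R4] _ 3]) auto
  next
    case 4
    have L2: "seg ?y (c + 2 * \<sigma>) (c + L + \<sigma>) (c + 2 * \<sigma>) (c + 3 * \<sigma>)"
      and L3: "seg ?h3 (c + 2 * \<sigma>) (c + 3 * \<sigma>) (c + 2 * \<sigma>') (c + 3 * \<sigma>')"
      and R1: "seg ?k2 (c + L) (c + L + \<sigma>) (c + L) (c + L + \<sigma>')"
      and R4: "seg ?y' (c + 2 * \<sigma>') (c + L + \<sigma>') (c + 2 * \<sigma>') (c + 3 * \<sigma>')"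
      using assms by (auto intro!: seg_tent_left simp: field_simps)
    have L1: "seg ?z (c + L) (c + L + \<sigma>) (c + 2 * \<sigma>) (c + L + \<sigma>)"
      and R3: "seg ?z' (c + L) (c + L + \<sigma>') (c + 2 * \<sigma>') (c + L + \<sigma>')"
      using assms by (auto intro!: seg_tent_right simp: field_simps)
    have R2: "seg ?h (c + L) (c + L + \<sigma>') (c + L) (c + L + \<sigma>')"
      using assms by (auto intro!: seg_tent_id simp: field_simps)
    show ?thesis
      using assms by (intro seg_eq[OF seg_comp[OF seg_comp[OF L1 L2] L3]
        seg_comp[OF seg_comp[OF seg_comp[OF R1 R2] R3] R4] _ 4]) auto
  next
    case 5
    have R1: "seg ?k2 (c + L + \<sigma>) (c + L + 2 * \<sigma>) (c + L + \<sigma>') (c + L + 2 * \<sigma>')"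
      using assms by (auto intro!: seg_tent_left simp: field_simps)
    have L2: "seg ?y (c + L + \<sigma>) (c + L + 2 * \<sigma>) (c + 3 * \<sigma>) (c + L + 2 * \<sigma>)"
      and L3: "seg ?h3 (c + 3 * \<sigma>) (c + L + 2 * \<sigma>) (c + 3 * \<sigma>') (c + L + 2 * \<sigma>')"
      and R4: "seg ?y' (c + L + \<sigma>') (c + L + 2 * \<sigma>') (c + 3 * \<sigma>') (c + L + 2 * \<sigma>')"
      using assms by (auto intro!: seg_tent_right simp: field_simps)
    have L1: "seg ?z (c + L + \<sigma>) (c + L + 2 * \<sigma>) (c + L + \<sigma>) (c + L + 2 * \<sigma>)"
      and R2: "seg ?h (c + L + \<sigma>') (c + L + 2 * \<sigma>') (c + L + \<sigma>') (c + L + 2 * \<sigma>')"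
      and R3: "seg ?z' (c + L + \<sigma>') (c + L + 2 * \<sigma>') (c + L + \<sigma>') (c + L + 2 * \<sigma>')"
      using assms by (auto intro!: seg_tent_id simp: field_simps)
    show ?thesis
      using assms by (intro seg_eq[OF seg_comp[OF seg_comp[OF L1 L2] L3]
        seg_comp[OF seg_comp[OF seg_comp[OF R1 R2] R3] R4] _ 5]) auto
  next
    case 6
    have L3: "seg ?h3 (c + L + 2 * \<sigma>) (c + 3 * L) (c + L + 2 * \<sigma>') (c + 3 * L)"
      and R1: "seg ?k2 (c + L + 2 * \<sigma>) (c + 3 * L) (c + L + 2 * \<sigma>') (c + 3 * L)"
      using assms by (auto intro!: seg_tent_right simp: field_simps)
    have L1: "seg ?z (c + L + 2 * \<sigma>) (c + 3 * L) (c + L + 2 * \<sigma>) (c + 3 * L)"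
      and L2: "seg ?y (c + L + 2 * \<sigma>) (c + 3 * L) (c + L + 2 * \<sigma>) (c + 3 * L)"
      and R2: "seg ?h (c + L + 2 * \<sigma>') (c + 3 * L) (c + L + 2 * \<sigma>') (c + 3 * L)"
      and R3: "seg ?z' (c + L + 2 * \<sigma>') (c + 3 * L) (c + L + 2 * \<sigma>') (c + 3 * L)"
      and R4: "seg ?y' (c + L + 2 * \<sigma>') (c + 3 * L) (c + L + 2 * \<sigma>') (c + 3 * L)"
      using assms by (auto intro!: seg_tent_id simp: field_simps)
    show ?thesis
      using assms by (intro seg_eq[OF seg_comp[OF seg_comp[OF L1 L2] L3]
        seg_comp[OF seg_comp[OF seg_comp[OF R1 R2] R3] R4] _ 6]) auto
  next
    case 7
    then show ?thesis using assms by (simp add: tent_outside)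
  qed
qed

text \<open>The pieces on either side of \<open>[a, b]\<close> absorb its displacement, so that
  nothing outside \<open>e\<^sub>0\<close> and \<open>e\<^sub>1\<close> is moved.\<close>

lemma affine_transport:
  assumes "e\<^sub>0 < a" "a < b" "b < e\<^sub>1" "e\<^sub>0 < a'" "a' < b'" "b' < e\<^sub>1"
    and F: "e\<^sub>0 \<in> F" "a \<in> F" "b \<in> F" "e\<^sub>1 \<in> F" "a' \<in> F" "b' \<in> F"
  obtains k where "pl k" "supp k \<subseteq> {e\<^sub>0..e\<^sub>1}"
    "\<And>t. a \<le> t \<Longrightarrow> t \<le> b \<Longrightarrow> k t = a' + (b' - a') / (b - a) * (t - a)"
proof -
  define k4 where "k4 t = (if t \<le> e\<^sub>1 then e\<^sub>1 + (e\<^sub>1 - b') / (e\<^sub>1 - b) * (t - e\<^sub>1) else id t)" for t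
  define k3 where "k3 t = (if t \<le> b then a' + (b' - a') / (b - a) * (t - a) else k4 t)" for t
  define k2 where "k2 t = (if t \<le> a then e\<^sub>0 + (a' - e\<^sub>0) / (a - e\<^sub>0) * (t - e\<^sub>0) else k3 t)" for t
  define k where "k t = (if t \<le> e\<^sub>0 then id t else k2 t)" for t
  have 4: "pl k4"
    unfolding k4_def using assms by (intro pl_glue pl_line pl_id mem_intros) auto
  have 3: "pl k3"
    unfolding k3_def using assms by (intro pl_glue pl_line 4 mem_intros) (auto simp: k4_def field_simps)
  have 2: "pl k2"
    unfolding k2_def using assms by (intro pl_glue pl_line 3 mem_intros) (auto simp: k3_def)
  have "pl k"
    unfolding k_def using assms by (intro pl_glue pl_id 2 mem_intros) (auto simp: k2_def)
  moreover have "supp k \<subseteq> {e\<^sub>0..e\<^sub>1}"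
    using assms by (auto simp: supp_def k_def k2_def k3_def k4_def split: if_splits)
  moreover have "k t = a' + (b' - a') / (b - a) * (t - a)" if "a \<le> t" "t \<le> b" for t
    using that assms by (cases "t = a") (simp_all add: k_def k2_def k3_def)
  ultimately show thesis using that by blast
qed

lemma tent_transport:
  assumes k: "pl k" "\<And>t. a \<le> t \<Longrightarrow> t \<le> b \<Longrightarrow> k t = s + r * t" and r: "r > 0"
    and t: "a < p" "p < b" "a < q" "q < b" "a \<in> F" "p \<in> F" "q \<in> F" "b \<in> F"
  shows "k \<circ> tent a p q b = tent (s + r * a) (s + r * p) (s + r * q) (s + r * b) \<circ> k"
proof
  fix t
  have lt: "s + r * a < s + r * p" "s + r * p < s + r * b" using r t by auto
  have ends: "tent a p q b a = a" "tent a p q b b = b"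
    using t by (auto simp: tent_outside)
  note mono = pl_le_iff[OF pl_tent[OF t]]
  have kab: "k a = s + r * a" "k b = s + r * b" using k(2) t by auto
  consider "t \<le> a" | "b \<le> t" | "a \<le> t" "t \<le> b" by linarith
  then show "(k \<circ> tent a p q b) t = (tent (s + r * a) (s + r * p) (s + r * q) (s + r * b) \<circ> k) t"
  proof cases
    case 3
    then have "a \<le> tent a p q b t" "tent a p q b t \<le> b"
      using mono[of a t] mono[of t b] ends by auto
    then show ?thesis using 3 k(2) tent_scale[OF r] by simp
  next
    case 1
    then have "k t \<le> s + r * a" using pl_le_iff[OF k(1), of t a] kab by simp
    then show ?thesis using 1 tent_outside[OF lt] tent_outside[OF t(1,2)] by simp
  next
    case 2
    then have "s + r * b \<le> k t" using pl_le_iff[OF k(1), of b t] kab by simp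
    then show ?thesis using 2 tent_outside[OF lt] tent_outside[OF t(1,2)] by simp
  qed
qed

end

text \<open>The quotient to which this is applied need not be commutative as a whole. The first
  relation gives \<open>e = d \<otimes> a\<close>, hence
  \<open>e \<otimes> e = d \<otimes> (d \<otimes> (a \<otimes> a))\<close>, and the second one
  becomes \<open>a \<otimes> (e \<otimes> e) = e \<otimes> e\<close>.\<close>

lemma (in group) one_if_doubling_relations:
  assumes "a \<in> carrier G" "d \<in> carrier G" "e \<in> carrier G" and comm: "d \<otimes> a = a \<otimes> d"
    and double: "a \<otimes> e = d \<otimes> (a \<otimes> a)" and triple: "a \<otimes> (e \<otimes> e) = d \<otimes> (d \<otimes> (a \<otimes> a))"
  shows "a = \<one>"
proof -
  have "a \<otimes> e = a \<otimes> (d \<otimes> a)"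
    using double comm assms(1,2) by (metis m_assoc)
  then have "e = d \<otimes> a" using assms(1-3) l_cancel by blast
  then have "e \<otimes> e = d \<otimes> ((a \<otimes> d) \<otimes> a)" using assms(1,2) by (simp add: m_assoc)
  also have "\<dots> = d \<otimes> ((d \<otimes> a) \<otimes> a)" by (simp only: comm)
  also have "\<dots> = d \<otimes> (d \<otimes> (a \<otimes> a))" using assms(1,2) by (simp add: m_assoc)
  finally have "e \<otimes> e = d \<otimes> (d \<otimes> (a \<otimes> a))" .
  then have "a \<otimes> (e \<otimes> e) = e \<otimes> e" using triple by simp
  then show ?thesis using assms(1,3) by (metis l_cancel_one m_closed r_cancel_one)
qed

section \<open>Maps with compact support in the interior of one interval\<close>

context pl_intervals begin

definition compact_part :: "'i \<Rightarrow> (real \<Rightarrow> real) set" where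
  "compact_part i = {f. pl f \<and> (\<exists>c d. c \<le> d \<and> {c..d} \<subseteq> interior (S i) \<and> supp f \<subseteq> {c..d})}"

lemma compact_partI: "pl f \<Longrightarrow> supp f \<subseteq> {c..d} \<Longrightarrow> c \<le> d \<Longrightarrow> {c..d} \<subseteq> interior (S i) \<Longrightarrow> f \<in> compact_part i"
  by (auto simp: compact_part_def)

lemma compact_part_subset: "i \<in> I \<Longrightarrow> compact_part i \<subseteq> carrier grp"
  using interior_subset by (fastforce simp: compact_part_def carrier_grp region_def)

lemma interior_between:
  assumes "i \<in> I" "x \<in> interior (S i)" "y \<in> interior (S i)"
  shows "{x..y} \<subseteq> interior (S i)"
proof -
  have "convex (interior (S i))"
    using interval[OF assms(1)] by (simp add: is_interval_convex_1 convex_interior)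
  then have "is_interval (interior (S i))" by (simp add: is_interval_convex_1)
  then show ?thesis using assms(2,3) unfolding is_interval_1
    by (meson atLeastAtMost_iff subsetI)
qed

lemma interior_beyond:
  assumes "i \<in> I" "x \<in> interior (S i)"
  obtains u v where "u \<in> F" "v \<in> F" "u < x" "x < v" "u \<in> interior (S i)" "v \<in> interior (S i)"
proof -
  obtain e where e: "e > 0" "ball x e \<subseteq> interior (S i)"
    using assms(2) open_interior open_contains_ball by blast
  obtain u v where "u \<in> F" "v \<in> F" "x - e < u" "u < x" "x < v" "v < x + e"
    using dense[of "x - e" x] dense[of x "x + e"] e(1) by auto
  moreover have "u \<in> ball x e" "v \<in> ball x e"
    using calculation by (auto simp: dist_real_def)
  ultimately show thesis using that e(2) by blast
qed

lemma tent_compact_part: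
  assumes "a < p" "p < b" "a < q" "q < b" "a \<in> F" "p \<in> F" "q \<in> F" "b \<in> F"
    and "i \<in> I" "a \<in> interior (S i)" "b \<in> interior (S i)"
  shows "tent a p q b \<in> compact_part i"
  using assms by (intro compact_partI[of _ a b] pl_tent supp_tent interior_between) auto

lemma local_transport:
  assumes i: "i \<in> I" and ab: "a < b" "a' < b'" "a \<in> F" "b \<in> F" "a' \<in> F" "b' \<in> F"
    and int: "a \<in> interior (S i)" "b \<in> interior (S i)" "a' \<in> interior (S i)" "b' \<in> interior (S i)"
  obtains k where "k \<in> compact_part i"
    "\<And>t. a \<le> t \<Longrightarrow> t \<le> b \<Longrightarrow> k t = a' + (b' - a') / (b - a) * (t - a)"
proof -
  have "min a a' \<in> interior (S i)" "max b b' \<in> interior (S i)"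
    using int by (auto simp: min_def max_def)
  then obtain u v where uv: "u \<in> F" "v \<in> F" "u < min a a'" "max b b' < v" "u \<in> interior (S i)" "v \<in> interior (S i)"
    using interior_beyond[OF i] by metis
  then obtain k where "pl k" "supp k \<subseteq> {u..v}"
    "\<And>t. a \<le> t \<Longrightarrow> t \<le> b \<Longrightarrow> k t = a' + (b' - a') / (b - a) * (t - a)"
    using affine_transport[of u a b v a' b'] ab by auto
  then show thesis
    using that compact_partI[of k u v i] interior_between[OF i uv(5,6)] uv(3,4) ab by auto
qed

end

locale normal_pl = pl_intervals +
  fixes N :: "(real \<Rightarrow> real) set"
  assumes N: "N \<lhd> grp"
begin

sublocale N: normal N grp by (rule N)

lemma N_carrier: "f \<in> N \<Longrightarrow> f \<in> carrier grp"
  using N.subset by blast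

lemma N_comp: "f \<in> N \<Longrightarrow> g \<in> N \<Longrightarrow> f \<circ> g \<in> N"
  using N.m_closed mult_grp by metis

lemma N_finv: "f \<in> N \<Longrightarrow> finv f \<in> N"
  using N.m_inv_closed inv_grp N_carrier by metis

lemma N_id: "id \<in> N"
  using N.one_closed one_grp by metis

lemma N_conj: "g \<in> carrier grp \<Longrightarrow> f \<in> N \<Longrightarrow> g \<circ> f \<circ> finv g \<in> N"
  using N.inv_op_closed2 by (simp add: mult_grp inv_grp)

end

text \<open>Under this hypothesis conjugation by a compactly supported map does not change the class
  modulo \<open>N\<close> of another one.\<close>

locale locally_commutative = normal_pl +
  fixes i :: 'a
  assumes i: "i \<in> I"
    and commutator: "f \<in> compact_part i \<Longrightarrow> g \<in> compact_part i \<Longrightarrow> f \<circ> g \<circ> finv f \<circ> finv g \<in> N"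
begin

abbreviation Q where "Q \<equiv> grp Mod N"

sublocale Q: group Q by (rule N.factorgroup_is_group)

definition cls :: "(real \<Rightarrow> real) \<Rightarrow> (real \<Rightarrow> real) set" where
  "cls f = N #>\<^bsub>grp\<^esub> f"

lemma cls_comp: "f \<in> carrier grp \<Longrightarrow> g \<in> carrier grp \<Longrightarrow> cls (f \<circ> g) = cls f \<otimes>\<^bsub>Q\<^esub> cls g"
  using hom_mult[OF N.r_coset_hom_Mod] unfolding cls_def mult_grp by blast

lemma cls_carrier: "f \<in> carrier grp \<Longrightarrow> cls f \<in> carrier Q"
  unfolding cls_def using hom_in_carrier[OF N.r_coset_hom_Mod] by blast

lemma cls_one_iff: "f \<in> carrier grp \<Longrightarrow> cls f = \<one>\<^bsub>Q\<^esub> \<longleftrightarrow> f \<in> N"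
  unfolding cls_def one_FactGroup using G.coset_join1 G.coset_join2 N.subgroup_axioms by metis

lemma cp_carrier: "f \<in> compact_part i \<Longrightarrow> f \<in> carrier grp"
  using compact_part_subset[OF i] by blast

lemma cls_commute:
  assumes "f \<in> compact_part i" "g \<in> compact_part i"
  shows "cls f \<otimes>\<^bsub>Q\<^esub> cls g = cls g \<otimes>\<^bsub>Q\<^esub> cls f"
proof -
  note c = assms[THEN cp_carrier]
  have pf: "pl f" "pl g" using c by (auto simp: carrier_grp)
  have "f \<circ> g = (f \<circ> g \<circ> finv f \<circ> finv g) \<circ> (g \<circ> f)"
    using pl_inv_f pf by (auto simp: fun_eq_iff)
  moreover have "cls (f \<circ> g \<circ> finv f \<circ> finv g) = \<one>\<^bsub>Q\<^esub>"
    using cls_one_iff N_carrier commutator assms by blast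
  ultimately have "cls (f \<circ> g) = \<one>\<^bsub>Q\<^esub> \<otimes>\<^bsub>Q\<^esub> cls (g \<circ> f)"
    using cls_comp N_carrier[OF commutator[OF assms]] c G.m_closed mult_grp by metis
  moreover have "cls (g \<circ> f) \<in> carrier Q"
    using cls_carrier c G.m_closed mult_grp by metis
  ultimately show ?thesis using cls_comp c Q.l_one by simp
qed

text \<open>The similarity \<open>t \<mapsto> s + r * t\<close> is realised on \<open>[a, b]\<close>
  by a compactly supported map \<open>k\<close>, which conjugates one tent into the other; the
  classes of \<open>k\<close> and of the tents commute.\<close>

lemma cls_tent_scale:
  assumes t: "a < p" "p < b" "a < q" "q < b" "a \<in> F" "p \<in> F" "q \<in> F" "b \<in> F"
    and int: "a \<in> interior (S i)" "b \<in> interior (S i)" "s + r * a \<in> interior (S i)" "s + r * b \<in> interior (S i)"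
    and rs: "r > 0" "r \<in> F" "s \<in> F"
  shows "cls (tent (s + r * a) (s + r * p) (s + r * q) (s + r * b)) = cls (tent a p q b)"
proof -
  let ?t = "tent a p q b" and ?t' = "tent (s + r * a) (s + r * p) (s + r * q) (s + r * b)"
  have ab: "a < b" and sab: "s + r * a < s + r * b" using rs t by auto
  have sF: "s + r * a \<in> F" "s + r * b \<in> F" using t rs by (auto intro!: mem_intros)
  obtain k where k: "k \<in> compact_part i"
    "\<And>t. a \<le> t \<Longrightarrow> t \<le> b \<Longrightarrow> k t = (s + r * a) + ((s + r * b) - (s + r * a)) / (b - a) * (t - a)"
    using local_transport[OF i ab sab t(5,8) sF int] by blast
  have e: "((s + r * b) - (s + r * a)) / (b - a) = r" using t by (simp add: field_simps)
  have k': "k t = s + r * t" if "a \<le> t" "t \<le> b" for t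
    using k(2)[OF that] unfolding e by (simp add: algebra_simps)
  have tc: "?t \<in> compact_part i" "?t' \<in> compact_part i"
    by (rule tent_compact_part; use t int rs i in \<open>auto intro!: mem_intros\<close>)+
  note c = cp_carrier[OF k(1)] cp_carrier[OF tc(1)] cp_carrier[OF tc(2)]
  have "pl k" using c(1) by (simp add: carrier_grp)
  then have "k \<circ> ?t = ?t' \<circ> k" using tent_transport[OF _ k' rs(1) t] by blast
  then have "cls k \<otimes>\<^bsub>Q\<^esub> cls ?t = cls ?t' \<otimes>\<^bsub>Q\<^esub> cls k" using cls_comp c by metis
  also have "\<dots> = cls k \<otimes>\<^bsub>Q\<^esub> cls ?t'" using cls_commute[OF tc(2) k(1)] .
  finally show ?thesis using Q.l_cancel cls_carrier c by metis
qed

lemma tent_in_N: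
  assumes t: "a < p" "p < b" "a < q" "q < b" "a \<in> F" "p \<in> F" "q \<in> F" "b \<in> F"
    and int: "a \<in> interior (S i)" "b \<in> interior (S i)"
  shows "tent a p q b \<in> N"
proof -
  \<comment> \<open>Thirds are taken so that the given tent becomes the one of triple size;
    \<open>?h\<close> is its copy on the scale of one third.\<close>
  define L \<sigma> \<sigma>' where "L = (b - a) / 3" and "\<sigma> = (p - a) / 3" and "\<sigma>' = (q - a) / 3"
  have L: "0 < \<sigma>" "\<sigma> < L" "0 < \<sigma>'" "\<sigma>' < L" and LF: "L \<in> F" "\<sigma> \<in> F" "\<sigma>' \<in> F"
    using t by (auto simp: L_def \<sigma>_def \<sigma>'_def intro!: mem_intros)
  have e: "p = a + 3 * \<sigma>" "q = a + 3 * \<sigma>'" "b = a + 3 * L"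
    by (auto simp: L_def \<sigma>_def \<sigma>'_def)
  have I: "x \<in> interior (S i)" if "a \<le> x" "x \<le> a + 3 * L" for x
    using interior_between[OF i int] that e(3) by auto
  let ?h = "tent a (a + \<sigma>) (a + \<sigma>') (a + L)"
  let ?h2 = "tent a (a + 2 * \<sigma>) (a + 2 * \<sigma>') (a + 2 * L)"
  let ?h3 = "tent a (a + 3 * \<sigma>) (a + 3 * \<sigma>') (a + 3 * L)"
  let ?k = "tent (a + L) (a + L + \<sigma>) (a + L + \<sigma>') (a + 2 * L)"
  let ?k2 = "tent (a + L) (a + L + 2 * \<sigma>) (a + L + 2 * \<sigma>') (a + 3 * L)"
  \<comment> \<open>The interchanges of neighbouring pieces. \<open>?y\<close> is \<open>?z\<close>
    translated by its own argument, so the two have the same class.\<close>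
  let ?z = "\<lambda>\<sigma>. tent (a + \<sigma>) (a + L) (a + 2 * \<sigma>) (a + L + \<sigma>)"
  let ?y = "\<lambda>\<sigma>. tent (a + 2 * \<sigma>) (a + L + \<sigma>) (a + 3 * \<sigma>) (a + L + 2 * \<sigma>)"
  have scale: "cls (tent (a + x) (a + x + r * \<sigma>) (a + x + r * \<sigma>') (a + x + r * L)) = cls ?h"
    if "x \<ge> 0" "r > 0" "x + r * L \<le> 3 * L" "x \<in> F" "r \<in> F" for x r
  proof -
    have "a + x - r * a \<in> F" using that t by (intro mem_intros)
    moreover have "a + x \<in> interior (S i)" "a + x + r * L \<in> interior (S i)"
      using that L by (auto intro!: I) (smt (verit) mult_pos_pos)
    ultimately show ?thesis
      using cls_tent_scale[of a "a + \<sigma>" "a + L" "a + \<sigma>'" "a + x - r * a" r] that L LF t I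
      by (simp add: algebra_simps add_mem)
  qed
  have h2: "cls ?h2 = cls ?h" using scale[of 0 2] L by (simp add: zero_mem numeral_mem)
  have h3: "cls ?h3 = cls ?h" using scale[of 0 3] L by (simp add: zero_mem numeral_mem)
  have k: "cls ?k = cls ?h" using scale[of L 1] L LF by (simp add: one_mem ac_simps)
  have k2: "cls ?k2 = cls ?h" using scale[of L 2] L LF by (simp add: numeral_mem add.assoc)
  have yz: "cls (?y \<tau>) = cls (?z \<tau>)" if "0 < \<tau>" "\<tau> < L" "\<tau> \<in> F" for \<tau>
    using cls_tent_scale[of "a + \<tau>" "a + L" "a + L + \<tau>" "a + 2 * \<tau>" \<tau> 1] that LF t I
    by (simp add: algebra_simps add_mem one_mem mult_mem numeral_mem)
  have cz: "?z \<tau> \<in> compact_part i" "?y \<tau> \<in> compact_part i" if "0 < \<tau>" "\<tau> < L" "\<tau> \<in> F" for \<tau>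
    by (rule tent_compact_part; use that LF t I i in \<open>auto intro!: mem_intros\<close>)+
  have ch: "?h \<in> compact_part i" "?h2 \<in> compact_part i" "?h3 \<in> compact_part i"
    "?k \<in> compact_part i" "?k2 \<in> compact_part i"
    by (rule tent_compact_part; use L LF t I i in \<open>auto intro!: mem_intros\<close>)+
  note c = ch[THEN cp_carrier] cz(1)[OF L(1,2) LF(2), THEN cp_carrier] cz(2)[OF L(1,2) LF(2), THEN cp_carrier]
    cz(1)[OF L(3,4) LF(3), THEN cp_carrier] cz(2)[OF L(3,4) LF(3), THEN cp_carrier]
  have cl: "f \<circ> g \<in> carrier grp" if "f \<in> carrier grp" "g \<in> carrier grp" for f g
    using that G.m_closed mult_grp by metis
  have "cls (?h2 \<circ> ?z \<sigma>) = cls (?z \<sigma>' \<circ> (?h \<circ> ?k))"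
    by (simp only: double_tent[OF L, of a])
  then have "cls ?h \<otimes>\<^bsub>Q\<^esub> cls (?z \<sigma>) = cls (?z \<sigma>') \<otimes>\<^bsub>Q\<^esub> (cls ?h \<otimes>\<^bsub>Q\<^esub> cls ?h)"
    by (simp only: cls_comp c cl h2 k)
  moreover have "cls (?h3 \<circ> (?y \<sigma> \<circ> ?z \<sigma>)) = cls (?y \<sigma>' \<circ> (?z \<sigma>' \<circ> (?h \<circ> ?k2)))"
    by (simp only: triple_tent[OF L, of a])
  then have "cls ?h \<otimes>\<^bsub>Q\<^esub> (cls (?z \<sigma>) \<otimes>\<^bsub>Q\<^esub> cls (?z \<sigma>))
      = cls (?z \<sigma>') \<otimes>\<^bsub>Q\<^esub> (cls (?z \<sigma>') \<otimes>\<^bsub>Q\<^esub> (cls ?h \<otimes>\<^bsub>Q\<^esub> cls ?h))"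
    by (simp only: cls_comp c cl h3 k2 yz[OF L(1,2) LF(2)] yz[OF L(3,4) LF(3)])
  ultimately have "cls ?h = \<one>\<^bsub>Q\<^esub>"
    by (intro Q.one_if_doubling_relations[of _ "cls (?z \<sigma>')" "cls (?z \<sigma>)"] cls_carrier c
        cls_commute cz L LF ch)
  then have "cls ?h3 = \<one>\<^bsub>Q\<^esub>" using h3 by simp
  then show ?thesis using cls_one_iff c e by metis
qed

text \<open>Induction on the number of kinks. The tent split off agrees with \<open>f\<close> up to
  the second kink, which removes the first kink without creating new ones.\<close>

lemma compact_part_subset_N: "compact_part i \<subseteq> N"
proof
  fix f assume "f \<in> compact_part i"
  then show "f \<in> N"
  proof (induction "card (kinks f)" arbitrary: f rule: less_induct)
    case less
    obtain c d where pf: "pl f" and cd: "{c..d} \<subseteq> interior (S i)" "supp f \<subseteq> {c..d}" "c \<le> d"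
      using less.prems by (auto simp: compact_part_def)
    have fixd: "f t = t" if "t < c \<or> d < t" for t
      using that cd(2) by (force simp: supp_def)
    have germ_id: "germ (nhds x) f 1 0" if "\<And>t. t \<in> U \<Longrightarrow> f t = t" "open U" "x \<in> U" for x U
      unfolding germ_def eventually_nhds using that by auto
    have id_on: "f t = t" if "connected U" "U \<inter> kinks f = {}" "x0 \<in> U" "x0 < c \<or> d < x0" "t \<in> U" for U x0 t
    proof -
      have "germ (nhds x0) f 1 0"
      proof (cases "x0 < c")
        case True
        then show ?thesis using germ_id[of "{..<c}"] fixd by auto
      next
        case False
        then show ?thesis using germ_id[of "{d<..}"] fixd that(4) by auto
      qed
      then have "germ (nhds t) f 1 0"
        by (rule germ_connected[OF that(1,3) _ _ that(5)]) (use that(2) pl_germ_ex[OF pf] in blast)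
      then show ?thesis by (auto simp: germ_def dest: eventually_nhds_x_imp_x)
    qed
    have fin: "finite (kinks f)" by (rule pl_kinks(1)[OF pf])
    show ?case
    proof (cases "f = id")
      case True
      then show ?thesis using N_id by simp
    next
      case nid: False
      have ne: "kinks f \<noteq> {}"
      proof
        assume "kinks f = {}"
        then have "f t = t" for t by (intro id_on[of UNIV "c - 1"]) auto
        with nid show False by (auto simp: fun_eq_iff)
      qed
      define p0 where "p0 = Min (kinks f)"
      define p2 where "p2 = Max (kinks f)"
      have p0: "p0 \<in> kinks f" "\<And>y. y \<in> kinks f \<Longrightarrow> p0 \<le> y" and p2: "p2 \<in> kinks f" "\<And>y. y \<in> kinks f \<Longrightarrow> y \<le> p2"
        using fin ne by (auto simp: p0_def p2_def)
      have low: "f t = t" if "t < p0" for t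
        by (rule id_on[of "{..<p0}" "min p0 c - 1"]) (use p0(2) that in force)+
      have high: "f t = t" if "p2 < t" for t
        by (rule id_on[of "{p2<..}" "max p2 d + 1"]) (use p2(2) that in force)+
      have kin: "x \<in> {c..d}" if "x \<in> kinks f" for x
      proof (rule ccontr)
        assume "x \<notin> {c..d}"
        then have "germ (nhds x) f 1 0"
          by (intro germ_id[of "- {c..d}"] fixd) (auto simp: open_Compl)
        with that show False
          unfolding kinks_def affine_germ_def using one_mem zero_mem by fastforce
      qed
      have gl: "germ (at_left p0) f 1 0" "germ (at_right p2) f 1 0"
        unfolding germ_def eventually_at_filter using low high by (auto intro!: always_eventually)
      then have fp: "f p0 = p0" "f p2 = p2"
        using pl_germ_value[OF pf, of "at_left p0"] pl_germ_value[OF pf, of "at_right p2"] by auto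
      have "p0 \<noteq> p2"
      proof
        assume "p0 = p2"
        then have "f t = t" for t using low high fp by (metis linorder_neqE_linordered_idom)
        with nid show False by (auto simp: fun_eq_iff)
      qed
      then have K1: "kinks f - {p0} \<noteq> {}" using p2 by blast
      define p1 where "p1 = Min (kinks f - {p0})"
      have p1: "p1 \<in> kinks f" "p1 \<noteq> p0" "\<And>y. y \<in> kinks f \<Longrightarrow> y \<noteq> p0 \<Longrightarrow> p1 \<le> y"
        using fin K1 Min_in[of "kinks f - {p0}"] by (auto simp: p1_def)
      have lt: "p0 < p1" "p1 \<le> p2" using p0(2)[OF p1(1)] p1 p2 by auto
      have mid: "{p0<..<p1} \<inter> kinks f = {}" using p1(3) by force
      define z where "z = (p0 + p1) / 2"
      have z: "z \<in> {p0<..<p1}" using lt by (simp add: z_def)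
      obtain m e where me: "germ (nhds z) f m e" using pl_germ_ex[OF pf] mid z by blast
      have "germ (nhds t) f m e" if "t \<in> {p0<..<p1}" for t
        by (rule germ_connected[OF connected_Ioo z me _ that]) (use mid pl_germ_ex[OF pf] in blast)
      then have aff: "f t = m * t + e" if "p0 < t" "t < p1" for t
        using that by (auto simp: germ_def dest: eventually_nhds_x_imp_x)
      have "germ (at_right p0) f m e" "germ (at_left p1) f m e"
        unfolding germ_def eventually_at_right_field eventually_at_left_field using aff lt(1) by blast+
      then have affp: "p0 = m * p0 + e" "f p1 = m * p1 + e"
        using pl_germ_value[OF pf, of "at_right p0"] pl_germ_value[OF pf, of "at_left p1"] fp by auto
      then have m: "m = (f p1 - p0) / (p1 - p0)" using lt(1) by (simp add: field_simps)
      have line: "f t = p0 + (f p1 - p0) / (p1 - p0) * (t - p0)" if t: "p0 \<le> t" "t \<le> p1" for t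
      proof -
        consider "t = p0" | "t = p1" | "p0 < t" "t < p1" using t by linarith
        then have "f t = m * t + e" by cases (metis affp(1) fp(1), metis affp(2), rule aff)
        also have "\<dots> = p0 + m * (t - p0)" using affp(1) by (simp add: algebra_simps)
        finally show ?thesis using m by simp
      qed
      have "p1 \<noteq> p2"
      proof
        assume eq: "p1 = p2"
        have "f t = t" for t
        proof -
          consider "t < p0" | "p0 \<le> t" "t \<le> p1" | "p2 < t" using eq by linarith
          then show ?thesis using low high line fp(2) eq lt by cases auto
        qed
        with nid show False by (auto simp: fun_eq_iff)
      qed
      then have lt2: "p1 < p2" using lt by simp
      have q: "p0 < f p1" "f p1 < p2"
        using pl_less_iff[OF pf, of p0 p1] pl_less_iff[OF pf, of p1 p2] lt lt2 fp by auto
      have pF: "p0 \<in> F" "p1 \<in> F" "p2 \<in> F" "f p1 \<in> F"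
        using pl_kinks(2)[OF pf] p0 p1 p2 pl_mem_iff[OF pf] by blast+
      have pi: "p0 \<in> interior (S i)" "p2 \<in> interior (S i)"
        using kin p0 p2 cd(1) by blast+
      \<comment> \<open>The tent bends at the first, the second and the last kink of
        \<open>f\<close>; returning to the identity at the last one keeps it from adding a
        kink.\<close>
      define h where "h = tent p0 p1 (f p1) p2"
      have hN: "h \<in> N" unfolding h_def by (intro tent_in_N lt lt2 q pF pi)
      have ph: "pl h" unfolding h_def by (intro pl_tent lt lt2 q pF)
      define g where "g = finv h \<circ> f"
      have pg: "pl g" unfolding g_def by (intro pl_comp pl_inv ph pf)
      have hf: "h t = f t" if "t \<le> p1" for t
      proof (cases "t \<le> p0")
        case True
        then have "f t = t" using low[of t] fp(1) by (cases "t = p0") auto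
        then show ?thesis using True lt lt2 by (simp add: h_def tent_outside)
      next
        case False
        then show ?thesis using that line[of t] by (simp add: h_def tent_def)
      qed
      have gid: "g t = t" if "t \<le> p1" for t
        using hf[OF that, symmetric] pl_inv_f[OF ph] by (simp add: g_def)
      have hp: "h p0 = p0" "h p1 = f p1" "h p2 = p2"
        using hf fp lt lt2 by (auto simp: h_def tent_outside)
      have sub: "kinks g \<subseteq> kinks f - {p0}"
      proof
        fix x assume x: "x \<in> kinks g"
        have "x \<in> kinks f"
        proof (rule ccontr)
          assume nx: "x \<notin> kinks f"
          then have "f x \<in> kinks (finv h)"
            using kinks_comp_mono[OF pf, of x "finv h"] x by (auto simp: g_def)
          \<comment> \<open>\<open>h\<close> and \<open>f\<close> agree at the three points, so the
            kinks of \<open>finv h\<close> pull back under \<open>f\<close> to kinks of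
            \<open>f\<close> itself.\<close>
          then have "f x \<in> h ` {p0, p1, p2}"
            using kinks_inv[OF ph] kinks_tent[OF lt(1) lt2 q] pF unfolding h_def by blast
          then have "f x \<in> {f p0, f p1, f p2}" using hp fp by auto
          then have "x \<in> {p0, p1, p2}" using pl_inj[OF pf] by (auto dest: injD)
          with nx p0 p1 p2 show False by blast
        qed
        moreover have "x \<noteq> p0"
        proof
          assume "x = p0"
          have "\<forall>\<^sub>F y in nhds p0. y \<in> {..<p1}" using lt(1) by (intro eventually_nhds_in_open) auto
          then have "germ (nhds p0) g 1 0" unfolding germ_def by eventually_elim (simp add: gid)
          with x \<open>x = p0\<close> show False
            unfolding kinks_def affine_germ_def using one_mem zero_mem by fastforce
        qed
        ultimately show "x \<in> kinks f - {p0}" by blast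
      qed
      have "card (kinks g) < card (kinks f)"
        using sub p0(1) fin by (intro psubset_card_mono) auto
      moreover have "g \<in> compact_part i"
      proof (rule compact_partI[OF pg _ cd(3,1)])
        have "h t = t" if "t \<notin> {c..d}" for t
          unfolding h_def using that kin[OF p0(1)] kin[OF p2(1)] lt lt2 by (intro tent_outside) auto
        then have "g t = t" if "t \<notin> {c..d}" for t
          using that fixd[of t] pl_inv_f[OF ph, of t] by (auto simp: g_def not_le)
        then show "supp g \<subseteq> {c..d}" unfolding supp_def by blast
      qed
      ultimately have "g \<in> N" by (rule less.hyps)
      moreover have "f = h \<circ> g"
        by (simp add: g_def comp_assoc[symmetric] finv_comp_self(2)[OF ph])
      ultimately show ?thesis using N_comp[OF hN] by simp
    qed
  qed
qed

end

section \<open>Slopes at the ends\<close>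

context real_subfield begin

lemma commute_disjoint_supp:
  assumes "pl f" "pl g" "supp f \<inter> supp g = {}"
  shows "f \<circ> g = g \<circ> f"
proof -
  have "f (g t) = f t \<and> g (f t) = f t" if "pl f" "supp f \<inter> supp g = {}" "f t \<noteq> t" for t f g
  proof -
    have "f (f t) \<noteq> f t" using that(3) pl_inj[OF that(1)] by (auto dest: injD)
    then show ?thesis using that(2,3) by (auto simp: supp_def)
  qed
  note * = this
  show ?thesis
  proof
    fix t
    consider "f t \<noteq> t" | "g t \<noteq> t" | "f t = t" "g t = t" by blast
    then show "(f \<circ> g) t = (g \<circ> f) t"
      using *[OF assms(1,3)] *[OF assms(2), of f] assms(3) by cases (auto simp: Int_commute)
  qed
qed

lemma supp_conj:
  assumes "pl h"
  shows "supp (h \<circ> f \<circ> finv h) = h ` supp f"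
proof -
  have "h (f (finv h t)) = t \<longleftrightarrow> f (finv h t) = finv h t" for t
    using pl_f_inv[OF assms] pl_inv_f[OF assms] by metis
  then show ?thesis
    using pl_f_inv[OF assms] pl_inv_f[OF assms] by (auto simp: supp_def image_iff) metis
qed

text \<open>Collects what \<open>commuting_slope\<close> requires of \<open>x\<close>. Along the
  orbit of \<open>q\<close> the map \<open>x\<close> acts as the affine map with fixed point
  \<open>w\<close> and slope \<open>\<beta>\<close>.\<close>

definition spiral :: "real filter \<Rightarrow> (real \<Rightarrow> real) \<Rightarrow> real \<Rightarrow> real \<Rightarrow> real \<Rightarrow> bool" where
  "spiral \<Phi> x q w \<beta> \<longleftrightarrow> pl x \<and> q \<in> kinks x \<and> (\<forall>y\<in>kinks x. y \<noteq> q \<longrightarrow> x y = y) \<and>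
     (\<forall>k. (x ^^ k) q = w + \<beta> ^ k * (q - w)) \<and> w \<noteq> q \<and> filterlim (\<lambda>k. (x ^^ k) q) \<Phi> sequentially"

lemma spiral_reflect:
  assumes "spiral \<Phi> x q w \<beta>"
  shows "spiral (filtermap uminus \<Phi>) (reflect x) (- q) (- w) \<beta>"
proof -
  have x: "pl x" "q \<in> kinks x" "\<And>y. y \<in> kinks x \<Longrightarrow> y \<noteq> q \<Longrightarrow> x y = y"
    "\<And>k. (x ^^ k) q = w + \<beta> ^ k * (q - w)" "w \<noteq> q" "filterlim (\<lambda>k. (x ^^ k) q) \<Phi> sequentially"
    using assms by (auto simp: spiral_def)
  have orb: "(reflect x ^^ k) (- q) = - (x ^^ k) q" for k
    by (induction k) (auto simp: reflect_def)
  have "filterlim (\<lambda>k. - (x ^^ k) q) (filtermap uminus \<Phi>) sequentially"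
    by (rule filterlim_compose[of uminus "filtermap uminus \<Phi>" \<Phi>, OF _ x(6)]) (simp add: filterlim_def)
  moreover have "- (x ^^ k) q = - w + \<beta> ^ k * (- q - - w)" for k
    unfolding x(4) by (simp add: algebra_simps)
  moreover have "reflect x y = y" if "y \<in> kinks (reflect x)" "y \<noteq> - q" for y
    using that x(3)[of "- y"] by (auto simp: kinks_reflect reflect_def)
  ultimately show ?thesis
    unfolding spiral_def orb using pl_reflect[OF x(1)] x(2,5) by (simp add: kinks_reflect)
qed

lemma spiral_at_right:
  assumes "a < b" "a \<in> F" "b \<in> F" "\<alpha> \<in> F" "\<alpha> > 1"
  obtains x q w where "spiral (at_right a) x q w (1 / \<alpha>)" "supp x \<subseteq> {a<..b}"
proof -
  define p where "p = (a + b) / 2"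
  \<comment> \<open>Chosen to give the left piece of the tent the slope \<open>1 / \<alpha>\<close>.
    The bend \<open>p\<close> of the tent, which takes the role of \<open>q\<close> in
    \<open>spiral\<close>, is then contracted towards \<open>a\<close>.\<close>
  define q where "q = a + (p - a) / \<alpha>"
  have p: "a < p" "p < b" "p \<in> F" using assms by (auto simp: p_def intro!: mem_intros)
  have "(p - a) * 1 < (p - a) * \<alpha>" using p assms by (intro mult_strict_left_mono) auto
  then have "(p - a) / \<alpha> > 0" "(p - a) / \<alpha> < p - a" using p assms by (auto simp: divide_less_eq)
  then have q: "a < q" "q < p" "q \<in> F" using p assms by (auto simp: q_def intro!: mem_intros)
  define x where "x = tent a p q b"
  have px: "pl x" unfolding x_def using p q assms by (intro pl_tent) auto
  have left: "x y = a + (1 / \<alpha>) * (y - a)" if "a < y" "y \<le> p" for y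
    using that p by (simp add: x_def tent_def q_def)
  have orb: "(x ^^ k) p = a + (1 / \<alpha>) ^ k * (p - a)" for k
  proof (induction k)
    case (Suc k)
    have "0 < (1 / \<alpha>) ^ k" "(1 / \<alpha>) ^ k \<le> 1" using assms by (auto simp: power_le_one)
    then have "0 < (1 / \<alpha>) ^ k * (p - a)" "(1 / \<alpha>) ^ k * (p - a) \<le> 1 * (p - a)"
      using p by (auto intro!: mult_right_mono simp del: power_one_over)
    then have "x (a + (1 / \<alpha>) ^ k * (p - a)) = a + (1 / \<alpha>) * ((1 / \<alpha>) ^ k * (p - a))"
      by (subst left) auto
    then show ?case using Suc by simp
  qed simp
  have "germ (at_left p) x (1 / \<alpha>) (a - (1 / \<alpha>) * a)"
    unfolding germ_def eventually_at_left_field using left p(1) by (intro exI[of _ a]) (auto simp: right_diff_distrib)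
  moreover have "germ (at_right p) x ((b - q) / (b - p)) (b - (b - q) / (b - p) * b)"
    unfolding germ_def eventually_at_right_field using p
    by (intro exI[of _ b]) (auto simp: x_def tent_def right_diff_distrib)
  moreover have "1 / \<alpha> < 1" "(b - q) / (b - p) > 1" using assms p q by auto
  ultimately have "p \<in> kinks x" by (intro kinkI) auto
  moreover have "kinks x \<subseteq> {a, p, b}" unfolding x_def using p q assms by (intro kinks_tent) auto
  then have "\<forall>y\<in>kinks x. y \<noteq> p \<longrightarrow> x y = y"
    using p by (auto simp: x_def tent_outside)
  moreover have "filterlim (\<lambda>k. (x ^^ k) p) (at_right a) sequentially"
    unfolding orb filterlim_at
  proof
    show "\<forall>\<^sub>F k in sequentially. a + (1 / \<alpha>) ^ k * (p - a) \<in> {a<..} \<and> a + (1 / \<alpha>) ^ k * (p - a) \<noteq> a"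
      using assms p by auto
    have "(\<lambda>k. (1 / \<alpha>) ^ k) \<longlonglongrightarrow> 0" using assms by (intro LIMSEQ_realpow_zero) auto
    then have "(\<lambda>k. a + (1 / \<alpha>) ^ k * (p - a)) \<longlonglongrightarrow> a + 0 * (p - a)"
      by (intro tendsto_add tendsto_mult tendsto_const)
    then show "(\<lambda>k. a + (1 / \<alpha>) ^ k * (p - a)) \<longlonglongrightarrow> a" by simp
  qed
  moreover have "supp x \<subseteq> {a<..b}"
  proof -
    have "x a = a" by (simp add: x_def tent_def)
    then have "supp x \<subseteq> {a..b} - {a}" using supp_tent[OF p(1,2), of q] by (auto simp: x_def supp_def)
    then show ?thesis by auto
  qed
  ultimately show thesis using that px orb p unfolding spiral_def by blast
qed

lemma spiral_at_top:
  assumes "M \<in> F" "\<alpha> \<in> F" "\<alpha> > 1"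
  obtains x q w where "spiral at_top x q w \<alpha>" "supp x \<subseteq> {M<..}"
proof -
  \<comment> \<open>The middle slope \<open>2 * \<alpha> - 1\<close> puts the final line through
    \<open>(M - 1, M - 1)\<close>, so that the orbit of \<open>M + 1\<close> is geometric about
    \<open>M - 1\<close>. It differs from \<open>\<alpha>\<close>, so \<open>M + 1\<close> really is
    a kink.\<close>
  define x where "x = ramp M (M + 1) (2 * \<alpha> - 1) \<alpha>"
  have pre: "M < M + 1" "0 < 2 * \<alpha> - 1" "0 < \<alpha>" "M \<in> F" "M + 1 \<in> F" "2 * \<alpha> - 1 \<in> F" "\<alpha> \<in> F"
    using assms by (auto intro!: mem_intros)
  have px: "pl x" unfolding x_def by (rule pl_ramp[OF pre])
  have right: "x y = (M - 1) + \<alpha> * (y - (M - 1))" if "y \<ge> M + 1" for y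
  proof (cases "y = M + 1")
    case False
    then show ?thesis using that by (simp add: x_def ramp_def algebra_simps)
  qed (simp add: x_def ramp_def algebra_simps)
  have orb: "(x ^^ k) (M + 1) = (M - 1) + \<alpha> ^ k * ((M + 1) - (M - 1))" for k
  proof (induction k)
    case (Suc k)
    have "1 \<le> \<alpha> ^ k" using assms by simp
    then have "x ((M - 1) + \<alpha> ^ k * ((M + 1) - (M - 1))) = (M - 1) + \<alpha> * (\<alpha> ^ k * ((M + 1) - (M - 1)))"
      by (subst right) auto
    then show ?case using Suc by simp
  qed simp
  have "germ (at_left (M + 1)) x (2 * \<alpha> - 1) (M - (2 * \<alpha> - 1) * M)"
    unfolding germ_def eventually_at_left_field
    by (intro exI[of _ M]) (auto simp: x_def ramp_def algebra_simps)
  moreover have "germ (at_right (M + 1)) x \<alpha> ((M - 1) - \<alpha> * (M - 1))"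
    unfolding germ_def eventually_at_right_field
    by (intro exI[of _ "M + 2"]) (auto simp: right algebra_simps)
  ultimately have "M + 1 \<in> kinks x" using assms(3) by (intro kinkI) auto
  moreover have "kinks x \<subseteq> {M, M + 1}" unfolding x_def by (rule kinks_ramp[OF pre])
  then have "\<forall>y\<in>kinks x. y \<noteq> M + 1 \<longrightarrow> x y = y" by (auto simp: x_def ramp_def)
  moreover have "filterlim (\<lambda>k. \<alpha> ^ k) at_top sequentially"
    using assms(3) by (intro filterlim_at_infinity_imp_filterlim_at_top filterlim_realpow_sequentially_gt1) auto
  then have "filterlim (\<lambda>k. (x ^^ k) (M + 1)) at_top sequentially"
    unfolding orb
    by (intro filterlim_tendsto_add_at_top[OF tendsto_const] filterlim_at_top_mult_tendsto_pos[OF tendsto_const]) auto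
  moreover have "supp x \<subseteq> {M<..}" unfolding x_def by (rule supp_ramp)
  ultimately show thesis using that[of x "M + 1" "M - 1"] px orb unfolding spiral_def by auto
qed

end

section \<open>Germs of group elements at the ends of an interval\<close>

context pl_intervals begin

text \<open>An end is a filter, which treats finite and infinite ends alike. The last condition
  selects the side of an endpoint on which \<open>S i\<close> lies, and the infinities that it
  reaches.\<close>

definition ends :: "'i \<Rightarrow> real filter set" where
  "ends i = {\<Phi>. (\<Phi> = at_top \<or> \<Phi> = at_bot \<or> (\<exists>e\<in>frontier (S i). \<Phi> = at_left e \<or> \<Phi> = at_right e)) \<and>
     (\<forall>\<^sub>F y in \<Phi>. y \<in> S i)}"

lemma end_nontrivial:
  assumes "\<Phi> \<in> ends i"
  shows "\<Phi> \<noteq> bot" "\<forall>\<^sub>F z in \<Phi>. z \<noteq> y"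
proof -
  consider "\<Phi> = at_top" | "\<Phi> = at_bot" | e where "\<Phi> = at_left e \<or> \<Phi> = at_right e"
    using assms by (auto simp: ends_def)
  then have "\<Phi> \<noteq> bot \<and> (\<forall>\<^sub>F z in \<Phi>. z \<noteq> y)"
  proof cases
    case 1
    have "\<forall>\<^sub>F z in at_top. z > y" by (rule eventually_gt_at_top)
    then show ?thesis unfolding 1 by (auto elim: eventually_mono)
  next
    case 2
    have "\<forall>\<^sub>F z in at_bot. z \<le> y - 1" by (rule eventually_le_at_bot)
    then show ?thesis unfolding 2 by (auto elim: eventually_mono)
  next
    case 3
    then show ?thesis
      using trivial_limit_at_left_real[of e] trivial_limit_at_right_real[of e] eventually_neq_at_within by metis
  qed
  then show "\<Phi> \<noteq> bot" "\<forall>\<^sub>F z in \<Phi>. z \<noteq> y" by auto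
qed

lemma end_germ_unique:
  "\<Phi> \<in> ends i \<Longrightarrow> germ \<Phi> f m c \<Longrightarrow> germ \<Phi> f m' c' \<Longrightarrow> m = m' \<and> c = c'"
  using germ_unique end_nontrivial by metis

lemma grp_pl: "f \<in> carrier grp \<Longrightarrow> pl f"
  by (simp add: carrier_grp)

lemma grp_comp: "f \<in> carrier grp \<Longrightarrow> g \<in> carrier grp \<Longrightarrow> f \<circ> g \<in> carrier grp"
  using G.m_closed mult_grp by metis

lemma end_filterlim:
  assumes "i \<in> I" "\<Phi> \<in> ends i" "f \<in> carrier grp"
  shows "filterlim f \<Phi> \<Phi>"
proof -
  note fl = pl_filterlim[OF grp_pl[OF assms(3)]]
  consider "\<Phi> = at_top" | "\<Phi> = at_bot" | e where "e \<in> frontier (S i)" "\<Phi> = at_left e \<or> \<Phi> = at_right e"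
    using assms(2) by (auto simp: ends_def)
  then show ?thesis
  proof cases
    case 3
    then show ?thesis using fl(2,3)[of e] grp_fixes_frontier[OF assms(3,1)] by auto
  qed (use fl in auto)
qed

lemma end_affine_germ:
  assumes "\<Phi> \<in> ends i" "f \<in> carrier grp"
  obtains m c where "m \<in> F" "c \<in> F" "m > 0" "germ \<Phi> f m c"
  using assms pl_affine_germ[OF grp_pl[OF assms(2)]] unfolding ends_def affine_germ_def by blast

lemma end_germ_comp:
  "i \<in> I \<Longrightarrow> \<Phi> \<in> ends i \<Longrightarrow> f \<in> carrier grp \<Longrightarrow> g \<in> carrier grp \<Longrightarrow> germ \<Phi> f m c \<Longrightarrow> germ \<Phi> g m' c' \<Longrightarrow>
    germ \<Phi> (f \<circ> g) (m * m') (m * c' + c)"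
  using germ_comp end_filterlim by blast

lemma end_germ_finv:
  assumes "i \<in> I" "\<Phi> \<in> ends i" "f \<in> carrier grp" "germ \<Phi> f m c"
  shows "germ \<Phi> (finv f) (1 / m) (- c / m)"
proof -
  obtain m' c' where "m' > 0" "germ \<Phi> f m' c'" using end_affine_germ[OF assms(2,3)] by blast
  then have "m \<noteq> 0" using end_germ_unique[OF assms(2,4)] by blast
  then show ?thesis
    using germ_inv[OF assms(4)] pl_surj[OF grp_pl[OF assms(3)]] end_filterlim[OF assms(1,2) finv_in_grp[OF assms(3)]] by blast
qed

text \<open>Group elements preserve each end, so germs there compose like affine maps, and a
  commutator of affine maps is a translation.\<close>

lemma end_germ_commutator:
  assumes "i \<in> I" "\<Phi> \<in> ends i" "f \<in> carrier grp" "g \<in> carrier grp" "germ \<Phi> f m c" "germ \<Phi> g m' c'"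
  shows "germ \<Phi> (f \<circ> g \<circ> finv f \<circ> finv g) 1 ((m - 1) * c' + (1 - m') * c)"
proof -
  have nz: "m \<noteq> 0" "m' \<noteq> 0"
    using end_affine_germ[OF assms(2,3)] end_affine_germ[OF assms(2,4)] end_germ_unique[OF assms(2)] assms(5,6)
    by (metis order_less_irrefl)+
  have "germ \<Phi> (f \<circ> g \<circ> finv f \<circ> finv g) (m * m' * (1 / m) * (1 / m'))
     (m * m' * (1 / m) * (- c' / m') + (m * m' * (- c / m) + (m * c' + c)))"
    by (intro end_germ_comp[OF assms(1,2)] end_germ_finv[OF assms(1,2)] grp_comp finv_in_grp assms)
  then show ?thesis using nz by (simp add: field_simps)
qed

text \<open>The slope at an end is multiplicative and hence unchanged by conjugation. The lemma is
  used for \<open>M = {1}\<close> and for the powers of a single number.\<close>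

lemma slope_subgroup:
  assumes "i \<in> I" "\<Phi> \<in> ends i" and M: "1 \<in> M" "\<And>x y. x \<in> M \<Longrightarrow> y \<in> M \<Longrightarrow> x * y \<in> M" "\<And>x. x \<in> M \<Longrightarrow> 1 / x \<in> M"
  shows "{f \<in> carrier grp. \<exists>m\<in>M. \<exists>c. germ \<Phi> f m c} \<lhd> grp" (is "?K \<lhd> grp")
  unfolding G.normal_inv_iff
proof (intro conjI ballI)
  show "subgroup ?K grp"
  proof
    show "\<one>\<^bsub>grp\<^esub> \<in> ?K" using M(1) germ_id G.one_closed by (auto simp: one_grp)
    show "x \<otimes>\<^bsub>grp\<^esub> y \<in> ?K" if "x \<in> ?K" "y \<in> ?K" for x y
      using that end_germ_comp[OF assms(1,2)] M(2) grp_comp unfolding mult_grp by blast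
    show "inv\<^bsub>grp\<^esub> x \<in> ?K" if K: "x \<in> ?K" for x
    proof -
      obtain m c where m: "m \<in> M" "germ \<Phi> x m c" and x: "x \<in> carrier grp" using K by blast
      then have "finv x \<in> ?K"
        using end_germ_finv[OF assms(1,2) x m(2)] M(3)[OF m(1)] finv_in_grp[OF x] by blast
      then show ?thesis using x by (simp only: inv_grp)
    qed
  qed auto
  fix x h assume x: "x \<in> carrier grp" and h: "h \<in> ?K"
  obtain m c where mc: "m > 0" "germ \<Phi> x m c" using end_affine_germ[OF assms(2) x] by metis
  obtain m' c' where h': "m' \<in> M" "germ \<Phi> h m' c'" "h \<in> carrier grp" using h by blast
  have "germ \<Phi> (x \<circ> h \<circ> finv x) (m * m' * (1 / m)) (m * m' * (- c / m) + (m * c' + c))"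
    by (intro end_germ_comp[OF assms(1,2)] end_germ_finv[OF assms(1,2)] grp_comp finv_in_grp x h' mc)
  then have "germ \<Phi> (x \<circ> h \<circ> finv x) m' (m * m' * (- c / m) + (m * c' + c))" using mc(1) by simp
  then show "x \<otimes>\<^bsub>grp\<^esub> h \<otimes>\<^bsub>grp\<^esub> inv\<^bsub>grp\<^esub> x \<in> ?K"
    using h'(1) grp_comp[OF grp_comp[OF x h'(3)] finv_in_grp[OF x]] unfolding mult_grp inv_grp[OF x] by blast
qed

text \<open>The set \<open>E\<close> of the overview. At a finite end, where the endpoint is fixed,
  slope 1 makes the germ the identity; at an infinite end a translation may remain.\<close>

definition unipotent :: "(real \<Rightarrow> real) set" where
  "unipotent = {f \<in> carrier grp. \<forall>i\<in>I. \<forall>\<Phi>\<in>ends i. \<exists>c. germ \<Phi> f 1 c}"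

lemma unipotent_comp: "f \<in> unipotent \<Longrightarrow> g \<in> unipotent \<Longrightarrow> f \<circ> g \<in> unipotent"
  unfolding unipotent_def using grp_comp end_germ_comp[of _ _ f g 1 _ 1] by simp blast

lemma unipotent_finv: "f \<in> unipotent \<Longrightarrow> finv f \<in> unipotent"
  unfolding unipotent_def using finv_in_grp end_germ_finv[of _ _ f 1] by simp blast

lemma derived_subset_unipotent: "derived grp (carrier grp) \<subseteq> unipotent"
proof -
  have "derived grp (carrier grp) \<subseteq> {f \<in> carrier grp. \<exists>m\<in>{1}. \<exists>c. germ \<Phi> f m c}"
    if i: "i \<in> I" "\<Phi> \<in> ends i" for i \<Phi>
    unfolding derived_def
  proof (rule G.generate_subgroup_incl)
    show "subgroup {f \<in> carrier grp. \<exists>m\<in>{1}. \<exists>c. germ \<Phi> f m c} grp"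
      using slope_subgroup[OF i, of "{1}"] G.normal_inv_iff by auto
    show "derived_set grp (carrier grp) \<subseteq> {f \<in> carrier grp. \<exists>m\<in>{1}. \<exists>c. germ \<Phi> f m c}"
    proof clarify
      fix f g assume fg: "f \<in> carrier grp" "g \<in> carrier grp"
      obtain m c m' c' where "germ \<Phi> f m c" "germ \<Phi> g m' c'"
        using end_affine_germ[OF i(2)] fg by metis
      then show "f \<otimes>\<^bsub>grp\<^esub> g \<otimes>\<^bsub>grp\<^esub> inv\<^bsub>grp\<^esub> f \<otimes>\<^bsub>grp\<^esub> inv\<^bsub>grp\<^esub> g \<in> carrier grp \<and>
          (\<exists>m\<in>{1}. \<exists>c. germ \<Phi> (f \<otimes>\<^bsub>grp\<^esub> g \<otimes>\<^bsub>grp\<^esub> inv\<^bsub>grp\<^esub> f \<otimes>\<^bsub>grp\<^esub> inv\<^bsub>grp\<^esub> g) m c)"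
        using end_germ_commutator[OF i fg] grp_comp[OF grp_comp[OF grp_comp[OF fg] finv_in_grp[OF fg(1)]] finv_in_grp[OF fg(2)]]
        unfolding mult_grp inv_grp[OF fg(1)] inv_grp[OF fg(2)] by blast
    qed
  qed
  moreover have "derived grp (carrier grp) \<subseteq> carrier grp" by (rule G.derived_in_carrier) simp
  ultimately show ?thesis unfolding unipotent_def by blast
qed

lemma end_interval:
  assumes "\<Phi> \<in> ends i"
  shows "\<Phi> = at_top \<and> (\<exists>M. {M<..} \<subseteq> S i) \<or> \<Phi> = at_bot \<and> (\<exists>M. {..<M} \<subseteq> S i) \<or>
    (\<exists>e b. \<Phi> = at_right e \<and> e \<in> frontier (S i) \<and> e < b \<and> {e<..<b} \<subseteq> S i) \<or>
    (\<exists>e b. \<Phi> = at_left e \<and> e \<in> frontier (S i) \<and> b < e \<and> {b<..<e} \<subseteq> S i)"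
proof -
  have ev: "\<forall>\<^sub>F y in \<Phi>. y \<in> S i" using assms by (simp add: ends_def)
  consider "\<Phi> = at_top" | "\<Phi> = at_bot" | e where "e \<in> frontier (S i)" "\<Phi> = at_left e" 
    | e where "e \<in> frontier (S i)" "\<Phi> = at_right e"
    using assms by (auto simp: ends_def)
  then show ?thesis
  proof cases
    case 1
    then show ?thesis using ev by (auto simp: eventually_at_top_dense subset_iff)
  next
    case 2
    then show ?thesis using ev by (auto simp: eventually_at_bot_dense subset_iff)
  next
    case (3 e)
    have "\<forall>\<^sub>F y in at_left e. y \<in> S i" using ev 3(2) by simp
    then obtain b where "b < e" "\<And>y. b < y \<Longrightarrow> y < e \<Longrightarrow> y \<in> S i"
      unfolding eventually_at_left_field by blast
    then have "{b<..<e} \<subseteq> S i" by auto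
    with \<open>b < e\<close> 3 show ?thesis by blast
  next
    case (4 e)
    have "\<forall>\<^sub>F y in at_right e. y \<in> S i" using ev 4(2) by simp
    then obtain b where "e < b" "\<And>y. e < y \<Longrightarrow> y < b \<Longrightarrow> y \<in> S i"
      unfolding eventually_at_right_field by blast
    then have "{e<..<b} \<subseteq> S i" by auto
    with \<open>e < b\<close> 4 show ?thesis by blast
  qed
qed

text \<open>Reflection reduces four kinds of ends to two. A finite endpoint is required to lie in
  \<open>F\<close>, since otherwise every group element has the germ of the identity there.\<close>

lemma exists_spiral:
  assumes i: "i \<in> I" "\<Phi> \<in> ends i" and nF: "\<And>e. e \<in> frontier (S i) \<Longrightarrow> \<Phi> = at_left e \<or> \<Phi> = at_right e \<Longrightarrow> e \<in> F"
    and \<alpha>: "\<alpha> \<in> F" "\<alpha> > 1"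
  obtains x q w \<beta> where "x \<in> carrier grp" "spiral \<Phi> x q w \<beta>" "\<beta> = \<alpha> \<or> \<beta> = 1 / \<alpha>"
proof -
  have mem: "x \<in> carrier grp" if "spiral \<Phi> x q w \<beta>" "supp x \<subseteq> S i" for x q w \<beta>
    using that i(1) by (auto simp: carrier_grp spiral_def region_def)
  have a: "- a \<in> F" if "a \<in> F" for a using that uminus_mem by blast
  consider M where "\<Phi> = at_top" "{M<..} \<subseteq> S i" | M where "\<Phi> = at_bot" "{..<M} \<subseteq> S i"
    | e b where "\<Phi> = at_right e" "e < b" "{e<..<b} \<subseteq> S i" "e \<in> frontier (S i)"
    | e b where "\<Phi> = at_left e" "b < e" "{b<..<e} \<subseteq> S i" "e \<in> frontier (S i)"
    using end_interval[OF i(2)] by blast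
  then show thesis
  proof cases
    case (1 M)
    obtain M' where "M' \<in> F" "M < M'" using dense[of M "M + 1"] by auto
    moreover obtain x q w where "spiral at_top x q w \<alpha>" "supp x \<subseteq> {M'<..}"
      using spiral_at_top[OF \<open>M' \<in> F\<close> \<alpha>] .
    moreover have "{M'<..} \<subseteq> S i" using 1(2) \<open>M < M'\<close> by auto
    ultimately show thesis using that mem 1(1) by blast
  next
    case (2 M)
    obtain M' where M': "M' \<in> F" "M' < M" using dense[of "M - 1" M] by auto
    obtain x q w where x: "spiral at_top x q w \<alpha>" "supp x \<subseteq> {- M'<..}"
      using spiral_at_top[OF a[OF M'(1)] \<alpha>] .
    have "supp (reflect x) \<subseteq> {..<M'}" using x(2) by (auto simp: supp_reflect)
    moreover have "{..<M'} \<subseteq> S i" using 2(2) M'(2) by auto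
    moreover have "spiral \<Phi> (reflect x) (- q) (- w) \<alpha>"
      using spiral_reflect[OF x(1)] 2(1) by (simp add: at_bot_mirror)
    ultimately show thesis using that mem by blast
  next
    case (3 e b)
    obtain b' where b': "b' \<in> F" "e < b'" "b' < b" using dense[OF 3(2)] by auto
    have "e \<in> F" using nF 3(1,4) by blast
    then obtain x q w where x: "spiral (at_right e) x q w (1 / \<alpha>)" "supp x \<subseteq> {e<..b'}"
      using spiral_at_right[OF b'(2) _ b'(1) \<alpha>] by blast
    moreover have "{e<..b'} \<subseteq> S i" using 3(3) b'(3) by (auto simp: subset_iff)
    ultimately show thesis using that mem 3(1) by blast
  next
    case (4 e b)
    obtain b' where b': "b' \<in> F" "b < b'" "b' < e" using dense[OF 4(2)] by auto
    have "e \<in> F" using nF 4(1,4) by blast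
    have "- e < - b'" using b' by simp
    from spiral_at_right[OF this a[OF \<open>e \<in> F\<close>] a[OF b'(1)] \<alpha>]
    obtain x q w where x: "spiral (at_right (- e)) x q w (1 / \<alpha>)" "supp x \<subseteq> {- e<..- b'}" .
    have "supp (reflect x) \<subseteq> {b'..<e}" using x(2) by (auto simp: supp_reflect)
    moreover have "{b'..<e} \<subseteq> S i" using 4(3) b'(2) by (auto simp: subset_iff)
    moreover have "spiral \<Phi> (reflect x) (- q) (- w) (1 / \<alpha>)"
      using spiral_reflect[OF x(1)] 4(1) mirror_filters(1)[of e] by simp
    ultimately show thesis using that mem by blast
  qed
qed

text \<open>The elements whose slope at the end is a power of \<open>\<alpha>\<close> form a normal
  subgroup, and it contains the centralizer of a spiral map with ratio \<open>\<alpha>\<close> or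
  \<open>1 / \<alpha>\<close>.\<close>

lemma pseudocentre_slope:
  assumes g: "g \<in> pseudocentre grp" and i: "i \<in> I" "\<Phi> \<in> ends i"
    and nF: "\<And>e. e \<in> frontier (S i) \<Longrightarrow> \<Phi> = at_left e \<or> \<Phi> = at_right e \<Longrightarrow> e \<in> F" and \<alpha>: "\<alpha> \<in> F" "\<alpha> > 1"
  shows "\<exists>k::int. \<exists>c. germ \<Phi> g (\<alpha> powi k) c"
proof -
  obtain x q w \<beta> where x: "x \<in> carrier grp" "spiral \<Phi> x q w \<beta>" "\<beta> = \<alpha> \<or> \<beta> = 1 / \<alpha>"
    using exists_spiral[OF i nF \<alpha>] by blast
  define M where "M = range (\<lambda>k::int. \<alpha> powi k)"
  let ?K = "{f \<in> carrier grp. \<exists>m\<in>M. \<exists>c. germ \<Phi> f m c}"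
  have "?K \<lhd> grp"
  proof (rule slope_subgroup[OF i])
    show "1 \<in> M" unfolding M_def by (rule range_eqI[of _ _ 0]) simp
    show "x * y \<in> M" if xy: "x \<in> M" "y \<in> M" for x y
    proof -
      obtain k l where "x = \<alpha> powi k" "y = \<alpha> powi l" using xy by (auto simp: M_def)
      then have "x * y = \<alpha> powi (k + l)" using \<alpha> by (simp add: power_int_add)
      then show ?thesis by (auto simp: M_def)
    qed
    show "1 / x \<in> M" if x: "x \<in> M" for x
    proof -
      obtain k where "x = \<alpha> powi k" using x by (auto simp: M_def)
      then have "1 / x = \<alpha> powi (- k)" by (simp add: power_int_minus inverse_eq_divide)
      then show ?thesis by (auto simp: M_def)
    qed
  qed
  moreover have "centralizer grp x \<subseteq> ?K"
  proof
    fix f assume "f \<in> centralizer grp x"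
    then have f: "f \<in> carrier grp" "f \<circ> x = x \<circ> f" by (auto simp: centralizer_def mult_grp)
    obtain \<nu> d where nd: "germ \<Phi> f \<nu> d" using end_affine_germ[OF i(2) f(1)] by metis
    have "\<beta> > 0" "\<beta> \<noteq> 1" using x(3) \<alpha>(2) by auto
    then obtain k :: int where "\<nu> = \<beta> powi k"
      using commuting_slope[OF grp_pl[OF f(1)] _ f(2), of q w \<beta> \<Phi> \<nu> d] x(2) nd
      unfolding spiral_def by blast
    moreover have "(1 / \<alpha>) powi k = \<alpha> powi (- k)"
      by (simp add: power_int_minus power_int_one_over inverse_eq_divide)
    ultimately have "\<nu> \<in> M" using x(3) by (auto simp: M_def)
    then show "f \<in> ?K" using f nd by blast
  qed
  ultimately have "normal_closure grp (centralizer grp x) \<subseteq> ?K"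
    unfolding normal_closure_def by blast
  then have "g \<in> ?K" using g x(1) unfolding pseudocentre_def by blast
  then show ?thesis by (auto simp: M_def)
qed

text \<open>Positive powers of 2 are even and those of 3 are odd; negative exponents are reduced to
  positive ones by inversion.\<close>

lemma powi_2_3:
  assumes "(2::real) powi k = 3 powi l"
  shows "(2::real) powi k = 1"
proof -
  have no: False if "k > 0" "(2::real) powi k = 3 powi l" for k l :: int
  proof -
    have "(2::real) powi k > 1" using that(1) by (simp add: one_less_power_int)
    moreover have "(3::real) powi l \<le> 1" if "l \<le> 0"
      using that one_le_power[of "3::real" "nat (- l)"] by (auto simp: power_int_def field_simps)
    ultimately have "l > 0" using that(2) by force
    then have "(2::real) ^ nat k = 3 ^ nat l" using that by (simp add: power_int_def)
    then have "(2::nat) ^ nat k = 3 ^ nat l" by (metis of_nat_eq_iff of_nat_numeral of_nat_power)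
    then have "even ((3::nat) ^ nat l)" using that(1) by (metis even_numeral even_power zero_less_nat_eq)
    then show False by simp
  qed
  show ?thesis
  proof (cases k "0::int" rule: linorder_cases)
    case less
    have "(2::real) powi (- k) = 3 powi (- l)" using assms by (simp add: power_int_minus)
    then show ?thesis using no[of "- k" "- l"] less by simp
  next
    case greater
    then show ?thesis using no assms by blast
  qed simp
qed

lemma pseudocentre_subset_unipotent: "pseudocentre grp \<subseteq> unipotent"
proof
  fix g assume g: "g \<in> pseudocentre grp"
  have gG: "g \<in> carrier grp"
  proof -
    have "centralizer grp id \<subseteq> carrier grp" by (auto simp: centralizer_def)
    then have "normal_closure grp (centralizer grp id) \<subseteq> carrier grp"
      using G.normal_self unfolding normal_closure_def by blast
    then show ?thesis using g G.one_closed unfolding pseudocentre_def one_grp by blast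
  qed
  have "\<exists>c. germ \<Phi> g 1 c" if i: "i \<in> I" "\<Phi> \<in> ends i" for i \<Phi>
  \<comment> \<open>At an endpoint outside \<open>F\<close> there is no spiral map to compare with,
    but there \<open>g\<close> has no kink and therefore trivial germ.\<close>
  proof (cases "\<exists>e\<in>frontier (S i). e \<notin> F \<and> (\<Phi> = at_left e \<or> \<Phi> = at_right e)")
    case True
    then obtain e where e: "e \<notin> F" "\<Phi> = at_left e \<or> \<Phi> = at_right e" and "e \<in> frontier (S i)"
      by blast
    moreover obtain m c where "germ (nhds e) g m c"
      using pl_germ_ex[OF grp_pl[OF gG]] pl_kinks(2)[OF grp_pl[OF gG]] e(1) by blast
    ultimately have "germ (nhds e) g 1 0" using grp_germ_frontier[OF gG i(1)] by blast
    moreover have "\<Phi> \<le> nhds e" using e(2) by (auto simp: at_within_def)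
    ultimately show ?thesis using germ_filter_mono by blast
  next
    case False
    then have nF: "e \<in> F" if "e \<in> frontier (S i)" "\<Phi> = at_left e \<or> \<Phi> = at_right e" for e
      using that by blast
    obtain k l c d where kl: "germ \<Phi> g (2 powi k) c" "germ \<Phi> g (3 powi l) d"
      using pseudocentre_slope[OF g i nF, of 2] pseudocentre_slope[OF g i nF, of 3] numeral_mem by auto
    then have "(2::real) powi k = 1"
      using powi_2_3 end_germ_unique[OF i(2)] by blast
    then show ?thesis using kl(1) by auto
  qed
  then show "g \<in> unipotent" using gG by (simp add: unipotent_def)
qed

section \<open>Normal subgroups containing a centralizer\<close>

text \<open>The predicate \<open>P\<close> confines the support to a given neighbourhood of the end,
  for instance to one where another map is the identity, so that the two maps commute.\<close>

lemma end_element: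
  assumes i: "i \<in> I" "\<Phi> \<in> ends i" and \<Phi>: "\<Phi> = at_top \<or> \<Phi> = at_bot" and P: "eventually P \<Phi>"
    and \<mu>: "\<mu> \<in> F" "\<mu> > 0" "d \<in> F"
  shows "\<exists>g\<in>carrier grp. supp g \<subseteq> S i \<and> (\<forall>y\<in>supp g. P y) \<and> germ \<Phi> g \<mu> d \<and>
    (\<forall>\<Psi>\<in>ends i. \<Psi> \<noteq> \<Phi> \<longrightarrow> germ \<Psi> g 1 0)"
proof -
  have ev: "\<forall>\<^sub>F y in \<Phi>. P y \<and> y \<in> S i"
    using P i(2) by (simp add: ends_def eventually_conj)
  have inF: "\<exists>m\<in>F. M < m" "\<exists>m\<in>F. m < M" for M
    using dense[of M "M + 1"] dense[of "M - 1" M] by auto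
  have far: "germ \<Psi> g 1 0" if g: "\<forall>\<^sub>F y in \<Psi>. y \<notin> supp g" for \<Psi> g
    using g unfolding germ_def by eventually_elim (simp add: supp_def)
  have fr: "e \<in> interior (S i)" if "open U" "U \<subseteq> S i" "e \<in> U" for e U
    using that interior_maximal by blast
  from \<Phi> show ?thesis
  proof
    assume t: "\<Phi> = at_top"
    obtain M where M: "\<And>y. y > M \<Longrightarrow> P y \<and> y \<in> S i"
      using ev unfolding t eventually_at_top_dense by blast
    obtain M' where M': "M' \<in> F" "M < M'" using inF by blast
    obtain g where g: "pl g" "supp g \<subseteq> {M'<..}" "germ at_top g \<mu> d"
      using exists_germ_at_top[OF \<mu> M'(1)] .
    have sub: "supp g \<subseteq> S i" and sP: "\<And>y. y \<in> supp g \<Longrightarrow> P y" using g(2) M M'(2) by force+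
    have "germ \<Psi> g 1 0" if \<Psi>: "\<Psi> \<in> ends i" "\<Psi> \<noteq> \<Phi>" for \<Psi>
    proof (rule far)
      consider "\<Psi> = at_bot" | e where "e \<in> frontier (S i)" "\<Psi> \<le> nhds e"
        using \<Psi> unfolding ends_def t by (auto simp: at_within_def)
      then have "\<forall>\<^sub>F y in \<Psi>. y \<le> M'"
      proof cases
        case 1
        then show ?thesis using eventually_le_at_bot by blast
      next
        case 2
        have "\<not> e > M" using fr[of "{M<..}" e] M 2(1) unfolding frontier_def by auto
        then have "\<forall>\<^sub>F y in nhds e. y \<in> {..<M'}" using M'(2) by (intro eventually_nhds_in_open) auto
        then have "\<forall>\<^sub>F y in nhds e. y \<le> M'" by eventually_elim simp
        then show ?thesis by (rule filter_leD[OF 2(2)])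
      qed
      then show "\<forall>\<^sub>F y in \<Psi>. y \<notin> supp g"
        by eventually_elim (use g(2) in auto)
    qed
    moreover have "g \<in> carrier grp" using g(1) sub i(1) by (auto simp: carrier_grp region_def)
    ultimately show ?thesis using g(3) sub sP t by blast
  next
    assume t: "\<Phi> = at_bot"
    obtain M where M: "\<And>y. y < M \<Longrightarrow> P y \<and> y \<in> S i"
      using ev unfolding t eventually_at_bot_dense by blast
    obtain M' where M': "M' \<in> F" "M' < M" using inF by blast
    obtain g where g: "pl g" "supp g \<subseteq> {..<M'}" "germ at_bot g \<mu> d"
      using exists_germ_at_bot[OF \<mu> M'(1)] .
    have sub: "supp g \<subseteq> S i" and sP: "\<And>y. y \<in> supp g \<Longrightarrow> P y" using g(2) M M'(2) by force+
    have "germ \<Psi> g 1 0" if \<Psi>: "\<Psi> \<in> ends i" "\<Psi> \<noteq> \<Phi>" for \<Psi>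
    proof (rule far)
      consider "\<Psi> = at_top" | e where "e \<in> frontier (S i)" "\<Psi> \<le> nhds e"
        using \<Psi> unfolding ends_def t by (auto simp: at_within_def)
      then have "\<forall>\<^sub>F y in \<Psi>. y \<ge> M'"
      proof cases
        case 1
        then show ?thesis using eventually_ge_at_top by blast
      next
        case 2
        have "\<not> e < M" using fr[of "{..<M}" e] M 2(1) unfolding frontier_def by auto
        then have "\<forall>\<^sub>F y in nhds e. y \<in> {M'<..}" using M'(2) by (intro eventually_nhds_in_open) auto
        then have "\<forall>\<^sub>F y in nhds e. y \<ge> M'" by eventually_elim simp
        then show ?thesis by (rule filter_leD[OF 2(2)])
      qed
      then show "\<forall>\<^sub>F y in \<Psi>. y \<notin> supp g"
        by eventually_elim (use g(2) in auto)
    qed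
    moreover have "g \<in> carrier grp" using g(1) sub i(1) by (auto simp: carrier_grp region_def)
    ultimately show ?thesis using g(3) sub sP t by blast
  qed
qed

text \<open>Trivial germs at the infinities bound the support, and trivial germs on both sides of an
  endpoint keep its closure away from that endpoint. On a side that \<open>S i\<close> does not
  reach, triviality comes from the support condition.\<close>

lemma compact_part_if_trivial_germs:
  assumes i: "i \<in> I" and f: "f \<in> carrier grp" and supp: "supp f \<subseteq> S i"
    and germs: "\<And>\<Phi>. \<Phi> \<in> ends i \<Longrightarrow> germ \<Phi> f 1 0"
  shows "f \<in> compact_part i"
proof -
  have trivial: "\<forall>\<^sub>F y in \<Phi>. f y = y"
    if \<Phi>: "\<Phi> = at_top \<or> \<Phi> = at_bot \<or> (\<exists>e\<in>frontier (S i). \<Phi> = at_left e \<or> \<Phi> = at_right e)" for \<Phi>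
  proof -
    have "(\<forall>\<^sub>F y in \<Phi>. y \<in> S i) \<or> (\<forall>\<^sub>F y in \<Phi>. y \<notin> S i)"
      using interval_eventually_sided[OF interval[OF i]] \<Phi> by blast
    then show ?thesis
    proof
      assume "\<forall>\<^sub>F y in \<Phi>. y \<in> S i"
      then have "\<Phi> \<in> ends i" using \<Phi> by (simp add: ends_def)
      then show ?thesis using germs by (simp add: germ_def)
    next
      assume "\<forall>\<^sub>F y in \<Phi>. y \<notin> S i"
      then show ?thesis by eventually_elim (use supp in \<open>auto simp: supp_def\<close>)
    qed
  qed
  obtain a b where "\<And>y. y \<ge> b \<Longrightarrow> f y = y" "\<And>y. y \<le> a \<Longrightarrow> f y = y"
    using trivial[of at_top] trivial[of at_bot]
    unfolding eventually_at_top_linorder eventually_at_bot_linorder by blast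
  then have "supp f \<subseteq> {a..b}" by (auto simp: supp_def) (meson linear)+
  then have "compact (closure (supp f))"
    by (meson bounded_closed_interval bounded_subset compact_closure)
  have int: "closure (supp f) \<subseteq> interior (S i)"
  proof
    fix e assume e: "e \<in> closure (supp f)"
    show "e \<in> interior (S i)"
    proof (rule ccontr)
      assume "e \<notin> interior (S i)"
      then have fr: "e \<in> frontier (S i)" using e closure_mono[OF supp] by (auto simp: frontier_def)
      then have "\<forall>\<^sub>F y in nhds e. f y = y"
        using trivial[of "at_left e"] trivial[of "at_right e"] grp_fixes_frontier[OF f i fr]
        by (auto simp: eventually_nhds_conv_at eventually_at_split)
      then obtain T where "open T" "e \<in> T" "T \<inter> supp f = {}"
        unfolding eventually_nhds by (auto simp: supp_def)
      then show False using e open_Int_closure_eq_empty by blast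
    qed
  qed
  show ?thesis
  proof (cases "supp f = {}")
    case True
    obtain x where "x \<in> interior (S i)" using int_nonempty[OF i] by blast
    then show ?thesis using True by (intro compact_partI[OF grp_pl[OF f], of x x]) auto
  next
    case False
    then have "closure (supp f) \<noteq> {}" by simp
    then obtain c d where "c \<in> closure (supp f)" "d \<in> closure (supp f)"
      and cd: "\<And>x. x \<in> closure (supp f) \<Longrightarrow> c \<le> x \<and> x \<le> d"
      using compact_attains_inf compact_attains_sup \<open>compact (closure (supp f))\<close> by metis
    then have "{c..d} \<subseteq> interior (S i)" using interior_between[OF i] int by blast
    moreover have "supp f \<subseteq> {c..d}" using cd closure_subset by fastforce
    moreover have "c \<le> d" using cd \<open>c \<in> closure (supp f)\<close> by blast
    ultimately show ?thesis using compact_partI[OF grp_pl[OF f]] by blast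
  qed
qed

text \<open>An interval other than the line has an endpoint. Without kinks in the closure, the germ
  there would be the identity and would spread over the whole interval.\<close>

lemma moved_component_kink:
  assumes f: "f \<in> carrier grp" and i: "i \<in> I" and t: "t \<in> S i" "f t \<noteq> t" and nU: "S i \<noteq> UNIV"
  shows "kinks f \<inter> closure (S i) \<noteq> {}"
proof
  assume no: "kinks f \<inter> closure (S i) = {}"
  have pf: "pl f" by (rule grp_pl[OF f])
  have "frontier (S i) \<noteq> {}" using nU t(1) frontier_eq_empty by blast
  then obtain e where e: "e \<in> frontier (S i)" by blast
  then have ec: "e \<in> closure (S i)" by (simp add: frontier_def)
  obtain m c where "germ (nhds e) f m c" using pl_germ_ex[OF pf] no ec by blast
  then have ge: "germ (nhds e) f 1 0" using grp_germ_frontier[OF f i e] by blast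
  have "connected (closure (S i))"
    using interval[OF i] by (simp add: is_interval_connected connected_imp_connected_closure)
  moreover have "t \<in> closure (S i)" using t(1) closure_subset by blast
  moreover have "\<exists>m c. germ (nhds x) f m c" if "x \<in> closure (S i)" for x
    using pl_germ_ex[OF pf] no that by blast
  ultimately have "germ (nhds t) f 1 0" using germ_connected[OF _ ec ge] by blast
  then show False using t(2) by (auto simp: germ_def dest: eventually_nhds_x_imp_x)
qed

text \<open>The closures are disjoint, so choosing a kink in each moved one is injective. This
  permits an induction over the moved intervals even when \<open>I\<close> is infinite.\<close>

lemma finite_moved_components:
  assumes f: "f \<in> carrier grp"
  shows "finite {i \<in> I. \<exists>t\<in>S i. f t \<noteq> t}" (is "finite ?T")
proof (cases "\<exists>i\<in>I. S i = UNIV")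
  case True
  then obtain i where i: "i \<in> I" "S i = UNIV" by blast
  have "j = i" if j: "j \<in> I" for j
  proof -
    obtain x where "x \<in> closure (S j)" using int_nonempty[OF j] interior_subset closure_subset by blast
    then show ?thesis using disj_closure[OF j i(1)] i(2) by simp
  qed
  then have "?T \<subseteq> {i}" by blast
  then show ?thesis by (rule finite_subset) simp
next
  case False
  then have "\<forall>i\<in>?T. \<exists>k. k \<in> kinks f \<and> k \<in> closure (S i)"
    using moved_component_kink[OF f] by blast
  from bchoice[OF this] obtain k where k: "\<And>i. i \<in> ?T \<Longrightarrow> k i \<in> kinks f \<and> k i \<in> closure (S i)"
    by blast
  have "inj_on k ?T"
  proof (rule inj_onI)
    fix i j assume ij: "i \<in> ?T" "j \<in> ?T" "k i = k j"
    then show "i = j" using disj_closure[of i j "k i"] k[OF ij(1)] k[OF ij(2)] by simp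
  qed
  moreover have "k ` ?T \<subseteq> kinks f" using k by blast
  ultimately show ?thesis
    using pl_kinks(1)[OF grp_pl[OF f]] by (meson finite_imageD finite_subset)
qed

lemma restrict_to_unipotent:
  assumes f: "f \<in> unipotent" and i: "i \<in> I"
  shows "restrict_to (S i) f \<in> unipotent"
proof -
  have fG: "f \<in> carrier grp" using f by (simp add: unipotent_def)
  have "\<exists>c. germ \<Phi> (restrict_to (S i) f) 1 c" if j: "j \<in> I" "\<Phi> \<in> ends j" for j \<Phi>
  proof -
    have ev: "\<forall>\<^sub>F y in \<Phi>. y \<in> S j" using j(2) by (simp add: ends_def)
    show ?thesis
    proof (cases "i = j")
      case True
      have "\<forall>\<^sub>F y in \<Phi>. restrict_to (S i) f y = f y" using ev by eventually_elim (simp add: restrict_to_def True)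
      from germ_cong[OF this] show ?thesis using f j unfolding unipotent_def by simp
    next
      case False
      have "y \<notin> S i" if "y \<in> S j" for y
        using False disj_closure[OF i j(1)] closure_subset that by blast
      then have "\<forall>\<^sub>F y in \<Phi>. restrict_to (S i) f y = 1 * y + 0"
        using ev by (auto elim!: eventually_mono simp: restrict_to_def)
      then show ?thesis unfolding germ_def by blast
    qed
  qed
  then show ?thesis using restrict_to_in_grp[OF fG i] by (simp add: unipotent_def)
qed

end

section \<open>Translations at infinity and compact commutators inside a normal subgroup\<close>

context normal_pl begin

text \<open>At the end, the commutator of \<open>x\<close> with a map of germ
  \<open>\<mu> * y + d\<close> is the translation by
  \<open>(\<kappa> - 1) * d + (1 - \<mu>) * e\<close>. If that map has trivial germs at the other
  ends, so has the commutator.\<close>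

lemma N_translations:
  assumes i: "i \<in> I" "\<Phi> \<in> ends i" and \<Phi>: "\<Phi> = at_top \<or> \<Phi> = at_bot"
    and x: "x \<in> carrier grp" "supp x \<subseteq> S i" "germ \<Phi> x \<kappa> e" "(\<kappa>, e) \<noteq> (1, 0)"
    and comm: "\<And>g. g \<in> carrier grp \<Longrightarrow> x \<circ> g \<circ> finv x \<circ> finv g \<in> N"
    and c: "c \<in> F"
  shows "\<exists>n\<in>N. supp n \<subseteq> S i \<and> germ \<Phi> n 1 c \<and> (\<forall>\<Psi>\<in>ends i. \<Psi> \<noteq> \<Phi> \<longrightarrow> germ \<Psi> n 1 0)"
proof -
  have key: "\<exists>n\<in>N. supp n \<subseteq> S i \<and> germ \<Phi> n 1 ((\<kappa> - 1) * d + (1 - \<mu>) * e) \<and> (\<forall>\<Psi>\<in>ends i. \<Psi> \<noteq> \<Phi> \<longrightarrow> germ \<Psi> n 1 0)"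
    if \<mu>: "\<mu> \<in> F" "\<mu> > 0" "d \<in> F" for \<mu> d
  proof -
    obtain g where g: "g \<in> carrier grp" "supp g \<subseteq> S i" "germ \<Phi> g \<mu> d"
      "\<And>\<Psi>. \<Psi> \<in> ends i \<Longrightarrow> \<Psi> \<noteq> \<Phi> \<Longrightarrow> germ \<Psi> g 1 0"
      using end_element[OF i \<Phi> eventually_True \<mu>] by blast
    let ?n = "x \<circ> g \<circ> finv x \<circ> finv g"
    have "supp ?n \<subseteq> supp x \<union> supp g"
      using supp_comp[of "x \<circ> g \<circ> finv x" "finv g"] supp_comp[of "x \<circ> g" "finv x"] supp_comp[of x g]
        supp_finv[OF grp_pl[OF x(1)]] supp_finv[OF grp_pl[OF g(1)]] by blast
    then have "supp ?n \<subseteq> S i" using x(2) g(2) by blast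
    moreover have "germ \<Psi> ?n 1 0" if \<Psi>: "\<Psi> \<in> ends i" "\<Psi> \<noteq> \<Phi>" for \<Psi>
    proof -
      obtain m c where "germ \<Psi> x m c" using end_affine_germ[OF \<Psi>(1) x(1)] by blast
      from end_germ_commutator[OF i(1) \<Psi>(1) x(1) g(1) this g(4)[OF \<Psi>]] show ?thesis by simp
    qed
    ultimately show ?thesis
      using comm[OF g(1)] end_germ_commutator[OF i x(1) g(1) x(3) g(3)] by blast
  qed
  obtain \<kappa>' e' where "\<kappa>' \<in> F" "e' \<in> F" "germ \<Phi> x \<kappa>' e'" using end_affine_germ[OF i(2) x(1)] by blast
  then have F: "\<kappa> \<in> F" "e \<in> F" using end_germ_unique[OF i(2) x(3)] by blast+
  \<comment> \<open>If \<open>x\<close> is a translation at the end, \<open>c\<close> requires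
    \<open>\<mu> = 1 - c / e\<close>, which is positive only for \<open>c / e < 1\<close>; otherwise
    the translation by \<open>- c\<close> is produced and inverted.\<close>
  consider "\<kappa> \<noteq> 1" | "\<kappa> = 1" "e \<noteq> 0" "c / e < 1" | "\<kappa> = 1" "e \<noteq> 0" "c / e \<ge> 1" using x(4) by force
  then show ?thesis
  proof cases
    case 1
    then have "(\<kappa> - 1) * (c / (\<kappa> - 1)) + (1 - 1) * e = c" by simp
    moreover have "c / (\<kappa> - 1) \<in> F" using c F by (intro mem_intros)
    ultimately show ?thesis using key[OF one_mem zero_less_one, of "c / (\<kappa> - 1)"] by simp
  next
    case 2
    then have "(\<kappa> - 1) * 0 + (1 - (1 - c / e)) * e = c" by simp
    moreover have "1 - c / e \<in> F" "1 - c / e > 0" using c F 2 by (auto intro!: mem_intros)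
    ultimately show ?thesis using key[OF _ _ zero_mem, of "1 - c / e"] by simp
  next
    case 3
    then have "(\<kappa> - 1) * 0 + (1 - (1 + c / e)) * e = - c" by simp
    moreover have "1 + c / e \<in> F" "1 + c / e > 0" using c F 3 by (auto intro!: mem_intros)
    ultimately obtain n where n: "n \<in> N" "supp n \<subseteq> S i" "germ \<Phi> n 1 (- c)"
      "\<And>\<Psi>. \<Psi> \<in> ends i \<Longrightarrow> \<Psi> \<noteq> \<Phi> \<Longrightarrow> germ \<Psi> n 1 0"
      using key[OF _ _ zero_mem, of "1 + c / e"] by metis
    note nG = N_carrier[OF n(1)]
    have "germ \<Phi> (finv n) 1 c" using end_germ_finv[OF i nG n(3)] by simp
    moreover have "germ \<Psi> (finv n) 1 0" if "\<Psi> \<in> ends i" "\<Psi> \<noteq> \<Phi>" for \<Psi>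
      using end_germ_finv[OF i(1) that(1) nG n(4)[OF that]] by simp
    moreover have "supp (finv n) \<subseteq> S i" using n(2) supp_finv[OF grp_pl[OF nG]] by simp
    ultimately show ?thesis using N_finv[OF n(1)] by blast
  qed
qed

text \<open>Higman's trick: if \<open>x\<close> moves the support \<open>[u, v]\<close> of \<open>f\<close> and \<open>g\<close> off itself, then
  \<open>[f, g] = [[f, x], g]\<close>; arbitrary compactly supported \<open>f\<close>, \<open>g\<close> are first conjugated into \<open>[u, v]\<close>.\<close>

lemma commutators_in_N:
  assumes i: "i \<in> I" and x: "x \<in> N" "supp x \<subseteq> S i" "x \<noteq> id"
    and fg: "f \<in> compact_part i" "g \<in> compact_part i"
  shows "f \<circ> g \<circ> finv f \<circ> finv g \<in> N"
proof -
  note xG = N_carrier[OF x(1)] and fG = subsetD[OF compact_part_subset[OF i] fg(1)]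
    and gG = subsetD[OF compact_part_subset[OF i] fg(2)]
  note px = grp_pl[OF xG] and pf = grp_pl[OF fG] and pg = grp_pl[OF gG]
  obtain t where t: "x t \<noteq> t" using x(3) by (auto simp: fun_eq_iff)
  then have "t \<in> S i" using x(2) by (auto simp: supp_def)
  moreover have "t \<notin> frontier (S i)" using grp_fixes_frontier[OF xG i] t by blast
  ultimately have ti: "t \<in> interior (S i)" using closure_subset by (auto simp: frontier_def)
  obtain u' v' where uv': "u' < t" "t < v'" "u' \<in> interior (S i)" "v' \<in> interior (S i)"
    using interior_beyond[OF i ti] by blast
  have J: "y \<in> interior (S i)" if "u' \<le> y" "y \<le> v'" for y
    using interior_between[OF i uv'(3,4)] that by auto
  \<comment> \<open>A segment strictly between \<open>t\<close> and \<open>x t\<close> is pushed by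
    \<open>x\<close> completely past itself.\<close>
  obtain u v where uv: "u < v" "u \<in> F" "v \<in> F" "u \<in> interior (S i)" "v \<in> interior (S i)"
    and off: "x ` {u..v} \<inter> {u..v} = {}"
  proof (cases "t < x t")
    case True
    obtain u where u: "u \<in> F" "t < u" "u < min v' (x t)" using dense[of t "min v' (x t)"] True uv' by auto
    obtain v where v: "v \<in> F" "u < v" "v < min v' (x t)" using dense[OF u(3)] by auto
    have "x y > v" if "y \<ge> u" for y
      using pl_less_iff[OF px, of t y] that u(2) v(3) by simp
    then have "x ` {u..v} \<inter> {u..v} = {}" by force
    moreover have "u \<in> interior (S i)" "v \<in> interior (S i)" using u v uv' by (auto intro!: J)
    ultimately show thesis using that u v by blast
  next
    case False
    then have xt: "x t < t" using t by simp
    obtain v where v: "v \<in> F" "max u' (x t) < v" "v < t" using dense[of "max u' (x t)" t] xt uv' by auto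
    obtain u where u: "u \<in> F" "max u' (x t) < u" "u < v" using dense[OF v(2)] by auto
    have "x y < u" if "y \<le> v" for y
      using pl_less_iff[OF px, of y t] that v(3) u(2) by simp
    then have "x ` {u..v} \<inter> {u..v} = {}" by force
    moreover have "u \<in> interior (S i)" "v \<in> interior (S i)" using u v uv' by (auto intro!: J)
    ultimately show thesis using that u v by blast
  qed
  obtain c1 d1 c2 d2 where cd: "c1 \<le> d1" "{c1..d1} \<subseteq> interior (S i)" "supp f \<subseteq> {c1..d1}"
    "c2 \<le> d2" "{c2..d2} \<subseteq> interior (S i)" "supp g \<subseteq> {c2..d2}"
    using fg by (auto simp: compact_part_def)
  have "min c1 c2 \<in> interior (S i)" "max d1 d2 \<in> interior (S i)"
    using cd(1,2,4,5) by (auto simp: min_def max_def)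
  then obtain c d where c: "c \<in> F" "c < min c1 c2" "c \<in> interior (S i)" and d: "d \<in> F" "max d1 d2 < d" "d \<in> interior (S i)"
    using interior_beyond[OF i] by metis
  have cdl: "c < d" using c(2) d(2) cd(1) by simp
  obtain k where k: "k \<in> compact_part i" "\<And>t. c \<le> t \<Longrightarrow> t \<le> d \<Longrightarrow> k t = u + (v - u) / (d - c) * (t - c)"
    using local_transport[OF i cdl uv(1) c(1) d(1) uv(2,3) c(3) d(3) uv(4,5)] by blast
  have kG: "k \<in> carrier grp" using k(1) compact_part_subset[OF i] by blast
  note pk = grp_pl[OF kG]
  have kends: "k c = u" "k d = v" using k(2) cdl by auto
  have ksub: "k ` {c..d} \<subseteq> {u..v}"
    using pl_le_iff[OF pk] kends by (auto simp flip: kends)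
  define f' where "f' = k \<circ> f \<circ> finv k"
  define g' where "g' = k \<circ> g \<circ> finv k"
  have G': "f' \<in> carrier grp" "g' \<in> carrier grp"
    unfolding f'_def g'_def by (intro grp_comp kG fG gG finv_in_grp)+
  note pf' = grp_pl[OF G'(1)] and pg' = grp_pl[OF G'(2)]
  have "supp f \<subseteq> {c..d}" "supp g \<subseteq> {c..d}" using cd c(2) d(2) by force+
  then have s': "supp f' \<subseteq> {u..v}" "supp g' \<subseteq> {u..v}"
    unfolding f'_def g'_def supp_conj[OF pk] using ksub by blast+
  \<comment> \<open>The support of \<open>w\<close> lies in the image of \<open>[u, v]\<close> under
    \<open>x\<close>, so \<open>w\<close> commutes with \<open>g'\<close> and drops out of the
    commutator of \<open>y = f' \<circ> w\<close> and \<open>g'\<close>.\<close>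
  define w where "w = x \<circ> finv f' \<circ> finv x"
  have wG: "w \<in> carrier grp" unfolding w_def by (intro grp_comp finv_in_grp xG G')
  note pw = grp_pl[OF wG]
  have "supp w = x ` supp f'" unfolding w_def supp_conj[OF px] supp_finv[OF pf'] ..
  then have "supp w \<inter> supp g' = {}" using s' off by blast
  then have wg: "w \<circ> g' = g' \<circ> w" by (rule commute_disjoint_supp[OF pw pg'])
  define y where "y = f' \<circ> x \<circ> finv f' \<circ> finv x"
  have yN: "y \<in> N" unfolding y_def by (intro N_comp N_conj N_finv G' x)
  have y: "y = f' \<circ> w" unfolding y_def w_def by (simp add: comp_assoc)
  have fy: "finv y t = finv w (finv f' t)" for t
    unfolding y using pl_inv_f[OF pl_comp[OF pf' pw], of "finv w (finv f' t)"] pl_f_inv[OF pf'] pl_f_inv[OF pw] by simp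
  have "y \<circ> (g' \<circ> finv y \<circ> finv g') \<in> N"
    by (intro N_comp N_conj N_finv yN G')
  moreover have "y \<circ> (g' \<circ> finv y \<circ> finv g') = f' \<circ> g' \<circ> finv f' \<circ> finv g'"
  proof
    fix t
    have "w (g' (finv w s)) = g' s" for s using wg pl_f_inv[OF pw] by (metis comp_apply)
    then show "(y \<circ> (g' \<circ> finv y \<circ> finv g')) t = (f' \<circ> g' \<circ> finv f' \<circ> finv g') t"
      unfolding comp_apply fy by (simp add: y)
  qed
  ultimately have "f' \<circ> g' \<circ> finv f' \<circ> finv g' \<in> N" by simp
  then have "finv k \<circ> (f' \<circ> g' \<circ> finv f' \<circ> finv g') \<circ> finv (finv k) \<in> N"
    by (rule N_conj[OF finv_in_grp[OF kG]])
  moreover have "finv k \<circ> (f' \<circ> g' \<circ> finv f' \<circ> finv g') \<circ> finv (finv k) = f \<circ> g \<circ> finv f \<circ> finv g"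
  proof
    fix t
    have ck: "finv (k \<circ> h \<circ> finv k) s = k (finv h (finv k s))" if "pl h" for h s
    proof -
      have "(k \<circ> h \<circ> finv k) (k (finv h (finv k s))) = s"
        using pl_inv_f[OF pk] pl_f_inv[OF pk] pl_f_inv[OF that] by simp
      then show ?thesis
        using pl_inv_f[OF pl_comp[OF pl_comp[OF pk that] pl_inv[OF pk]]] by metis
    qed
    have "finv (finv k) t = k t" using pl_inv_f[OF pl_inv[OF pk], of "k t"] pl_inv_f[OF pk] by simp
    then show "(finv k \<circ> (f' \<circ> g' \<circ> finv f' \<circ> finv g') \<circ> finv (finv k)) t = (f \<circ> g \<circ> finv f \<circ> finv g) t"
      unfolding f'_def g'_def comp_apply using ck[OF pf] ck[OF pg] pl_inv_f[OF pk] by (simp add: comp_def)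
  qed
  ultimately show ?thesis by simp
qed

end

text \<open>The common features of the commutator subgroup and of a normal subgroup that contains a
  centralizer, so that both are treated by one argument.\<close>

locale large_normal_pl = normal_pl +
  assumes compact_commutators:
      "i \<in> I \<Longrightarrow> f \<in> compact_part i \<Longrightarrow> g \<in> compact_part i \<Longrightarrow> f \<circ> g \<circ> finv f \<circ> finv g \<in> N"
    and end_commutators:
      "i \<in> I \<Longrightarrow> \<Phi> \<in> ends i \<Longrightarrow> \<Phi> = at_top \<or> \<Phi> = at_bot \<Longrightarrow>
        \<exists>x \<kappa> e. x \<in> carrier grp \<and> supp x \<subseteq> S i \<and> germ \<Phi> x \<kappa> e \<and> (\<kappa>, e) \<noteq> (1, 0) \<and>
          (\<forall>g\<in>carrier grp. x \<circ> g \<circ> finv x \<circ> finv g \<in> N)"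
begin

lemma compact_in_N: "i \<in> I \<Longrightarrow> compact_part i \<subseteq> N"
proof -
  assume i: "i \<in> I"
  interpret locally_commutative F S I N i
    by unfold_locales (use i compact_commutators in auto)
  show ?thesis by (rule compact_part_subset_N)
qed

text \<open>Makes \<open>f\<close> the identity near one infinite end by a factor from
  \<open>N\<close>, without spoiling ends at which it is already trivial. If \<open>\<Phi>\<close>
  is not an end of \<open>S i\<close>, the factor is \<open>id\<close>.\<close>

lemma straighten_end:
  assumes i: "i \<in> I" and \<Phi>: "\<Phi> = at_top \<or> \<Phi> = at_bot" and f: "f \<in> unipotent" "supp f \<subseteq> S i"
  shows "\<exists>n\<in>N. n \<circ> f \<in> unipotent \<and> supp (n \<circ> f) \<subseteq> S i \<and> (\<Phi> \<in> ends i \<longrightarrow> germ \<Phi> (n \<circ> f) 1 0) \<and>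
    (\<forall>\<Psi>\<in>ends i. \<Psi> \<noteq> \<Phi> \<longrightarrow> germ \<Psi> f 1 0 \<longrightarrow> germ \<Psi> (n \<circ> f) 1 0)"
proof (cases "\<Phi> \<in> ends i")
  case False
  then show ?thesis using N_id f by (intro bexI[of _ id]) auto
next
  case True
  have fG: "f \<in> carrier grp" using f(1) by (simp add: unipotent_def)
  obtain c where c: "germ \<Phi> f 1 c" using f(1) i True by (auto simp: unipotent_def)
  moreover obtain m' c' where "c' \<in> F" "germ \<Phi> f m' c'" using end_affine_germ[OF True fG] by blast
  ultimately have "c \<in> F" using end_germ_unique[OF True] by blast
  then have cF: "- c \<in> F" by (rule uminus_mem)
  obtain x \<kappa> e where x: "x \<in> carrier grp" "supp x \<subseteq> S i" "germ \<Phi> x \<kappa> e" "(\<kappa>, e) \<noteq> (1, 0)"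
    "\<And>g. g \<in> carrier grp \<Longrightarrow> x \<circ> g \<circ> finv x \<circ> finv g \<in> N"
    using end_commutators[OF i True \<Phi>] by blast
  obtain n where n: "n \<in> N" "supp n \<subseteq> S i" "germ \<Phi> n 1 (- c)" "\<And>\<Psi>. \<Psi> \<in> ends i \<Longrightarrow> \<Psi> \<noteq> \<Phi> \<Longrightarrow> germ \<Psi> n 1 0"
    using N_translations[OF i True \<Phi> x cF] by blast
  note nG = N_carrier[OF n(1)]
  have s: "supp (n \<circ> f) \<subseteq> S i" using supp_comp[of n f] n(2) f(2) by blast
  have g0: "germ \<Phi> (n \<circ> f) 1 0" using end_germ_comp[OF i True nG fG n(3) c] by simp
  have g1: "germ \<Psi> (n \<circ> f) 1 d" if "\<Psi> \<in> ends i" "\<Psi> \<noteq> \<Phi>" "germ \<Psi> f 1 d" for \<Psi> d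
    using end_germ_comp[OF i that(1) nG fG n(4)[OF that(1,2)] that(3)] by simp
  have "\<exists>d. germ \<Psi> (n \<circ> f) 1 d" if j: "j \<in> I" "\<Psi> \<in> ends j" for j \<Psi>
  proof (cases "j = i")
    case True
    then show ?thesis using g0 g1 f(1) j unfolding unipotent_def by blast
  next
    case False
    have ev: "\<forall>\<^sub>F y in \<Psi>. y \<in> S j" using j(2) by (simp add: ends_def)
    have "y \<notin> S i" if "y \<in> S j" for y
      using False disj_closure[OF i j(1)] closure_subset that by blast
    then have "(n \<circ> f) y = 1 * y + 0" if "y \<in> S j" for y
      using that s by (auto simp: supp_def)
    then have "germ \<Psi> (n \<circ> f) 1 0" unfolding germ_def using ev by (auto elim!: eventually_mono)
    then show ?thesis by blast
  qed
  then have "n \<circ> f \<in> unipotent" using grp_comp[OF nG fG] by (simp add: unipotent_def)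
  then show ?thesis using n(1) s g0 g1 by blast
qed

lemma component_in_N:
  assumes i: "i \<in> I" and f: "f \<in> unipotent" "supp f \<subseteq> S i"
  shows "f \<in> N"
proof -
  have cancel: "f \<in> N" if "n \<in> N" "n \<circ> f \<in> N" "f \<in> unipotent" for n f
  proof -
    have "finv n \<circ> (n \<circ> f) \<in> N" by (intro N_comp N_finv that(1,2))
    then show ?thesis using finv_comp_self(1)[OF grp_pl[OF N_carrier[OF that(1)]]] by (simp add: comp_assoc[symmetric])
  qed
  obtain n1 where n1: "n1 \<in> N" "n1 \<circ> f \<in> unipotent" "supp (n1 \<circ> f) \<subseteq> S i" "at_top \<in> ends i \<Longrightarrow> germ at_top (n1 \<circ> f) 1 0"
    using straighten_end[OF i _ f, of at_top] by blast
  define f1 where "f1 = n1 \<circ> f"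
  obtain n2 where n2: "n2 \<in> N" "n2 \<circ> f1 \<in> unipotent" "supp (n2 \<circ> f1) \<subseteq> S i" "at_bot \<in> ends i \<Longrightarrow> germ at_bot (n2 \<circ> f1) 1 0"
    "\<And>\<Psi>. \<Psi> \<in> ends i \<Longrightarrow> \<Psi> \<noteq> at_bot \<Longrightarrow> germ \<Psi> f1 1 0 \<Longrightarrow> germ \<Psi> (n2 \<circ> f1) 1 0"
    using straighten_end[OF i _ n1(2,3), of at_bot] unfolding f1_def by blast
  define f2 where "f2 = n2 \<circ> f1"
  have f2: "f2 \<in> unipotent" "supp f2 \<subseteq> S i" using n2 by (auto simp: f2_def)
  then have f2G: "f2 \<in> carrier grp" by (simp add: unipotent_def)
  have "germ \<Phi> f2 1 0" if \<Phi>: "\<Phi> \<in> ends i" for \<Phi>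
  proof -
    consider "\<Phi> = at_bot" | "\<Phi> = at_top" "\<Phi> \<noteq> at_bot" | e where "e \<in> frontier (S i)" "\<Phi> = at_left e \<or> \<Phi> = at_right e"
      using \<Phi> by (auto simp: ends_def)
    then show ?thesis
    proof cases
      case 1
      then show ?thesis using n2(4) \<Phi> by (simp add: f2_def)
    next
      case 2
      then show ?thesis using n2(5)[OF \<Phi>] n1(4) \<Phi> by (simp add: f2_def f1_def)
    next
      \<comment> \<open>At a finite end the translation part vanishes because the endpoint is
        fixed.\<close>
      case 3
      obtain c where c: "germ \<Phi> f2 1 c" using f2(1) i \<Phi> unfolding unipotent_def by blast
      then have "f2 e = 1 * e + c" using pl_germ_value[OF grp_pl[OF f2G]] 3(2) by blast
      then have "c = 0" using grp_fixes_frontier[OF f2G i 3(1)] by simp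
      then show ?thesis using c by simp
    qed
  qed
  then have "f2 \<in> N"
    using compact_part_if_trivial_germs[OF i f2G f2(2)] compact_in_N[OF i] by blast
  then have "f1 \<in> N" using cancel[OF n2(1)] n1(2) by (simp add: f2_def f1_def)
  then show ?thesis using cancel[OF n1(1)] f(1) by (simp add: f1_def)
qed

text \<open>Induction on the number of moved intervals: dividing by the restriction to one of them
  makes the map trivial there and leaves it unchanged elsewhere.\<close>

lemma unipotent_subset_N: "unipotent \<subseteq> N"
proof
  fix f assume "f \<in> unipotent"
  then show "f \<in> N"
  proof (induction "card {i \<in> I. \<exists>t\<in>S i. f t \<noteq> t}" arbitrary: f rule: less_induct)
    case less
    have fG: "f \<in> carrier grp" using less.prems by (simp add: unipotent_def)
    show ?case
    proof (cases "f = id")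
      case True
      then show ?thesis using N_id by simp
    next
      case False
      then obtain t where t: "f t \<noteq> t" by (auto simp: fun_eq_iff)
      then have "t \<in> region" using fG by (auto simp: carrier_grp supp_def)
      then obtain i where i: "i \<in> I" "t \<in> S i" by (auto simp: region_def)
      define r where "r = restrict_to (S i) f"
      have rU: "r \<in> unipotent" unfolding r_def by (rule restrict_to_unipotent[OF less.prems i(1)])
      have rG: "r \<in> carrier grp" using rU by (simp add: unipotent_def)
      note pr = grp_pl[OF rG]
      have "supp r \<subseteq> S i" using supp_restrict_to unfolding r_def by blast
      then have rN: "r \<in> N" by (rule component_in_N[OF i(1) rU])
      define g where "g = finv r \<circ> f"
      have gU: "g \<in> unipotent" unfolding g_def by (intro unipotent_comp unipotent_finv rU less.prems)
      have gin: "g s = s" if "s \<in> S i" for s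
        using pl_inv_f[OF pr, of s] that by (simp add: g_def r_def restrict_to_def)
      have gout: "g s = f s" if "s \<notin> S i" for s
      proof -
        have "f s \<notin> S i" using component_iff[OF fG i(1)] that by simp
        then have "r (f s) = f s" by (simp add: r_def restrict_to_def)
        then show ?thesis using pl_inv_f[OF pr, of "f s"] by (simp add: g_def)
      qed
      let ?T = "\<lambda>f. {i \<in> I. \<exists>t\<in>S i. f t \<noteq> t}"
      have "?T g \<subseteq> ?T f" using gin gout by (smt (verit) Collect_mono)
      moreover have "i \<in> ?T f - ?T g" using i t gin by auto
      ultimately have "card (?T g) < card (?T f)"
        by (intro psubset_card_mono finite_moved_components fG) auto
      then have "g \<in> N" using less.hyps gU by blast
      moreover have "f = r \<circ> g" by (simp add: g_def comp_assoc[symmetric] finv_comp_self(2)[OF pr])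
      ultimately show ?thesis using N_comp[OF rN] by simp
    qed
  qed
qed

end

section \<open>Comparison of the two subgroups with the unipotent elements\<close>

context pl_intervals begin

lemma unipotent_subset_derived: "unipotent \<subseteq> derived grp (carrier grp)"
proof -
  have com: "f \<circ> g \<circ> finv f \<circ> finv g \<in> derived grp (carrier grp)" if "f \<in> carrier grp" "g \<in> carrier grp" for f g
  proof -
    have "f \<otimes>\<^bsub>grp\<^esub> g \<otimes>\<^bsub>grp\<^esub> inv\<^bsub>grp\<^esub> f \<otimes>\<^bsub>grp\<^esub> inv\<^bsub>grp\<^esub> g \<in> derived grp (carrier grp)"
      unfolding derived_def by (rule generate.incl) (use that in blast)
    then show ?thesis using that by (simp add: mult_grp inv_grp)
  qed
  interpret large_normal_pl F S I "derived grp (carrier grp)"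
  proof (intro large_normal_pl.intro large_normal_pl_axioms.intro normal_pl.intro normal_pl_axioms.intro
      pl_intervals_axioms G.derived_self_is_normal)
    show "f \<circ> g \<circ> finv f \<circ> finv g \<in> derived grp (carrier grp)"
      if "i \<in> I" "f \<in> compact_part i" "g \<in> compact_part i" for i f g
      using com compact_part_subset[OF that(1)] that by blast
    show "\<exists>x \<kappa> e. x \<in> carrier grp \<and> supp x \<subseteq> S i \<and> germ \<Phi> x \<kappa> e \<and> (\<kappa>, e) \<noteq> (1, 0) \<and>
          (\<forall>g\<in>carrier grp. x \<circ> g \<circ> finv x \<circ> finv g \<in> derived grp (carrier grp))"
      if i: "i \<in> I" "\<Phi> \<in> ends i" "\<Phi> = at_top \<or> \<Phi> = at_bot" for i \<Phi>
    proof -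
      obtain x where "x \<in> carrier grp" "supp x \<subseteq> S i" "germ \<Phi> x 2 0"
        using end_element[OF i eventually_True, of 2 0] numeral_mem zero_mem by auto
      then show ?thesis using com by (intro exI[of _ x] exI[of _ 2] exI[of _ 0]) auto
    qed
  qed
  show ?thesis by (rule unipotent_subset_N)
qed

text \<open>The restriction of \<open>x\<close> to an interval centralizes \<open>x\<close>, and so
  does every group element supported where \<open>x\<close> is the identity. On each interval one of
  the two provides a nontrivial element of \<open>N\<close>, the input to Higman's argument.\<close>

lemma unipotent_subset_normal:
  assumes N: "N \<lhd> grp" and x: "x \<in> carrier grp" and cent: "centralizer grp x \<subseteq> N"
  shows "unipotent \<subseteq> N"
proof -
  interpret normal_pl F S I N
    by (intro normal_pl.intro normal_pl_axioms.intro pl_intervals_axioms N)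
  have cN: "g \<in> N" if "g \<in> carrier grp" "g \<circ> x = x \<circ> g" for g
    using cent that by (auto simp: centralizer_def mult_grp)
  have px: "pl x" by (rule grp_pl[OF x])
  have restr: "restrict_to (S i) x \<in> N" if i: "i \<in> I" for i
  proof (rule cN[OF restrict_to_in_grp[OF x i]])
    show "restrict_to (S i) x \<circ> x = x \<circ> restrict_to (S i) x"
      using component_iff[OF x i] by (auto simp: fun_eq_iff restrict_to_def)
  qed
  have com: "y \<circ> g \<circ> finv y \<circ> finv g \<in> N" if "y \<in> N" "g \<in> carrier grp" for y g
  proof -
    have "y \<circ> (g \<circ> finv y \<circ> finv g) \<in> N" by (intro N_comp N_conj N_finv that)
    then show ?thesis by (simp add: comp_assoc)
  qed
  have nontriv: "\<exists>y\<in>N. supp y \<subseteq> S i \<and> y \<noteq> id" if i: "i \<in> I" for i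
  proof (cases "\<exists>t\<in>S i. x t \<noteq> t")
    case True
    then obtain t where "t \<in> S i" "x t \<noteq> t" by blast
    then have "restrict_to (S i) x t \<noteq> t" by (simp add: restrict_to_def)
    then have "restrict_to (S i) x \<noteq> id" by auto
    then show ?thesis using restr[OF i] supp_restrict_to by blast
  next
    case False
    obtain m where "m \<in> interior (S i)" using int_nonempty[OF i] by blast
    then obtain a b where ab: "a \<in> F" "b \<in> F" "a < m" "m < b" "a \<in> interior (S i)" "b \<in> interior (S i)"
      using interior_beyond[OF i] by metis
    define p where "p = (a + b) / 2"
    define q where "q = (p + b) / 2"
    have p: "a < p" "p < b" "p \<in> F" using ab by (auto simp: p_def intro!: mem_intros)
    have q: "a < q" "q < b" "q \<in> F" "q \<noteq> p" using ab p by (auto simp: q_def intro!: mem_intros)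
    let ?t = "tent a p q b"
    have "{a..b} \<subseteq> S i" using interior_between[OF i ab(5,6)] interior_subset by blast
    then have s: "supp ?t \<subseteq> S i" using supp_tent[OF p(1,2)] by blast
    have pt: "pl ?t" using ab p q by (intro pl_tent) auto
    have "supp ?t \<inter> supp x = {}" using False s by (auto simp: supp_def)
    then have "?t \<circ> x = x \<circ> ?t" by (rule commute_disjoint_supp[OF pt px])
    moreover have "?t \<in> carrier grp" using pt s i by (auto simp: carrier_grp region_def)
    ultimately have "?t \<in> N" by (intro cN)
    moreover have "?t p \<noteq> p" using p q by (simp add: tent_def)
    then have "?t \<noteq> id" by auto
    ultimately show ?thesis using s by blast
  qed
  interpret large_normal_pl F S I N
  proof
    show "f \<circ> g \<circ> finv f \<circ> finv g \<in> N" if "i \<in> I" "f \<in> compact_part i" "g \<in> compact_part i" for i f g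
      using nontriv[OF that(1)] commutators_in_N that by blast
    show "\<exists>x \<kappa> e. x \<in> carrier grp \<and> supp x \<subseteq> S i \<and> germ \<Phi> x \<kappa> e \<and> (\<kappa>, e) \<noteq> (1, 0) \<and>
          (\<forall>g\<in>carrier grp. x \<circ> g \<circ> finv x \<circ> finv g \<in> N)"
      if i: "i \<in> I" "\<Phi> \<in> ends i" "\<Phi> = at_top \<or> \<Phi> = at_bot" for i \<Phi>
    proof -
      obtain \<kappa> e where xe: "germ \<Phi> x \<kappa> e" using end_affine_germ[OF i(2) x] by blast
      \<comment> \<open>If \<open>x\<close> is the identity near the end, a map of slope 2 supported
        in that neighbourhood centralizes \<open>x\<close>; otherwise the restriction of
        \<open>x\<close> already has a nontrivial germ.\<close>
      have "\<exists>y\<in>N. \<exists>\<kappa> e. supp y \<subseteq> S i \<and> germ \<Phi> y \<kappa> e \<and> (\<kappa>, e) \<noteq> (1, 0)"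
      proof (cases "(\<kappa>, e) = (1, 0)")
        case True
        then have "\<forall>\<^sub>F y in \<Phi>. x y = y" using xe by (simp add: germ_def)
        then obtain g where g: "g \<in> carrier grp" "supp g \<subseteq> S i" "\<And>y. y \<in> supp g \<Longrightarrow> x y = y" "germ \<Phi> g 2 0"
          using end_element[OF i, of "\<lambda>y. x y = y" 2 0] numeral_mem zero_mem by auto
        have "supp g \<inter> supp x = {}" using g(3) by (auto simp: supp_def)
        then have "g \<in> N" using commute_disjoint_supp[OF grp_pl[OF g(1)] px] cN g(1) by blast
        then show ?thesis using g(2,4) by (intro bexI[of _ g] exI[of _ 2] exI[of _ 0]) auto
      next
        case False
        have "\<forall>\<^sub>F y in \<Phi>. y \<in> S i" using i(2) by (simp add: ends_def)
        then have "\<forall>\<^sub>F y in \<Phi>. restrict_to (S i) x y = x y" by eventually_elim (simp add: restrict_to_def)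
        then have "germ \<Phi> (restrict_to (S i) x) \<kappa> e" using xe germ_cong by blast
        then show ?thesis using False restr[OF i(1)] supp_restrict_to by blast
      qed
      then show ?thesis using com N_carrier by blast
    qed
  qed
  show ?thesis by (rule unipotent_subset_N)
qed

lemma pseudocentre_grp: "pseudocentre grp = derived grp (carrier grp)"
proof
  show "pseudocentre grp \<subseteq> derived grp (carrier grp)"
    using pseudocentre_subset_unipotent unipotent_subset_derived by blast
  show "derived grp (carrier grp) \<subseteq> pseudocentre grp"
    using derived_subset_unipotent unipotent_subset_normal
    unfolding pseudocentre_def normal_closure_def by blast
qed

end

text \<open>Passes from the record structure on the type \<open>real\<close> to closure conditions
  for the ordinary operations; zero is the only case in which the two notions of inverse have to be
  treated separately.\<close>

lemma real_subfieldI: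
  assumes "subfield F (ring_of_type_algebra :: real ring)"
  shows "real_subfield F"
proof -
  let ?R = "ring_of_type_algebra :: real ring"
  interpret R: field ?R by (rule field_from_type_algebra)
  note s = subringE[OF subfieldE(1)[OF assms]]
  have ops: "\<zero>\<^bsub>?R\<^esub> = 0" "\<one>\<^bsub>?R\<^esub> = 1" "x \<otimes>\<^bsub>?R\<^esub> y = x * y" "x \<oplus>\<^bsub>?R\<^esub> y = x + y" "carrier ?R = UNIV" for x y
    by (simp_all add: ring_of_type_algebra_def)
  have neg: "\<ominus>\<^bsub>?R\<^esub> x = - x" for x
    using R.minus_equality[of "- x" x] by (simp add: ops)
  show ?thesis
  proof
    show "1 \<in> F" using s(3) by (simp add: ops)
    show "x - y \<in> F" if "x \<in> F" "y \<in> F" for x y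
      using s(7)[OF that(1) s(5)[OF that(2)]] by (simp add: ops neg)
    show "x * y \<in> F" if "x \<in> F" "y \<in> F" for x y
      using s(6)[OF that] by (simp add: ops)
    show "inverse x \<in> F" if "x \<in> F" for x
    proof (cases "x = 0")
      case False
      then have x: "x \<in> F - {\<zero>\<^bsub>?R\<^esub>}" using that by (simp add: ops)
      have "x * inv\<^bsub>?R\<^esub> x = 1" using R.subfield_m_inv(2)[OF assms x] by (simp add: ops)
      then have "inv\<^bsub>?R\<^esub> x = inverse x" using inverse_unique by metis
      then show ?thesis using R.subfield_m_inv(1)[OF assms x] by auto
    qed (use that in simp)
  qed
qed

theorem theorem9p10:
  fixes S :: "'i \<Rightarrow> real set" and I :: "'i set" and F :: "real set"
  assumes "\<And>i. i \<in> I \<Longrightarrow> nondegenerate_interval (S i)"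
    and "\<And>i j. i \<in> I \<Longrightarrow> j \<in> I \<Longrightarrow> i \<noteq> j \<Longrightarrow> closure (S i) \<inter> closure (S j) = {}"
    and "subfield F (ring_of_type_algebra :: real ring)"
  shows "pseudocentre (PL_grp (\<Union>i\<in>I. S i) F {x \<in> F. x > 0})
       = derived (PL_grp (\<Union>i\<in>I. S i) F {x \<in> F. x > 0})
                 (carrier (PL_grp (\<Union>i\<in>I. S i) F {x \<in> F. x > 0}))"
proof -
  interpret real_subfield F by (rule real_subfieldI[OF assms(3)])
  interpret pl_intervals F S I by unfold_locales (use assms(1,2) in blast)+
  show ?thesis using pseudocentre_grp by (simp add: grp_def region_def)
qed

end
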